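(* Let $\Lambda_i=(V_i,E_i)$, $i=1,2$, be hypergraphs. The following are equivalent: (i) $\Lambda_1\cong_{\rm qc}\Lambda_2$; (ii) $\Lambda_1\cong_{{\rm C}^*}\Lambda_2$; (iii) $\Lambda_1\cong_{A^*}\Lambda_2$.
   Context: Algebras are over $\mathbb C$. A hypergraph $\Lambda=(V,E)$ consists of a finite set $V$ of vertices and a finite non-empty family $E$ of hyperedges, each $e\in E$ being identified with a subset of $V$; repeated hyperedges are allowed, and two hyperedges are equal only if they are the same element of $E$. All hypergraphs are assumed full: every vertex lies in some hyperedge. The hypergraph isomorphism game $\mathrm{HypIso}(\Lambda_1,\Lambda_2)$ has all question and answer sets equal to $X:=V_1\sqcup V_2\sqcup E_1\sqcup E_2$ and rule function $\lambda:X^4\to\{0,1\}$, where $\lambda(x,y,a,b)=1$ ($x,y$ questions, $a,b$ answers) iff: (i) if $x\in V_i$ then $a\in V_{3-i}$, if $x\in E_i$ then $a\in E_{3-i}$, and similarly for $(y,b)$; (ii) if $x\in V_i$ and $y\in E_i$, then $x\in y\iff a\in b$; (iii) if $x,y$ are both vertices, let $v_A,w_A$ be the elements of $\{x,a\}$ in $V_1,V_2$ and $v_B,w_B$ those of $\{y,b\}$ in $V_1,V_2$; then the relation between $v_A,v_B$ in $\Lambda_1$ (equal / adjacent, i.e. distinct and in a common hyperedge / distinct non-adjacent) is the same as that between $w_A,w_B$ in $\Lambda_2$; (iv) if $x,y$ are both hyperedges, with the analogous notation $e_A,e_B\in E_1$, $f_A,f_B\in E_2$, the relation between $e_A,e_B$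 (equal / intersecting, i.e. distinct with non-empty intersection / disjoint) is the same as that between $f_A,f_B$. The game $*$-algebra $\mathcal A(\mathrm{HypIso}(\Lambda_1,\Lambda_2))$ is the universal unital $*$-algebra generated by $\{e_{x,a}:x,a\in X\}$ with $e_{x,a}=e_{x,a}^*=e_{x,a}^2$, $\sum_ae_{x,a}=1$ for each $x$, and $e_{x,a}e_{y,b}=0$ whenever $\lambda(x,y,a,b)=0$. $\Lambda_1\cong_{\rm qc}\Lambda_2$ means the game has a perfect quantum commuting strategy: there are a Hilbert space $H$, a unit vector $\xi\in H$ and POVMs (families of positive operators summing to $I$) $(E_{x,a})_{a\in X}$, $(F_{y,b})_{b\in X}$ on $H$, $x,y\in X$, with $E_{x,a}F_{y,b}=F_{y,b}E_{x,a}$, such that $p(a,b|x,y):=\langle E_{x,a}F_{y,b}\xi,\xi\rangle$ vanishes whenever $\lambda(x,y,a,b)=0$. $\Lambda_1\cong_{{\rm C}^*}\Lambda_2$ means $\mathcal A(\mathrm{HypIso}(\Lambda_1,\Lambda_2))$ admits a unital $*$-representation into $\mathcal B(H)$ for some non-zero Hilbert space $H$. $\Lambda_1\cong_{A^*}\Lambda_2$ means $\mathcal A(\mathrm{HypIso}(\Lambda_1,\Lambda_2))\neq0$. *)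

theory Defs
  imports "HOL-Analysis.Analysis" "HOL-Algebra.QuotRing" "HOL-Algebra.Module"
begin

section \<open>Hypergraphs\<close>

text \<open>Hyperedges are abstract labels with an incidence map, so that different hyperedges may
  have the same underlying vertex set.\<close>

record ('v, 'e) hypergraph =
  verts :: "'v set"
  hedges :: "'e set"
  incid :: "'e \<Rightarrow> 'v set"

locale hypergraph =
  fixes \<Lambda> :: "('v, 'e) hypergraph"
  assumes finite_verts: "finite (verts \<Lambda>)"
    and finite_hedges: "finite (hedges \<Lambda>)"
    and hedges_nonempty: "hedges \<Lambda> \<noteq> {}"
    and incid_subset: "\<And>e. e \<in> hedges \<Lambda> \<Longrightarrow> incid \<Lambda> e \<subseteq> verts \<Lambda>"
    and full: "\<And>v. v \<in> verts \<Lambda> \<Longrightarrow> \<exists>e \<in> hedges \<Lambda>. v \<in> incid \<Lambda> e"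

datatype vertex_relation = Equal_vertices | Adjacent | Non_adjacent

definition vertex_rel :: "('v, 'e) hypergraph \<Rightarrow> 'v \<Rightarrow> 'v \<Rightarrow> vertex_relation" where
  "vertex_rel \<Lambda> v w =
     (if v = w then Equal_vertices
      else if \<exists>e \<in> hedges \<Lambda>. v \<in> incid \<Lambda> e \<and> w \<in> incid \<Lambda> e then Adjacent
      else Non_adjacent)"

datatype hedge_relation = Equal_hedges | Intersecting | Disjoint

definition hedge_rel :: "('v, 'e) hypergraph \<Rightarrow> 'e \<Rightarrow> 'e \<Rightarrow> hedge_relation" where
  "hedge_rel \<Lambda> e f =
     (if e = f then Equal_hedges
      else if incid \<Lambda> e \<inter> incid \<Lambda> f \<noteq> {} then Intersecting
      else Disjoint)"


section \<open>The hypergraph isomorphism game\<close>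

datatype ('v1, 'e1, 'v2, 'e2) item = Vtx1 'v1 | Vtx2 'v2 | Edg1 'e1 | Edg2 'e2

definition iso_items ::
  "('v1, 'e1) hypergraph \<Rightarrow> ('v2, 'e2) hypergraph \<Rightarrow> ('v1, 'e1, 'v2, 'e2) item set" where
  "iso_items \<Lambda>1 \<Lambda>2 =
     Vtx1 ` verts \<Lambda>1 \<union> Vtx2 ` verts \<Lambda>2 \<union> Edg1 ` hedges \<Lambda>1 \<union> Edg2 ` hedges \<Lambda>2"

text \<open>Whether an answer \<open>a\<close> to a question \<open>x\<close> has the required kind.\<close>

fun admissible :: "('v1, 'e1, 'v2, 'e2) item \<Rightarrow> ('v1, 'e1, 'v2, 'e2) item \<Rightarrow> bool" where
  "admissible (Vtx1 v) a \<longleftrightarrow> a \<in> range Vtx2"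
| "admissible (Vtx2 w) a \<longleftrightarrow> a \<in> range Vtx1"
| "admissible (Edg1 e) a \<longleftrightarrow> a \<in> range Edg2"
| "admissible (Edg2 f) a \<longleftrightarrow> a \<in> range Edg1"

text \<open>Arguments of the rule predicate are in the order \<open>x y a b\<close>: the two questions, then the
  two answers. It is only used for arguments in \<^term>\<open>iso_items \<Lambda>1 \<Lambda>2\<close>.\<close>

definition hyp_iso_rule ::
  "('v1, 'e1) hypergraph \<Rightarrow> ('v2, 'e2) hypergraph \<Rightarrow>
   ('v1, 'e1, 'v2, 'e2) item \<Rightarrow> ('v1, 'e1, 'v2, 'e2) item \<Rightarrow>
   ('v1, 'e1, 'v2, 'e2) item \<Rightarrow> ('v1, 'e1, 'v2, 'e2) item \<Rightarrow> bool" where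
  "hyp_iso_rule \<Lambda>1 \<Lambda>2 x y a b \<longleftrightarrow>
     admissible x a \<and> admissible y b \<and>
     (\<forall>v e w f. x = Vtx1 v \<and> y = Edg1 e \<and> a = Vtx2 w \<and> b = Edg2 f \<longrightarrow>
        (v \<in> incid \<Lambda>1 e \<longleftrightarrow> w \<in> incid \<Lambda>2 f)) \<and>
     (\<forall>v e w f. x = Vtx2 w \<and> y = Edg2 f \<and> a = Vtx1 v \<and> b = Edg1 e \<longrightarrow>
        (w \<in> incid \<Lambda>2 f \<longleftrightarrow> v \<in> incid \<Lambda>1 e)) \<and>
     (\<forall>vA wA vB wB. {x, a} = {Vtx1 vA, Vtx2 wA} \<and> {y, b} = {Vtx1 vB, Vtx2 wB} \<longrightarrow>
        vertex_rel \<Lambda>1 vA vB = vertex_rel \<Lambda>2 wA wB) \<and>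
     (\<forall>eA fA eB fB. {x, a} = {Edg1 eA, Edg2 fA} \<and> {y, b} = {Edg1 eB, Edg2 fB} \<longrightarrow>
        hedge_rel \<Lambda>1 eA eB = hedge_rel \<Lambda>2 fA fB)"


section \<open>Complex unital *-algebras\<close>

record 'a star_algebra = "(complex, 'a) module" +
  star :: "'a \<Rightarrow> 'a"

definition star_hom :: "'a star_algebra \<Rightarrow> 'b star_algebra \<Rightarrow> ('a \<Rightarrow> 'b) set" where
  "star_hom A B =
     {h \<in> ring_hom A B.
        (\<forall>c. \<forall>x \<in> carrier A. h (c \<odot>\<^bsub>A\<^esub> x) = c \<odot>\<^bsub>B\<^esub> h x) \<and>
        (\<forall>x \<in> carrier A. h (star A x) = star B (h x))}"

definition gen_star_ideal :: "'a star_algebra \<Rightarrow> 'a set \<Rightarrow> 'a set" where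
  "gen_star_ideal A S =
     \<Inter>{I. ideal I A \<and> (\<forall>c. \<forall>x \<in> I. c \<odot>\<^bsub>A\<^esub> x \<in> I) \<and> (\<forall>x \<in> I. star A x \<in> I) \<and> S \<subseteq> I}"

text \<open>The unions follow the pattern of \<^const>\<open>rcoset_mult\<close>: they do not depend on a choice of
  representatives, and the scalar \<open>0\<close> sends every coset to \<open>I\<close>.\<close>

definition quot_star_algebra :: "'a star_algebra \<Rightarrow> 'a set \<Rightarrow> 'a set star_algebra" where
  "quot_star_algebra A I =
     \<lparr>carrier = carrier (A Quot I), mult = mult (A Quot I), one = one (A Quot I),
      ring.zero = ring.zero (A Quot I), add = add (A Quot I),
      smult = (\<lambda>c K. \<Union>x \<in> K. I +>\<^bsub>A\<^esub> (c \<odot>\<^bsub>A\<^esub> x)),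
      star = (\<lambda>K. \<Union>x \<in> K. I +>\<^bsub>A\<^esub> star A x)\<rparr>"


subsection \<open>The free unital *-algebra on a set\<close>

text \<open>Words are lists of letters \<open>(g, False)\<close>, standing for a generator \<open>g\<close>, and \<open>(g, True)\<close>,
  standing for its adjoint. Elements are finitely supported complex functions on words, with
  convolution over the factorisations of a word as product.\<close>

definition free_star_algebra :: "'g set \<Rightarrow> (('g \<times> bool) list \<Rightarrow> complex) star_algebra" where
  "free_star_algebra G =
     \<lparr>carrier = {p. finite {w. p w \<noteq> 0} \<and> {w. p w \<noteq> 0} \<subseteq> lists (G \<times> UNIV)},
      mult = (\<lambda>p q w. \<Sum>k\<le>length w. p (take k w) * q (drop k w)),
      one = (\<lambda>w. of_bool (w = [])),
      ring.zero = (\<lambda>w. 0),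
      add = (\<lambda>p q w. p w + q w),
      smult = (\<lambda>c p w. c * p w),
      star = (\<lambda>p w. cnj (p (rev (map (\<lambda>(g, s). (g, \<not> s)) w))))\<rparr>"

lemma free_star_algebra_carrierI:
  assumes "finite B" "{w. p w \<noteq> 0} \<subseteq> B" "B \<subseteq> lists (G \<times> UNIV)"
  shows "p \<in> carrier (free_star_algebra G)"
proof -
  have "finite {w. p w \<noteq> 0}" using assms(1,2) by (rule rev_finite_subset)
  moreover have "{w. p w \<noteq> 0} \<subseteq> lists (G \<times> UNIV)" using assms(2,3) by (rule order_trans)
  ultimately show ?thesis by (simp add: free_star_algebra_def)
qed

lemma free_star_algebra_carrierD:
  assumes "p \<in> carrier (free_star_algebra G)"
  shows "finite {w. p w \<noteq> 0}" "{w. p w \<noteq> 0} \<subseteq> lists (G \<times> UNIV)"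
  using assms by (simp_all add: free_star_algebra_def)

lemma free_star_algebra_mult_closed:
  assumes "p \<in> carrier (free_star_algebra G)" "q \<in> carrier (free_star_algebra G)"
  shows "p \<otimes>\<^bsub>free_star_algebra G\<^esub> q \<in> carrier (free_star_algebra G)"
proof -
  let ?S = "\<lambda>p :: ('a \<times> bool) list \<Rightarrow> complex. {w. p w \<noteq> 0}"
  have "?S (p \<otimes>\<^bsub>free_star_algebra G\<^esub> q) \<subseteq> (\<lambda>(u, v). u @ v) ` (?S p \<times> ?S q)"
  proof
    fix w assume "w \<in> ?S (p \<otimes>\<^bsub>free_star_algebra G\<^esub> q)"
    then have "(\<Sum>k\<le>length w. p (take k w) * q (drop k w)) \<noteq> 0"
      by (simp add: free_star_algebra_def)
    then obtain k where "p (take k w) * q (drop k w) \<noteq> 0"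
      by (meson sum.not_neutral_contains_not_neutral)
    then have "(take k w, drop k w) \<in> ?S p \<times> ?S q" by simp
    then show "w \<in> (\<lambda>(u, v). u @ v) ` (?S p \<times> ?S q)"
      by (metis (mono_tags, lifting) append_take_drop_id case_prod_conv image_eqI)
  qed
  moreover have "finite ((\<lambda>(u, v). u @ v) ` (?S p \<times> ?S q))"
    using assms[THEN free_star_algebra_carrierD(1)] by simp
  moreover have "(\<lambda>(u, v). u @ v) ` (?S p \<times> ?S q) \<subseteq> lists (G \<times> UNIV)"
    using assms[THEN free_star_algebra_carrierD(2)] by fastforce
  ultimately show ?thesis by (intro free_star_algebra_carrierI)
qed

lemma free_star_algebra_mult_assoc:
  "p \<otimes>\<^bsub>free_star_algebra G\<^esub> q \<otimes>\<^bsub>free_star_algebra G\<^esub> r =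
   p \<otimes>\<^bsub>free_star_algebra G\<^esub> (q \<otimes>\<^bsub>free_star_algebra G\<^esub> r)"
proof
  fix w
  let ?f = "\<lambda>i j (l::nat). p (take i w) * q (take j (drop i w)) * r (drop (i + j) w)"
  let ?n = "length w"
  have "(p \<otimes>\<^bsub>free_star_algebra G\<^esub> q \<otimes>\<^bsub>free_star_algebra G\<^esub> r) w =
      (\<Sum>k=0..?n. \<Sum>j=0..k. ?f j (k - j) (?n - k))"
    by (auto simp: free_star_algebra_def atLeast0AtMost sum_distrib_right min_absorb1
        min_absorb2 drop_take intro!: sum.cong)
  also have "\<dots> = (\<Sum>j=0..?n. \<Sum>i=0..?n - j. ?f j i (?n - j - i))"
    by (rule fps_mult_assoc_lemma)
  also have "\<dots> = (p \<otimes>\<^bsub>free_star_algebra G\<^esub> (q \<otimes>\<^bsub>free_star_algebra G\<^esub> r)) w"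
    by (simp add: free_star_algebra_def atLeast0AtMost sum_distrib_left mult.assoc add.commute)
  finally show "(p \<otimes>\<^bsub>free_star_algebra G\<^esub> q \<otimes>\<^bsub>free_star_algebra G\<^esub> r) w =
    (p \<otimes>\<^bsub>free_star_algebra G\<^esub> (q \<otimes>\<^bsub>free_star_algebra G\<^esub> r)) w" .
qed

lemma ring_free_star_algebra: "ring (free_star_algebra G)"
proof (rule ringI)
  let ?A = "free_star_algebra G"
  show "abelian_group ?A"
  proof (rule abelian_groupI)
    show "p \<oplus>\<^bsub>?A\<^esub> q \<in> carrier ?A" if "p \<in> carrier ?A" "q \<in> carrier ?A" for p q
    proof (rule free_star_algebra_carrierI)
      show "{w. (p \<oplus>\<^bsub>?A\<^esub> q) w \<noteq> 0} \<subseteq> {w. p w \<noteq> 0} \<union> {w. q w \<noteq> 0}"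
        by (auto simp: free_star_algebra_def)
    qed (use that[THEN free_star_algebra_carrierD(1)] that[THEN free_star_algebra_carrierD(2)]
        in auto)
    show "\<exists>q \<in> carrier ?A. q \<oplus>\<^bsub>?A\<^esub> p = \<zero>\<^bsub>?A\<^esub>" if "p \<in> carrier ?A" for p
      using that by (intro bexI[of _ "\<lambda>w. - p w"]) (auto simp: free_star_algebra_def)
  qed (auto simp: free_star_algebra_def add.assoc add.commute)
  show "Group.monoid ?A"
  proof (rule monoidI)
    show "\<one>\<^bsub>?A\<^esub> \<in> carrier ?A" by (auto simp: free_star_algebra_def)
    show "p \<otimes>\<^bsub>?A\<^esub> q \<in> carrier ?A" if "p \<in> carrier ?A" "q \<in> carrier ?A" for p q
      by (rule free_star_algebra_mult_closed[OF that])
    show "p \<otimes>\<^bsub>?A\<^esub> q \<otimes>\<^bsub>?A\<^esub> r = p \<otimes>\<^bsub>?A\<^esub> (q \<otimes>\<^bsub>?A\<^esub> r)" for p q r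
      by (rule free_star_algebra_mult_assoc)
    show "\<one>\<^bsub>?A\<^esub> \<otimes>\<^bsub>?A\<^esub> p = p" for p
    proof
      fix w
      have "(\<Sum>k\<le>length w. of_bool (take k w = []) * p (drop k w)) =
          (\<Sum>k\<in>{0}. of_bool (take k w = []) * p (drop k w))"
        by (rule sum.mono_neutral_right) auto
      then show "(\<one>\<^bsub>?A\<^esub> \<otimes>\<^bsub>?A\<^esub> p) w = p w" by (simp add: free_star_algebra_def)
    qed
    show "p \<otimes>\<^bsub>?A\<^esub> \<one>\<^bsub>?A\<^esub> = p" for p
    proof
      fix w
      have "(\<Sum>k\<le>length w. p (take k w) * of_bool (drop k w = [])) =
          (\<Sum>k\<in>{length w}. p (take k w) * of_bool (drop k w = []))"
        by (rule sum.mono_neutral_right) auto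
      then show "(p \<otimes>\<^bsub>?A\<^esub> \<one>\<^bsub>?A\<^esub>) w = p w" by (simp add: free_star_algebra_def)
    qed
  qed
qed (auto simp: free_star_algebra_def algebra_simps sum.distrib)

lemma ideal_gen_star_ideal:
  assumes "S \<subseteq> carrier (free_star_algebra G)"
  shows "ideal (gen_star_ideal (free_star_algebra G) S) (free_star_algebra G)"
proof -
  let ?A = "free_star_algebra G"
  let ?C = "{I. ideal I ?A \<and> (\<forall>c. \<forall>x \<in> I. c \<odot>\<^bsub>?A\<^esub> x \<in> I) \<and>
    (\<forall>x \<in> I. star ?A x \<in> I) \<and> S \<subseteq> I}"
  have smult: "c \<odot>\<^bsub>?A\<^esub> p \<in> carrier ?A" if "p \<in> carrier ?A" for c p
  proof (rule free_star_algebra_carrierI)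
    show "{w. (c \<odot>\<^bsub>?A\<^esub> p) w \<noteq> 0} \<subseteq> {w. p w \<noteq> 0}"
      by (auto simp: free_star_algebra_def)
  qed (use that[THEN free_star_algebra_carrierD(1)] that[THEN free_star_algebra_carrierD(2)]
      in auto)
  have star: "star ?A p \<in> carrier ?A" if "p \<in> carrier ?A" for p
  proof -
    define f :: "('a \<times> bool) list \<Rightarrow> ('a \<times> bool) list"
      where "f = (\<lambda>w. rev (map (\<lambda>(g, s). (g, \<not> s)) w))"
    have inv: "f (f w) = w" for w
      by (simp add: f_def rev_map comp_def case_prod_unfold)
    have star_f: "star ?A p = (\<lambda>w. cnj (p (f w)))"
      by (simp add: free_star_algebra_def f_def)
    show ?thesis
    proof (rule free_star_algebra_carrierI)
      show "{w. star ?A p w \<noteq> 0} \<subseteq> f ` {w. p w \<noteq> 0}"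
      proof
        fix w assume "w \<in> {w. star ?A p w \<noteq> 0}"
        then have "f w \<in> {w. p w \<noteq> 0}" by (simp add: star_f)
        then show "w \<in> f ` {w. p w \<noteq> 0}" by (rule rev_image_eqI) (simp add: inv)
      qed
      show "finite (f ` {w. p w \<noteq> 0})"
        using free_star_algebra_carrierD(1)[OF that] by simp
      have "f w \<in> lists (G \<times> UNIV)" if "w \<in> lists (G \<times> UNIV)" for w
        using that by (auto simp: f_def in_lists_conv_set)
      then show "f ` {w. p w \<noteq> 0} \<subseteq> lists (G \<times> UNIV)"
        using free_star_algebra_carrierD(2)[OF that] by blast
    qed
  qed
  have "carrier ?A \<in> ?C"
    using ring.oneideal[OF ring_free_star_algebra] smult star assms by blast
  then have "ideal (\<Inter>?C) ?A"
    by (intro ring.i_Intersect[OF ring_free_star_algebra]) auto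
  then show ?thesis by (simp add: gen_star_ideal_def)
qed

definition free_gen :: "'g \<Rightarrow> ('g \<times> bool) list \<Rightarrow> complex" where
  "free_gen g = (\<lambda>w. of_bool (w = [(g, False)]))"


section \<open>The *-algebra of a game\<close>

text \<open>Question and answer sets are all equal to \<open>X\<close>.\<close>

definition game_relations ::
  "'x set \<Rightarrow> ('x \<Rightarrow> 'x \<Rightarrow> 'x \<Rightarrow> 'x \<Rightarrow> bool) \<Rightarrow> ((('x \<times> 'x) \<times> bool) list \<Rightarrow> complex) set" where
  "game_relations X rule =
     (let A = free_star_algebra (X \<times> X); e = (\<lambda>x a. free_gen (x, a)) in
        {star A (e x a) \<ominus>\<^bsub>A\<^esub> e x a | x a. x \<in> X \<and> a \<in> X} \<union>
        {e x a \<otimes>\<^bsub>A\<^esub> e x a \<ominus>\<^bsub>A\<^esub> e x a | x a. x \<in> X \<and> a \<in> X} \<union>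
        {(\<Oplus>\<^bsub>A\<^esub>a\<in>X. e x a) \<ominus>\<^bsub>A\<^esub> \<one>\<^bsub>A\<^esub> | x. x \<in> X} \<union>
        {e x a \<otimes>\<^bsub>A\<^esub> e y b | x y a b.
           x \<in> X \<and> y \<in> X \<and> a \<in> X \<and> b \<in> X \<and> \<not> rule x y a b})"

lemma game_relations_subset:
  "game_relations X rule \<subseteq> carrier (free_star_algebra (X \<times> X))"
proof -
  let ?A = "free_star_algebra (X \<times> X)"
  interpret ring ?A by (rule ring_free_star_algebra)
  have gen: "free_gen (x, a) \<in> carrier ?A" if "x \<in> X" "a \<in> X" for x a
    using that by (auto simp: free_gen_def free_star_algebra_def)
  have star: "star ?A (free_gen (x, a)) \<in> carrier ?A" if "x \<in> X" "a \<in> X" for x a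
  proof (rule free_star_algebra_carrierI[of "{[((x, a), True)]}"])
    show "{w. star ?A (free_gen (x, a)) w \<noteq> 0} \<subseteq> {[((x, a), True)]}"
    proof safe
      fix w assume "star ?A (free_gen (x, a)) w \<noteq> 0"
      then have "rev (map (\<lambda>(g, s). (g, \<not> s)) w) = [((x, a), False)]"
        by (auto simp: free_star_algebra_def free_gen_def split: if_splits)
      then show "w = [((x, a), True)]" by (cases w) auto
    qed
  qed (use that in auto)
  show ?thesis using gen star unfolding game_relations_def Let_def by (auto simp: Pi_def)
qed

definition game_algebra ::
  "'x set \<Rightarrow> ('x \<Rightarrow> 'x \<Rightarrow> 'x \<Rightarrow> 'x \<Rightarrow> bool) \<Rightarrow>
   ((('x \<times> 'x) \<times> bool) list \<Rightarrow> complex) set star_algebra" where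
  "game_algebra X rule =
     quot_star_algebra (free_star_algebra (X \<times> X))
       (gen_star_ideal (free_star_algebra (X \<times> X)) (game_relations X rule))"


section \<open>Hilbert spaces and bounded operators\<close>

text \<open>Hilbert spaces have an explicit carrier, as they are existentially quantified below. The
  inner product is linear in the first argument. The fields \<^const>\<open>mult\<close> and \<^const>\<open>one\<close>
  inherited from \<open>module\<close> play no role.\<close>

definition complex_ring :: "complex ring" where
  "complex_ring = \<lparr>carrier = UNIV, mult = (*), one = 1, ring.zero = 0, add = (+)\<rparr>"

lemma field_complex_ring: "Ring.field complex_ring"
proof (rule cring.cring_fieldI2)
  show "cring complex_ring"
  proof (rule cringI)
    show "abelian_group complex_ring"
      by (rule abelian_groupI)
        (auto simp: complex_ring_def algebra_simps intro: exI[of _ "- x" for x])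
    show "comm_monoid complex_ring"
      by (rule comm_monoidI) (auto simp: complex_ring_def)
  qed (auto simp: complex_ring_def algebra_simps)
  show "\<zero>\<^bsub>complex_ring\<^esub> \<noteq> \<one>\<^bsub>complex_ring\<^esub>"
    by (simp add: complex_ring_def)
  show "\<exists>b \<in> carrier complex_ring. a \<otimes>\<^bsub>complex_ring\<^esub> b = \<one>\<^bsub>complex_ring\<^esub>"
    if "a \<in> carrier complex_ring" "a \<noteq> \<zero>\<^bsub>complex_ring\<^esub>" for a
    using that by (auto simp: complex_ring_def intro: exI[of _ "inverse a"])
qed

record 'h hilbert = "(complex, 'h) module" +
  cinner :: "'h \<Rightarrow> 'h \<Rightarrow> complex"

definition hnorm :: "'h hilbert \<Rightarrow> 'h \<Rightarrow> real" where
  "hnorm H v = sqrt (Re (cinner H v v))"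

locale hilbert_space = module complex_ring H
  for H :: "'h hilbert" (structure) +
  assumes cinner_add_left:
      "\<lbrakk>u \<in> carrier H; v \<in> carrier H; w \<in> carrier H\<rbrakk> \<Longrightarrow>
       cinner H (u \<oplus>\<^bsub>H\<^esub> v) w = cinner H u w + cinner H v w"
    and cinner_smult_left:
      "\<lbrakk>v \<in> carrier H; w \<in> carrier H\<rbrakk> \<Longrightarrow> cinner H (c \<odot>\<^bsub>H\<^esub> v) w = c * cinner H v w"
    and cinner_commute:
      "\<lbrakk>v \<in> carrier H; w \<in> carrier H\<rbrakk> \<Longrightarrow> cinner H v w = cnj (cinner H w v)"
    and cinner_pos:
      "\<lbrakk>v \<in> carrier H; v \<noteq> \<zero>\<^bsub>H\<^esub>\<rbrakk> \<Longrightarrow> 0 < Re (cinner H v v)"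
    and complete:
      "Metric_space.mcomplete (carrier H) (\<lambda>v w. hnorm H (v \<ominus>\<^bsub>H\<^esub> w))"

text \<open>Operators are extensional functions on the carrier, so that operators are equal if they
  agree on the carrier.\<close>

definition bounded_ops :: "'h hilbert \<Rightarrow> ('h \<Rightarrow> 'h) set" where
  "bounded_ops H =
     {T \<in> carrier H \<rightarrow>\<^sub>E carrier H.
        (\<forall>v \<in> carrier H. \<forall>w \<in> carrier H. T (v \<oplus>\<^bsub>H\<^esub> w) = T v \<oplus>\<^bsub>H\<^esub> T w) \<and>
        (\<forall>c. \<forall>v \<in> carrier H. T (c \<odot>\<^bsub>H\<^esub> v) = c \<odot>\<^bsub>H\<^esub> T v) \<and>
        (\<exists>K. \<forall>v \<in> carrier H. hnorm H (T v) \<le> K * hnorm H v)}"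

definition hadjoint :: "'h hilbert \<Rightarrow> ('h \<Rightarrow> 'h) \<Rightarrow> 'h \<Rightarrow> 'h" where
  "hadjoint H T =
     (THE S. S \<in> bounded_ops H \<and>
        (\<forall>v \<in> carrier H. \<forall>w \<in> carrier H. cinner H (T v) w = cinner H v (S w)))"

definition op_algebra :: "'h hilbert \<Rightarrow> ('h \<Rightarrow> 'h) star_algebra" where
  "op_algebra H =
     \<lparr>carrier = bounded_ops H,
      mult = (\<lambda>S T. compose (carrier H) S T),
      one = (\<lambda>v \<in> carrier H. v),
      ring.zero = (\<lambda>v \<in> carrier H. \<zero>\<^bsub>H\<^esub>),
      add = (\<lambda>S T. \<lambda>v \<in> carrier H. S v \<oplus>\<^bsub>H\<^esub> T v),
      smult = (\<lambda>c T. \<lambda>v \<in> carrier H. c \<odot>\<^bsub>H\<^esub> T v),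
      star = hadjoint H\<rparr>"

definition positive_op :: "'h hilbert \<Rightarrow> ('h \<Rightarrow> 'h) \<Rightarrow> bool" where
  "positive_op H T \<longleftrightarrow>
     T \<in> bounded_ops H \<and> (\<forall>v \<in> carrier H. cinner H (T v) v \<in> \<real>\<^sub>\<ge>\<^sub>0)"

definition povm :: "'h hilbert \<Rightarrow> 'a set \<Rightarrow> ('a \<Rightarrow> 'h \<Rightarrow> 'h) \<Rightarrow> bool" where
  "povm H A P \<longleftrightarrow>
     (\<forall>a \<in> A. positive_op H (P a)) \<and>
     (\<Oplus>\<^bsub>op_algebra H\<^esub>a\<in>A. P a) = \<one>\<^bsub>op_algebra H\<^esub>"


section \<open>Notions of isomorphism\<close>

text \<open>HOL cannot quantify over types inside a formula. The type argument \<open>'h\<close> is the type whose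
  subsets serve as carriers of the Hilbert spaces under consideration. It has to be large enough:
  a non-zero complex Hilbert space contains a copy of \<open>complex\<close>, so if there is no injection from
  \<open>complex\<close> into \<open>'h\<close>, then \<open>'h\<close> does not carry any non-zero Hilbert space.\<close>

definition perfect_qc_strategy ::
  "'h itself \<Rightarrow> 'x set \<Rightarrow> ('x \<Rightarrow> 'x \<Rightarrow> 'x \<Rightarrow> 'x \<Rightarrow> bool) \<Rightarrow> bool" where
  "perfect_qc_strategy TYPE('h) X rule \<longleftrightarrow>
     (\<exists>(H :: 'h hilbert) \<xi> P Q.
        hilbert_space H \<and> \<xi> \<in> carrier H \<and> hnorm H \<xi> = 1 \<and>
        (\<forall>x \<in> X. povm H X (P x)) \<and> (\<forall>y \<in> X. povm H X (Q y)) \<and>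
        (\<forall>x \<in> X. \<forall>y \<in> X. \<forall>a \<in> X. \<forall>b \<in> X.
           P x a \<otimes>\<^bsub>op_algebra H\<^esub> Q y b = Q y b \<otimes>\<^bsub>op_algebra H\<^esub> P x a) \<and>
        (\<forall>x \<in> X. \<forall>y \<in> X. \<forall>a \<in> X. \<forall>b \<in> X.
           \<not> rule x y a b \<longrightarrow> cinner H ((P x a \<otimes>\<^bsub>op_algebra H\<^esub> Q y b) \<xi>) \<xi> = 0))"

definition qc_isomorphic ::
  "'h itself \<Rightarrow> ('v1, 'e1) hypergraph \<Rightarrow> ('v2, 'e2) hypergraph \<Rightarrow> bool" where
  "qc_isomorphic TYPE('h) \<Lambda>1 \<Lambda>2 \<longleftrightarrow>
     perfect_qc_strategy TYPE('h) (iso_items \<Lambda>1 \<Lambda>2) (hyp_iso_rule \<Lambda>1 \<Lambda>2)"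

definition hyp_iso_algebra ::
  "('v1, 'e1) hypergraph \<Rightarrow> ('v2, 'e2) hypergraph \<Rightarrow>
   (((('v1, 'e1, 'v2, 'e2) item \<times> ('v1, 'e1, 'v2, 'e2) item) \<times> bool) list \<Rightarrow> complex) set
   star_algebra" where
  "hyp_iso_algebra \<Lambda>1 \<Lambda>2 = game_algebra (iso_items \<Lambda>1 \<Lambda>2) (hyp_iso_rule \<Lambda>1 \<Lambda>2)"

definition cstar_isomorphic ::
  "'h itself \<Rightarrow> ('v1, 'e1) hypergraph \<Rightarrow> ('v2, 'e2) hypergraph \<Rightarrow> bool" where
  "cstar_isomorphic TYPE('h) \<Lambda>1 \<Lambda>2 \<longleftrightarrow>
     (\<exists>H :: 'h hilbert. hilbert_space H \<and> carrier H \<noteq> {\<zero>\<^bsub>H\<^esub>} \<and>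
        star_hom (hyp_iso_algebra \<Lambda>1 \<Lambda>2) (op_algebra H) \<noteq> {})"

definition astar_isomorphic ::
  "('v1, 'e1) hypergraph \<Rightarrow> ('v2, 'e2) hypergraph \<Rightarrow> bool" where
  "astar_isomorphic \<Lambda>1 \<Lambda>2 \<longleftrightarrow>
     carrier (hyp_iso_algebra \<Lambda>1 \<Lambda>2) \<noteq> {\<zero>\<^bsub>hyp_iso_algebra \<Lambda>1 \<Lambda>2\<^esub>}"

end

theory Submission
  imports Defs "HOL-Library.Function_Algebras"
begin

text \<open>
  The idea is that the game algebra is generated by the entries of a magic unitary, and that a
  non-zero algebra of this kind always has a tracial state, the analogue of the Haar state of a
  compact quantum group.

  Let \<open>i\<close> run through the vertices and hyperedges of \<open>\<Lambda>1\<close> and \<open>j\<close> through those of \<open>\<Lambda>2\<close>. In the game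
  algebra the generators for the question \<open>i\<close> with answer \<open>j\<close> and for the question \<open>j\<close> with answer \<open>i\<close>
  coincide; call this element \<open>u\<^sub>i\<^sub>j\<close>. The rows and columns of \<open>u\<close> sum to 1, and \<open>u\<^sub>i\<^sub>j u\<^sub>k\<^sub>l = 0\<close> unless
  \<open>i, k\<close> are related in \<open>\<Lambda>1\<close> as \<open>j, l\<close> are in \<open>\<Lambda>2\<close>. Each of these relations says that a certain pair
  of scalar matrices intertwines tensor powers of \<open>u\<close>.

  Call a vector \<open>x2\<close> in the \<open>n\<close>-th tensor power invariant if \<open>u\<close> maps it to a scalar vector \<open>x1\<close>. If
  \<open>1 \<noteq> 0\<close> in the algebra, then \<open>x1\<close> is determined by \<open>x2\<close>. The Haar trace sends the product of the
  letters \<open>(i\<^sub>1, j\<^sub>1), \<dots>, (i\<^sub>n, j\<^sub>n)\<close> to the entry at these indices of the matrix that takes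
  \<open>x2\<close> to \<open>x1\<close> for invariant \<open>x2\<close> and vanishes on the orthogonal complement of the invariant vectors.
  Inserting and contracting an index, projecting onto a relation and rotating the indices preserve
  invariance, and so do the adjoints of these operations; by \<open>frame_transfer\<close> the Haar trace therefore
  satisfies the relations of \<open>u\<close> and is a trace. Invariant vectors of even degree are intertwiners,
  which form a *-algebra, and the positivity of the Haar trace is the complete positivity of a
  conditional expectation followed by a *-isomorphism (\<open>choi_positive\<close>, \<open>haar_positive\<close>).

  From a tracial state one obtains a Hilbert space on which the generators act by left and by right
  multiplication. The left multiplications represent the algebra. Together with the right
  multiplications and the vector of the trace they are a perfect quantum commuting strategy. The
  space consists of functions on the countable set of words, so that its carrier can be moved into
  any type with at least as many elements as the complex numbers.

  Conversely, a representation on a non-zero space shows that \<open>1 \<noteq> 0\<close>. In a perfect strategy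
  \<open>(P, Q, \<xi>)\<close> the game forces \<open>P\<^sub>x\<^sub>a \<xi> = Q\<^sub>x\<^sub>a \<xi>\<close>; hence the moments of the operators \<open>P\<^sub>x\<^sub>a\<close> at \<open>\<xi>\<close>
  respect all relations of the game and give a functional on the game algebra with value 1 at 1.
\<close>

section \<open>Frames of finite-dimensional spaces of functions\<close>

definition cip :: "'a set \<Rightarrow> ('a \<Rightarrow> complex) \<Rightarrow> ('a \<Rightarrow> complex) \<Rightarrow> complex" where
  "cip S f g = (\<Sum>s\<in>S. cnj (f s) * g s)"

text \<open>A space of pairs \<open>(f, g)\<close> stands for the graph of a linear map \<open>g \<mapsto> f\<close>.\<close>

definition pair_space :: "(('a \<Rightarrow> complex) \<times> ('b \<Rightarrow> complex)) set \<Rightarrow> bool" where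
  "pair_space W \<longleftrightarrow>
     (\<forall>f g f' g'. (f, g) \<in> W \<longrightarrow> (f', g') \<in> W \<longrightarrow> (\<lambda>s. f s + f' s, \<lambda>t. g t + g' t) \<in> W) \<and>
     (\<forall>c f g. (f, g) \<in> W \<longrightarrow> (\<lambda>s. c * f s, \<lambda>t. c * g t) \<in> W)"

text \<open>A Parseval frame for the second components; its expansion formula replaces
  the use of orthonormal bases.\<close>

definition expands_in ::
  "(('a \<Rightarrow> complex) \<times> ('b \<Rightarrow> complex)) set \<Rightarrow> 'b set \<Rightarrow>
   nat \<Rightarrow> (nat \<Rightarrow> 'a \<Rightarrow> complex) \<Rightarrow> (nat \<Rightarrow> 'b \<Rightarrow> complex) \<Rightarrow> bool" where
  "expands_in W T m b d \<longleftrightarrow>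
     (\<forall>k<m. (b k, d k) \<in> W) \<and>
     (\<forall>f g. (f, g) \<in> W \<longrightarrow> (\<forall>t\<in>T. g t = (\<Sum>k<m. cip T (d k) g * d k t)))"

text \<open>The coefficients of both expansions are inner products of second components only. So
  \<open>\<Sum>k<m. b k s * cnj (d k t)\<close> is the matrix of the orthogonal projection onto the second components,
  followed by the linear map of which \<open>W\<close> is the graph.\<close>

definition frame ::
  "(('a \<Rightarrow> complex) \<times> ('b \<Rightarrow> complex)) set \<Rightarrow> 'a set \<Rightarrow> 'b set \<Rightarrow>
   nat \<Rightarrow> (nat \<Rightarrow> 'a \<Rightarrow> complex) \<Rightarrow> (nat \<Rightarrow> 'b \<Rightarrow> complex) \<Rightarrow> bool" where
  "frame W S T m b d \<longleftrightarrow> expands_in W T m b d \<and>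
     (\<forall>f g. (f, g) \<in> W \<longrightarrow> (\<forall>s\<in>S. f s = (\<Sum>k<m. cip T (d k) g * b k s)))"

lemma cnj_cip: "cnj (cip S f g) = cip S g f"
  by (simp add: cip_def mult.commute)

lemma cip_cong: "(\<And>s. s \<in> S \<Longrightarrow> f s = f' s) \<Longrightarrow> (\<And>s. s \<in> S \<Longrightarrow> g s = g' s) \<Longrightarrow> cip S f g = cip S f' g'"
  by (simp add: cip_def)

lemma cip_diff_right: "cip S f (\<lambda>s. g s - h s) = cip S f g - cip S f h"
  by (simp add: cip_def right_diff_distrib sum_subtractf)

lemma cip_scale_right: "cip S f (\<lambda>s. c * g s) = c * cip S f g"
  by (simp add: cip_def sum_distrib_left mult_ac)

lemma cip_scale_left: "cip S (\<lambda>s. c * g s) f = cnj c * cip S g f"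
  by (simp add: cip_def sum_distrib_left mult_ac)

lemma cip_sum_right: "cip S f (\<lambda>s. \<Sum>k\<in>A. c k * g k s) = (\<Sum>k\<in>A. c k * cip S f (g k))"
  unfolding cip_def sum_distrib_left by (subst sum.swap) (simp add: mult_ac)

lemma cip_sum_left: "cip S (\<lambda>s. \<Sum>k\<in>A. c k * g k s) f = (\<Sum>k\<in>A. cnj (c k) * cip S (g k) f)"
proof -
  have "cip S (\<lambda>s. \<Sum>k\<in>A. c k * g k s) f = cnj (cip S f (\<lambda>s. \<Sum>k\<in>A. c k * g k s))"
    by (simp add: cnj_cip)
  also have "\<dots> = (\<Sum>k\<in>A. cnj (c k) * cip S (g k) f)"
    by (simp only: cip_sum_right cnj_sum complex_cnj_mult cnj_cip)
  finally show ?thesis .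
qed

lemma cip_self: "cip S f f = of_real (\<Sum>s\<in>S. (cmod (f s))\<^sup>2)"
  by (simp add: cip_def mult.commute[of "cnj _"] flip: complex_norm_square)

lemma pair_space_add:
  "pair_space W \<Longrightarrow> (f, g) \<in> W \<Longrightarrow> (f', g') \<in> W \<Longrightarrow> (\<lambda>s. f s + f' s, \<lambda>t. g t + g' t) \<in> W"
  by (simp add: pair_space_def)

lemma pair_space_scale:
  "pair_space W \<Longrightarrow> (f, g) \<in> W \<Longrightarrow> (\<lambda>s. c * f s, \<lambda>t. c * g t) \<in> W"
  by (simp add: pair_space_def)

lemma pair_space_diff:
  assumes "pair_space W" "(f, g) \<in> W" "(f', g') \<in> W"
  shows "(\<lambda>s. f s - f' s, \<lambda>t. g t - g' t) \<in> W"
  using pair_space_add[OF assms(1,2) pair_space_scale[OF assms(1,3), of "-1"]] by simp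

lemma pair_space_sum:
  assumes W: "pair_space W" and "(f0, g0) \<in> W" "\<And>k. k < (m::nat) \<Longrightarrow> (b k, d k) \<in> W"
  shows "(\<lambda>s. \<Sum>k<m. c k * b k s, \<lambda>t. \<Sum>k<m. c k * d k t) \<in> W"
  using assms(3)
proof (induction m)
  case 0
  show ?case using pair_space_scale[OF W assms(2), of 0] by simp
next
  case (Suc m)
  then show ?case
    using pair_space_add[OF W _ pair_space_scale[OF W Suc.prems[of m], of "c m"]] by simp
qed

lemma expands_in_cip:
  assumes "expands_in W T m b d" "(f, g) \<in> W"
  shows "cip T g h = (\<Sum>k<m. cip T g (d k) * cip T (d k) h)"
proof -
  have "cip T g h = cip T (\<lambda>t. \<Sum>k<m. cip T (d k) g * d k t) h"
    using assms by (intro cip_cong) (auto simp: expands_in_def)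
  then show ?thesis by (simp add: cip_sum_left cnj_cip)
qed

text \<open>The Gram-Schmidt process, by induction on \<open>T\<close>: the pairs whose second
  component vanishes at the new point \<open>s\<close> have a frame, and they have codimension at most one, so that
  one more normalised vector orthogonal to them suffices.\<close>

lemma expands_in_exists:
  assumes "finite T" "pair_space W"
  shows "\<exists>m b d. expands_in W T m b d"
  using assms
proof (induction T arbitrary: W rule: finite_induct)
  case empty
  show ?case by (rule exI[of _ 0]) (simp add: expands_in_def)
next
  case (insert s T)
  let ?T = "insert s T"
  define W0 where "W0 = {(f, g). (f, g) \<in> W \<and> g s = 0}"
  have W0: "pair_space W0"
    using insert.prems by (auto simp: pair_space_def W0_def)
  from insert.IH[OF W0] obtain m b d where e0: "expands_in W0 T m b d" by blast
  have bd: "(b k, d k) \<in> W" "d k s = 0" if "k < m" for k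
    using e0 that by (auto simp: expands_in_def W0_def)
  have cipT: "cip ?T g h = cip T g h" if "g s = 0 \<or> h s = 0" for g h
    using that insert.hyps by (auto simp: cip_def)
  show ?case
  proof (cases "W0 = W")
    case True
    have "expands_in W ?T m b d"
      unfolding expands_in_def
    proof (intro conjI allI impI ballI)
      show "(b k, d k) \<in> W" if "k < m" for k using bd that by simp
      fix f g t assume fg: "(f, g) \<in> W" and t: "t \<in> ?T"
      have g: "g s = 0" using fg True by (auto simp: W0_def)
      show "g t = (\<Sum>k<m. cip ?T (d k) g * d k t)"
      proof (cases "t = s")
        case True then show ?thesis using g bd by simp
      next
        case False
        then show ?thesis using t e0 fg \<open>W0 = W\<close> g by (simp add: expands_in_def cipT)
      qed
    qed
    then show ?thesis by blast
  next
    case False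
    then obtain f0 g0 where fg0: "(f0, g0) \<in> W" "g0 s \<noteq> 0" by (auto simp: W0_def)
    define f1 where "f1 = (\<lambda>x. f0 x - (\<Sum>k<m. cip T (d k) g0 * b k x))"
    define g1 where "g1 = (\<lambda>x. g0 x - (\<Sum>k<m. cip T (d k) g0 * d k x))"
    have fg1: "(f1, g1) \<in> W" unfolding f1_def g1_def
      by (intro pair_space_diff pair_space_sum[of _ f0 g0] insert.prems fg0 bd)
    have g1s: "g1 s \<noteq> 0" using fg0 bd by (simp add: g1_def)
    have orth: "cip T g g1 = 0" if "(f, g) \<in> W0" for f g
      using expands_in_cip[OF e0 that, of g0]
      by (simp add: g1_def cip_diff_right cip_sum_right mult.commute[of "cip T g _"])
    define nu where "nu = (\<Sum>x\<in>?T. (cmod (g1 x))\<^sup>2)"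
    have nu: "cip ?T g1 g1 = of_real nu" by (simp add: cip_self nu_def)
    have nupos: "nu > 0" unfolding nu_def
      using g1s insert.hyps by (intro sum_pos2[of _ s]) auto
    define r where "r = 1 / complex_of_real (sqrt nu)"
    have rr: "cnj r * r = 1 / of_real nu"
      using nupos by (simp add: r_def flip: of_real_mult)
    define b' where "b' = b(m := (\<lambda>x. r * f1 x))"
    define d' where "d' = d(m := (\<lambda>x. r * g1 x))"
    have "expands_in W ?T (Suc m) b' d'"
      unfolding expands_in_def
    proof (intro conjI allI impI ballI)
      show "(b' k, d' k) \<in> W" if "k < Suc m" for k
        using that bd pair_space_scale[OF insert.prems fg1] by (auto simp: b'_def d'_def less_Suc_eq)
      fix f g t assume fg: "(f, g) \<in> W" and t: "t \<in> ?T"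
      define a where "a = g s / g1 s"
      have w0: "(\<lambda>x. f x - a * f1 x, \<lambda>x. g x - a * g1 x) \<in> W0"
        using pair_space_diff[OF insert.prems fg pair_space_scale[OF insert.prems fg1, of a]] g1s
          a_def by (simp add: W0_def)
      have dg: "cip ?T (d k) g = cip T (d k) (\<lambda>x. g x - a * g1 x)" if "k < m" for k
        using orth[of "b k" "d k"] bd[OF that]
        by (simp add: cipT cip_diff_right cip_scale_right W0_def)
      have "cip ?T g1 (\<lambda>x. g x - a * g1 x) = cnj (cip T (\<lambda>x. g x - a * g1 x) g1)"
        using g1s by (simp add: cipT cnj_cip a_def)
      then have "cip ?T g1 (\<lambda>x. g x - a * g1 x) = 0" by (simp add: orth[OF w0])
      then have ag: "cip ?T g1 g = a * of_real nu"
        by (simp add: cip_diff_right cip_scale_right nu)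
      have "cip ?T (d' m) g * d' m t = cnj r * r * (cip ?T g1 g * g1 t)"
        by (simp add: d'_def cip_scale_left mult_ac)
      then have last: "cip ?T (d' m) g * d' m t = a * g1 t"
        using nupos by (simp add: rr ag)
      have "g t - a * g1 t = (\<Sum>k<m. cip T (d k) (\<lambda>x. g x - a * g1 x) * d k t)"
      proof (cases "t = s")
        case True then show ?thesis using g1s bd by (simp add: a_def)
      next
        case False then show ?thesis using w0 e0 t by (simp add: expands_in_def)
      qed
      also have "\<dots> = (\<Sum>k<m. cip ?T (d' k) g * d' k t)"
        by (rule sum.cong) (auto simp: dg d'_def)
      finally show "g t = (\<Sum>k<Suc m. cip ?T (d' k) g * d' k t)"
        using last by (simp add: algebra_simps)
    qed
    then show ?thesis by blast
  qed
qed

lemma frame_exists: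
  assumes "finite T" and W: "pair_space W"
    and det: "\<And>f g. (f, g) \<in> W \<Longrightarrow> (\<And>t. t \<in> T \<Longrightarrow> g t = 0) \<Longrightarrow> \<forall>s\<in>S. f s = 0"
  shows "\<exists>m b d. frame W S T m b d"
proof -
  obtain m b d where e: "expands_in W T m b d" using expands_in_exists[OF assms(1,2)] by blast
  have "f s = (\<Sum>k<m. cip T (d k) g * b k s)" if fg: "(f, g) \<in> W" and s: "s \<in> S" for f g s
  proof -
    have "(\<lambda>x. f x - (\<Sum>k<m. cip T (d k) g * b k x), \<lambda>x. g x - (\<Sum>k<m. cip T (d k) g * d k x)) \<in> W"
      using e by (intro pair_space_diff pair_space_sum[of _ f g] W fg) (auto simp: expands_in_def)
    from det[OF this] e fg s show ?thesis by (auto simp: expands_in_def)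
  qed
  with e show ?thesis unfolding frame_def by blast
qed

text \<open>The matrix attached to a frame depends on the space only, and it commutes with every
  operation that preserves the graphs and has an adjoint with the same property. All the relations
  and symmetries of the Haar trace below are instances of this identity.\<close>

lemma frame_transfer:
  assumes fr: "frame W S T m b d" and fr': "frame W' S' T' m' b' d'"
    and T: "\<And>f g. (f, g) \<in> W \<Longrightarrow> (A f, C g) \<in> W'"
    and T': "\<And>f g. (f, g) \<in> W' \<Longrightarrow> (A' f, C' g) \<in> W"
    and adj: "\<And>f g f' g'. (f, g) \<in> W \<Longrightarrow> (f', g') \<in> W' \<Longrightarrow> cip T' g' (C g) = cip T (C' g') g"
    and s: "s \<in> S'" and t: "t \<in> T"
  shows "(\<Sum>k<m. A (b k) s * cnj (d k t)) = (\<Sum>l<m'. b' l s * cnj (C' (d' l) t))"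
proof -
  have bd: "(b k, d k) \<in> W" if "k < m" for k using fr that by (auto simp: frame_def expands_in_def)
  have bd': "(b' k, d' k) \<in> W'" if "k < m'" for k
    using fr' that by (auto simp: frame_def expands_in_def)
  have 1: "A (b k) s = (\<Sum>l<m'. cip T' (d' l) (C (d k)) * b' l s)" if "k < m" for k
    using fr' T[OF bd[OF that]] s by (auto simp: frame_def)
  have 2: "C' (d' l) t = (\<Sum>k<m. cip T (d k) (C' (d' l)) * d k t)" if "l < m'" for l
    using fr T'[OF bd'[OF that]] t by (auto simp: frame_def expands_in_def)
  have "(\<Sum>k<m. A (b k) s * cnj (d k t)) =
      (\<Sum>k<m. \<Sum>l<m'. cip T' (d' l) (C (d k)) * b' l s * cnj (d k t))"
    by (intro sum.cong refl) (simp add: 1 sum_distrib_right)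
  also have "\<dots> = (\<Sum>l<m'. \<Sum>k<m. cip T' (d' l) (C (d k)) * b' l s * cnj (d k t))"
    by (rule sum.swap)
  also have "\<dots> = (\<Sum>l<m'. b' l s * cnj (C' (d' l) t))"
    by (intro sum.cong refl)
       (simp add: 2 sum_distrib_left adj[OF bd bd'] cnj_cip mult_ac)
  finally show ?thesis .
qed

section \<open>Positivity of Choi kernels\<close>

definition mprod :: "'i set \<Rightarrow> ('i \<times> 'i \<Rightarrow> complex) \<Rightarrow> ('i \<times> 'i \<Rightarrow> complex) \<Rightarrow> 'i \<times> 'i \<Rightarrow> complex" where
  "mprod L X Y = (\<lambda>(i, k). \<Sum>j\<in>L. X (i, j) * Y (j, k))"

definition mstar :: "('i \<times> 'i \<Rightarrow> complex) \<Rightarrow> 'i \<times> 'i \<Rightarrow> complex" where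
  "mstar X = (\<lambda>(i, k). cnj (X (k, i)))"

lemma cip_Times: "cip (S \<times> T) f g = (\<Sum>i\<in>S. \<Sum>k\<in>T. cnj (f (i, k)) * g (i, k))"
  unfolding cip_def by (simp add: sum.cartesian_product)

lemma cip_mprod_left:
  "cip (L \<times> L) Z (mprod L Y X) = cip (L \<times> L) (mprod L (mstar Y) Z) X"
proof -
  have "cip (L \<times> L) Z (mprod L Y X) = (\<Sum>i\<in>L. \<Sum>k\<in>L. \<Sum>j\<in>L. cnj (Z (i, k)) * Y (i, j) * X (j, k))"
    by (simp add: cip_Times mprod_def sum_distrib_left mult.assoc)
  also have "\<dots> = (\<Sum>i\<in>L. \<Sum>j\<in>L. \<Sum>k\<in>L. cnj (Z (i, k)) * Y (i, j) * X (j, k))"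
    by (intro sum.cong refl sum.swap)
  also have "\<dots> = (\<Sum>j\<in>L. \<Sum>i\<in>L. \<Sum>k\<in>L. cnj (Z (i, k)) * Y (i, j) * X (j, k))"
    by (rule sum.swap)
  also have "\<dots> = (\<Sum>j\<in>L. \<Sum>k\<in>L. \<Sum>i\<in>L. cnj (Z (i, k)) * Y (i, j) * X (j, k))"
    by (intro sum.cong refl sum.swap)
  also have "\<dots> = cip (L \<times> L) (mprod L (mstar Y) Z) X"
    by (simp add: cip_Times mprod_def mstar_def sum_distrib_right sum_distrib_left mult_ac)
  finally show ?thesis .
qed

lemma cip_mstar: "cip (L \<times> L) (mstar X) (mstar Y) = cip (L \<times> L) Y X"
proof -
  have "cip (L \<times> L) (mstar X) (mstar Y) = (\<Sum>i\<in>L. \<Sum>k\<in>L. X (k, i) * cnj (Y (k, i)))"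
    by (simp add: cip_Times mstar_def)
  also have "\<dots> = (\<Sum>k\<in>L. \<Sum>i\<in>L. X (k, i) * cnj (Y (k, i)))" by (rule sum.swap)
  finally show ?thesis by (simp add: cip_Times mult.commute)
qed

lemma mstar_mstar [simp]: "mstar (mstar X) = X"
  by (auto simp: mstar_def)

text \<open>\<open>B\<close> is the graph of a *-isomorphism between two *-algebras of matrices, and \<open>kappa\<close> is the Choi
  matrix of the orthogonal projection onto the second algebra followed by this isomorphism. Let
  \<open>Th\<close> be the operator with matrix \<open>kappa\<close> on rectangular matrices, and \<open>Z\<close> the space of
  those rectangular matrices \<open>z\<close> with \<open>Y1 z = z Y2\<close> for all \<open>(Y1, Y2) \<in> B\<close>. Then \<open>Th\<close> is self-adjoint, it maps
  into \<open>Z\<close>, and on \<open>Z\<close> it is multiplication by the positive matrix \<open>\<Sum>k<m. b k (b k)\<^sup>*\<close>. Hence the quadratic form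
  of \<open>Th\<close> at \<open>c\<close> equals its value at the projection of \<open>c\<close> to \<open>Z\<close>, where it is visibly non-negative.\<close>

lemma choi_positive:
  fixes B :: "(('i \<times> 'i \<Rightarrow> complex) \<times> ('j \<times> 'j \<Rightarrow> complex)) set"
    and c :: "'i \<times> 'j \<Rightarrow> complex"
  assumes fin: "finite L1" "finite L2"
    and prodB: "\<And>X1 X2 Y1 Y2. (X1, X2) \<in> B \<Longrightarrow> (Y1, Y2) \<in> B \<Longrightarrow> (mprod L1 X1 Y1, mprod L2 X2 Y2) \<in> B"
    and starB: "\<And>X1 X2. (X1, X2) \<in> B \<Longrightarrow> (mstar X1, mstar X2) \<in> B"
    and fr: "frame B (L1 \<times> L1) (L2 \<times> L2) m b d"
  defines "kappa \<equiv> \<lambda>p q. \<Sum>k<m. b k p * cnj (d k q)"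
  shows "(\<Sum>i\<in>L1. \<Sum>j\<in>L2. \<Sum>k\<in>L1. \<Sum>l\<in>L2. cnj (c (i, j)) * kappa (i, k) (j, l) * c (k, l)) \<in> \<real>\<^sub>\<ge>\<^sub>0"
proof -
  define Th where "Th = (\<lambda>c (i, j). \<Sum>k\<in>L1. \<Sum>l\<in>L2. kappa (i, k) (j, l) * c (k, l))"
  let ?ip = "cip (L1 \<times> L2) :: ('i \<times> 'j \<Rightarrow> complex) \<Rightarrow> _"
  define Z where "Z = {z. \<forall>Y1 Y2. (Y1, Y2) \<in> B \<longrightarrow> (\<forall>i\<in>L1. \<forall>j\<in>L2.
      (\<Sum>k\<in>L1. Y1 (i, k) * z (k, j)) = (\<Sum>l\<in>L2. z (i, l) * Y2 (l, j)))}"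
  have bd: "(b k, d k) \<in> B" if "k < m" for k using fr that by (auto simp: frame_def expands_in_def)
  have left: "(\<Sum>n\<in>L1. Y1 (i, n) * kappa (n, k) (j, l)) = (\<Sum>n\<in>L2. kappa (i, k) (n, l) * Y2 (n, j))"
    if Y: "(Y1, Y2) \<in> B" and ij: "i \<in> L1" "k \<in> L1" "j \<in> L2" "l \<in> L2" for Y1 Y2 i j k l
  proof -
    have "(\<Sum>k'<m. mprod L1 Y1 (b k') (i, k) * cnj (d k' (j, l))) =
        (\<Sum>k'<m. b k' (i, k) * cnj (mprod L2 (mstar Y2) (d k') (j, l)))"
      by (rule frame_transfer[OF fr fr, where A = "mprod L1 Y1" and C = "mprod L2 Y2"
            and A' = "mprod L1 (mstar Y1)"])
         (use ij prodB[OF Y] prodB[OF starB[OF Y]] in \<open>auto simp: cip_mprod_left\<close>)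
    moreover have "(\<Sum>k'<m. mprod L1 Y1 (b k') (i, k) * cnj (d k' (j, l))) =
        (\<Sum>n\<in>L1. Y1 (i, n) * kappa (n, k) (j, l))"
      unfolding kappa_def mprod_def sum_distrib_left prod.case sum_distrib_right
      by (subst sum.swap) (simp add: mult_ac)
    moreover have "(\<Sum>k'<m. b k' (i, k) * cnj (mprod L2 (mstar Y2) (d k') (j, l))) =
        (\<Sum>n\<in>L2. kappa (i, k) (n, l) * Y2 (n, j))"
      unfolding kappa_def mprod_def mstar_def cnj_sum sum_distrib_left prod.case sum_distrib_right
      by (subst sum.swap) (simp add: mult_ac)
    ultimately show ?thesis by simp
  qed
  have ThZ: "Th c \<in> Z" for c
    unfolding Z_def
  proof (safe)
    fix Y1 Y2 i j assume Y: "(Y1, Y2) \<in> B" and i: "i \<in> L1" and j: "j \<in> L2"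
    have "(\<Sum>n\<in>L1. Y1 (i, n) * Th c (n, j)) =
        (\<Sum>n\<in>L1. \<Sum>k\<in>L1. \<Sum>l\<in>L2. Y1 (i, n) * kappa (n, k) (j, l) * c (k, l))"
      by (simp add: Th_def sum_distrib_left mult.assoc)
    also have "\<dots> = (\<Sum>k\<in>L1. \<Sum>n\<in>L1. \<Sum>l\<in>L2. Y1 (i, n) * kappa (n, k) (j, l) * c (k, l))"
      by (rule sum.swap)
    also have "\<dots> = (\<Sum>k\<in>L1. \<Sum>l\<in>L2. \<Sum>n\<in>L1. Y1 (i, n) * kappa (n, k) (j, l) * c (k, l))"
      by (intro sum.cong refl sum.swap)
    also have "\<dots> = (\<Sum>k\<in>L1. \<Sum>l\<in>L2. \<Sum>n\<in>L2. kappa (i, k) (n, l) * Y2 (n, j) * c (k, l))"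
      by (intro sum.cong refl) (simp add: left[OF Y i _ j] flip: sum_distrib_right)
    also have "\<dots> = (\<Sum>k\<in>L1. \<Sum>n\<in>L2. \<Sum>l\<in>L2. kappa (i, k) (n, l) * Y2 (n, j) * c (k, l))"
      by (intro sum.cong refl sum.swap)
    also have "\<dots> = (\<Sum>n\<in>L2. \<Sum>k\<in>L1. \<Sum>l\<in>L2. kappa (i, k) (n, l) * Y2 (n, j) * c (k, l))"
      by (rule sum.swap)
    also have "\<dots> = (\<Sum>n\<in>L2. Th c (i, n) * Y2 (n, j))"
      by (simp add: Th_def sum_distrib_right sum_distrib_left mult_ac)
    finally show "(\<Sum>n\<in>L1. Y1 (i, n) * Th c (n, j)) = (\<Sum>n\<in>L2. Th c (i, n) * Y2 (n, j))" .
  qed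
  have fr_star: "frame B (L1 \<times> L1) (L2 \<times> L2) m (\<lambda>k. mstar (b k)) (\<lambda>k. mstar (d k))"
    unfolding frame_def expands_in_def
  proof (intro conjI allI impI ballI)
    show "(mstar (b k), mstar (d k)) \<in> B" if "k < m" for k using bd[OF that] starB by blast
    fix Y1 Y2 assume Y: "(Y1, Y2) \<in> B"
    have c: "cip (L2 \<times> L2) (mstar (d k)) Y2 = cnj (cip (L2 \<times> L2) (d k) (mstar Y2))" for k
      using cip_mstar[of L2 "d k" "mstar Y2"] by (simp add: cnj_cip)
    show "Y2 t = (\<Sum>k<m. cip (L2 \<times> L2) (mstar (d k)) Y2 * mstar (d k) t)" if t: "t \<in> L2 \<times> L2" for t
    proof -
      obtain i j where ij: "t = (i, j)" "i \<in> L2" "j \<in> L2" using t by auto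
      have "mstar Y2 (j, i) = (\<Sum>k<m. cip (L2 \<times> L2) (d k) (mstar Y2) * d k (j, i))"
        using fr starB[OF Y] ij unfolding frame_def expands_in_def by blast
      then have "cnj (mstar Y2 (j, i)) = (\<Sum>k<m. cnj (cip (L2 \<times> L2) (d k) (mstar Y2)) * cnj (d k (j, i)))"
        by simp
      then show ?thesis by (simp add: c ij(1)) (simp add: mstar_def)
    qed
    show "Y1 t = (\<Sum>k<m. cip (L2 \<times> L2) (mstar (d k)) Y2 * mstar (b k) t)" if t: "t \<in> L1 \<times> L1" for t
    proof -
      obtain i j where ij: "t = (i, j)" "i \<in> L1" "j \<in> L1" using t by auto
      have "mstar Y1 (j, i) = (\<Sum>k<m. cip (L2 \<times> L2) (d k) (mstar Y2) * b k (j, i))"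
        using fr starB[OF Y] ij unfolding frame_def by blast
      then have "cnj (mstar Y1 (j, i)) = (\<Sum>k<m. cnj (cip (L2 \<times> L2) (d k) (mstar Y2)) * cnj (b k (j, i)))"
        by simp
      then show ?thesis by (simp add: c ij(1)) (simp add: mstar_def)
    qed
  qed
  have herm: "kappa (i, k) (j, l) = cnj (kappa (k, i) (l, j))"
    if "i \<in> L1" "k \<in> L1" "j \<in> L2" "l \<in> L2" for i k j l
  proof -
    have "kappa (i, k) (j, l) = (\<Sum>k'<m. mstar (b k') (i, k) * cnj (mstar (d k') (j, l)))"
      unfolding kappa_def
      by (rule frame_transfer[OF fr fr_star, where A = id and C = id and A' = id and C' = id, simplified])
         (use that in auto)
    then show ?thesis by (simp add: kappa_def mstar_def)
  qed
  have Th_sa: "?ip x (Th y) = ?ip (Th x) y" for x y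
  proof -
    have "?ip x (Th y) = (\<Sum>i\<in>L1. \<Sum>j\<in>L2. \<Sum>k\<in>L1. \<Sum>l\<in>L2. cnj (x (i, j)) * kappa (i, k) (j, l) * y (k, l))"
      by (simp add: cip_Times Th_def sum_distrib_left mult.assoc)
    also have "\<dots> = (\<Sum>(i,j)\<in>L1\<times>L2. \<Sum>(k,l)\<in>L1\<times>L2. cnj (x (i, j)) * kappa (i, k) (j, l) * y (k, l))"
      by (simp flip: sum.cartesian_product)
    also have "\<dots> = (\<Sum>q\<in>L1\<times>L2. \<Sum>p\<in>L1\<times>L2. cnj (x p) * kappa (fst p, fst q) (snd p, snd q) * y q)"
      by (subst sum.swap) (simp add: case_prod_unfold)
    also have "\<dots> = (\<Sum>q\<in>L1\<times>L2. \<Sum>p\<in>L1\<times>L2. cnj (x p) * cnj (kappa (fst q, fst p) (snd q, snd p)) * y q)"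
      by (intro sum.cong refl arg_cong2[where f = "(*)"] herm) auto
    also have "\<dots> = (\<Sum>(k,l)\<in>L1\<times>L2. \<Sum>(i,j)\<in>L1\<times>L2. cnj (x (i, j)) * cnj (kappa (k, i) (l, j)) * y (k, l))"
      by (simp add: case_prod_unfold)
    also have "\<dots> = ?ip (Th x) y"
      by (simp add: cip_Times Th_def sum_distrib_left sum_distrib_right mult_ac flip: sum.cartesian_product)
    finally show ?thesis .
  qed
  \<comment> \<open>The orthogonal projection of \<open>c\<close> onto \<open>Z\<close>, by way of a frame for the graph of the identity on \<open>Z\<close>.\<close>
  define ZZ where "ZZ = {(z, z) |z. z \<in> Z}"
  have "pair_space ZZ"
    by (auto simp: pair_space_def ZZ_def Z_def algebra_simps sum.distrib simp flip: sum_distrib_left)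
  then obtain n z z' where "frame ZZ (L1 \<times> L2) (L1 \<times> L2) n z z'"
    using frame_exists[of "L1 \<times> L2" ZZ "L1 \<times> L2"] fin by (auto simp: ZZ_def)
  then have ez: "expands_in ZZ (L1 \<times> L2) n z z'" by (simp add: frame_def)
  define e where "e = (\<lambda>x. \<Sum>k<n. ?ip (z' k) c * z' k x)"
  have proj: "?ip y c = ?ip y e" if "y \<in> Z" for y
  proof -
    have "?ip y c = (\<Sum>k<n. ?ip y (z' k) * ?ip (z' k) c)"
      by (rule expands_in_cip[OF ez]) (use that in \<open>auto simp: ZZ_def\<close>)
    then show ?thesis by (simp add: e_def cip_sum_right mult.commute[of "?ip y _"])
  qed
  have "\<And>k. k < n \<Longrightarrow> (z' k, z' k) \<in> ZZ" using ez by (auto simp: expands_in_def ZZ_def)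
  moreover have "(\<lambda>_. 0, \<lambda>_. 0) \<in> ZZ" by (auto simp: ZZ_def Z_def)
  ultimately have "(e, e) \<in> ZZ" unfolding e_def
    by (intro pair_space_sum \<open>pair_space ZZ\<close>)
  then have eZ: "e \<in> Z" by (auto simp: ZZ_def)
  have "?ip c (Th c) = ?ip e (Th e)"
  proof -
    have "?ip c (Th c) = cnj (?ip (Th c) c)" by (simp add: cnj_cip)
    also have "\<dots> = cnj (?ip (Th c) e)" by (simp add: proj ThZ)
    also have "\<dots> = ?ip (Th e) c" by (simp add: cnj_cip Th_sa)
    also have "\<dots> = ?ip e (Th e)" by (simp add: proj ThZ Th_sa)
    finally show ?thesis .
  qed
  define g where "g = (\<lambda>k' k j. \<Sum>n\<in>L1. cnj (b k' (n, k)) * e (n, j))"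
  have cg: "cnj (g k' k j) = (\<Sum>i\<in>L1. cnj (e (i, j)) * b k' (i, k))" for k' k j
    by (simp add: g_def mult.commute)
  \<comment> \<open>On \<open>Z\<close> the second factor of \<open>kappa\<close> can be moved to the left of \<open>e\<close>, where it becomes \<open>(b k')\<^sup>*\<close>.\<close>
  have The: "Th e (i, j) = (\<Sum>k'<m. \<Sum>k\<in>L1. b k' (i, k) * g k' k j)" if i: "i \<in> L1" and j: "j \<in> L2" for i j
  proof -
    have "Th e (i, j) = (\<Sum>k\<in>L1. \<Sum>l\<in>L2. \<Sum>k'<m. b k' (i, k) * (e (k, l) * cnj (d k' (j, l))))"
      by (simp add: Th_def kappa_def sum_distrib_left sum_distrib_right mult_ac)
    also have "\<dots> = (\<Sum>k\<in>L1. \<Sum>k'<m. \<Sum>l\<in>L2. b k' (i, k) * (e (k, l) * cnj (d k' (j, l))))"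
      by (intro sum.cong refl sum.swap)
    also have "\<dots> = (\<Sum>k'<m. \<Sum>k\<in>L1. \<Sum>l\<in>L2. b k' (i, k) * (e (k, l) * cnj (d k' (j, l))))"
      by (rule sum.swap)
    also have "\<dots> = (\<Sum>k'<m. \<Sum>k\<in>L1. b k' (i, k) * g k' k j)"
    proof (intro sum.cong refl)
      fix k' k assume "k' \<in> {..<m}" "k \<in> L1"
      then have "(\<Sum>n\<in>L1. mstar (b k') (k, n) * e (n, j)) = (\<Sum>l\<in>L2. e (k, l) * mstar (d k') (l, j))"
        using starB[OF bd[of k']] eZ j by (auto simp: Z_def)
      then show "(\<Sum>l\<in>L2. b k' (i, k) * (e (k, l) * cnj (d k' (j, l)))) = b k' (i, k) * g k' k j"
        by (simp add: g_def mstar_def flip: sum_distrib_left)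
    qed
    finally show ?thesis .
  qed
  have "?ip e (Th e) = (\<Sum>i\<in>L1. \<Sum>j\<in>L2. \<Sum>k'<m. \<Sum>k\<in>L1. cnj (e (i, j)) * b k' (i, k) * g k' k j)"
    by (simp add: cip_Times The sum_distrib_left mult.assoc)
  also have "\<dots> = (\<Sum>j\<in>L2. \<Sum>i\<in>L1. \<Sum>k'<m. \<Sum>k\<in>L1. cnj (e (i, j)) * b k' (i, k) * g k' k j)"
    by (rule sum.swap)
  also have "\<dots> = (\<Sum>j\<in>L2. \<Sum>k'<m. \<Sum>i\<in>L1. \<Sum>k\<in>L1. cnj (e (i, j)) * b k' (i, k) * g k' k j)"
    by (intro sum.cong refl sum.swap)
  also have "\<dots> = (\<Sum>j\<in>L2. \<Sum>k'<m. \<Sum>k\<in>L1. \<Sum>i\<in>L1. cnj (e (i, j)) * b k' (i, k) * g k' k j)"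
    by (intro sum.cong refl sum.swap)
  also have "\<dots> = (\<Sum>j\<in>L2. \<Sum>k'<m. \<Sum>k\<in>L1. cnj (g k' k j) * g k' k j)"
    by (simp add: cg sum_distrib_right)
  also have "\<dots> = of_real (\<Sum>j\<in>L2. \<Sum>k'<m. \<Sum>k\<in>L1. (cmod (g k' k j))\<^sup>2)"
    by (simp add: mult.commute[of "cnj _"] flip: complex_norm_square)
  also have "\<dots> \<in> \<real>\<^sub>\<ge>\<^sub>0"
    unfolding nonneg_Reals_of_real_iff by (intro sum_nonneg) simp
  finally have "?ip e (Th e) \<in> \<real>\<^sub>\<ge>\<^sub>0" .
  then have "?ip c (Th c) \<in> \<real>\<^sub>\<ge>\<^sub>0" using \<open>?ip c (Th c) = ?ip e (Th e)\<close> by simp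
  then show ?thesis by (simp add: cip_Times Th_def sum_distrib_left mult.assoc)
qed

section \<open>Words over a finite alphabet\<close>

definition words_of :: "'a set \<Rightarrow> nat \<Rightarrow> 'a list set" where
  "words_of S n = {xs. set xs \<subseteq> S \<and> length xs = n}"

lemma finite_words_of: "finite S \<Longrightarrow> finite (words_of S n)"
  by (simp add: words_of_def finite_lists_length_eq)

lemma words_of_0 [simp]: "words_of S 0 = {[]}"
  by (auto simp: words_of_def)

lemma Cons_in_words_of [simp]: "x # xs \<in> words_of S (Suc n) \<longleftrightarrow> x \<in> S \<and> xs \<in> words_of S n"
  by (auto simp: words_of_def)

lemma length_words_of: "xs \<in> words_of S n \<Longrightarrow> length xs = n"
  by (simp add: words_of_def)

lemma words_of_SucE:
  assumes "xs \<in> words_of S (Suc n)"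
  obtains y ys where "xs = y # ys" "y \<in> S" "ys \<in> words_of S n"
  using assms by (cases xs) (auto simp: words_of_def)

lemma rev_in_words_of [simp]: "rev xs \<in> words_of S n \<longleftrightarrow> xs \<in> words_of S n"
  by (simp add: words_of_def)

lemma snoc_in_words_of: "x \<in> S \<Longrightarrow> xs \<in> words_of S n \<Longrightarrow> xs @ [x] \<in> words_of S (Suc n)"
  by (auto simp: words_of_def)

lemma sum_words_Suc: "(\<Sum>xs\<in>words_of S (Suc n). g xs) = (\<Sum>x\<in>S. \<Sum>xs\<in>words_of S n. g (x # xs))"
proof -
  have "(\<Sum>xs\<in>words_of S (Suc n). g xs) = (\<Sum>(x, xs)\<in>S \<times> words_of S n. g (x # xs))"
    by (rule sum.reindex_bij_witness[of _ "\<lambda>(x, xs). x # xs" "\<lambda>xs. (hd xs, tl xs)"])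
       (auto elim!: words_of_SucE)
  then show ?thesis by (simp add: sum.cartesian_product)
qed

lemma sum_words_rev: "(\<Sum>xs\<in>words_of S n. g (rev xs)) = (\<Sum>xs\<in>words_of S n. g xs)"
  by (rule sum.reindex_bij_witness[of _ rev rev]) auto

lemma sum_words_append:
  "(\<Sum>xs\<in>words_of S (n + m). g xs) = (\<Sum>xs\<in>words_of S n. \<Sum>ys\<in>words_of S m. g (xs @ ys))"
  by (induction n arbitrary: g) (simp_all add: sum_words_Suc)

lemma sum_words_snoc:
  "(\<Sum>xs\<in>words_of S (Suc n). g xs) = (\<Sum>x\<in>S. \<Sum>xs\<in>words_of S n. g (xs @ [x]))"
proof -
  have "(\<Sum>xs\<in>words_of S (Suc n). g xs) = (\<Sum>x\<in>S. \<Sum>xs\<in>words_of S n. g (rev (x # xs)))"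
    by (subst sum_words_rev[symmetric]) (rule sum_words_Suc)
  also have "\<dots> = (\<Sum>x\<in>S. \<Sum>xs\<in>words_of S n. g (xs @ [x]))"
    using sum_words_rev[of "\<lambda>xs. g (xs @ [_])"] by simp
  finally show ?thesis .
qed

section \<open>Functionals on the algebra of isomorphisms of two coloured sets\<close>

text \<open>A colour is a possible relation between two elements. If a pair in
  one structure has the same colour as a pair in the other, then the members of both or of neither are equal, and the
  reversed pairs have the same colour, too.\<close>

locale coloured_pair =
  fixes I1 :: "'i set" and I2 :: "'j set"
    and r1 :: "'i \<Rightarrow> 'i \<Rightarrow> 'c" and r2 :: "'j \<Rightarrow> 'j \<Rightarrow> 'c"
  assumes finite_I1: "finite I1" and finite_I2: "finite I2"
    and diag: "\<lbrakk>i \<in> I1; k \<in> I1; j \<in> I2; l \<in> I2; r1 i k = r2 j l\<rbrakk> \<Longrightarrow> i = k \<longleftrightarrow> j = l"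
    and colour_sym: "\<lbrakk>i \<in> I1; k \<in> I1; j \<in> I2; l \<in> I2; r1 i k = r2 j l\<rbrakk> \<Longrightarrow> r1 k i = r2 l j"
begin

text \<open>The linear functionals on the universal algebra generated by elements \<open>u\<^sub>i\<^sub>j\<close> with rows and columns
  summing to 1 and \<open>u\<^sub>i\<^sub>j u\<^sub>k\<^sub>l = 0\<close> whenever the colours of \<open>(i, k)\<close> and \<open>(j, l)\<close> differ. The value \<open>f w\<close> is the one at the
  product of the letters of \<open>w\<close>. An equation in the algebra is expressed by applying all functionals to it.\<close>

definition iso_functionals :: "(('i \<times> 'j) list \<Rightarrow> complex) set" where
  "iso_functionals = {f.
     (\<forall>a b. \<forall>i\<in>I1. (\<Sum>j\<in>I2. f (a @ (i, j) # b)) = f (a @ b)) \<and>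
     (\<forall>a b. \<forall>j\<in>I2. (\<Sum>i\<in>I1. f (a @ (i, j) # b)) = f (a @ b)) \<and>
     (\<forall>a b. \<forall>i\<in>I1. \<forall>k\<in>I1. \<forall>j\<in>I2. \<forall>l\<in>I2. r1 i k \<noteq> r2 j l \<longrightarrow> f (a @ (i, j) # (k, l) # b) = 0)}"

lemma row_sum: "f \<in> iso_functionals \<Longrightarrow> i \<in> I1 \<Longrightarrow> (\<Sum>j\<in>I2. f (a @ (i, j) # b)) = f (a @ b)"
  by (simp add: iso_functionals_def)

lemma col_sum: "f \<in> iso_functionals \<Longrightarrow> j \<in> I2 \<Longrightarrow> (\<Sum>i\<in>I1. f (a @ (i, j) # b)) = f (a @ b)"
  by (simp add: iso_functionals_def)

lemma mismatch:
  "f \<in> iso_functionals \<Longrightarrow> i \<in> I1 \<Longrightarrow> k \<in> I1 \<Longrightarrow> j \<in> I2 \<Longrightarrow> l \<in> I2 \<Longrightarrow> r1 i k \<noteq> r2 j l \<Longrightarrow>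
   f (a @ (i, j) # (k, l) # b) = 0"
  by (simp add: iso_functionals_def)

lemma shift: "f \<in> iso_functionals \<Longrightarrow> (\<lambda>w. f (a @ w @ b)) \<in> iso_functionals"
  using row_sum[of f _ "a @ _" "_ @ b"] col_sum[of f _ "a @ _" "_ @ b"] mismatch[of f _ _ _ _ "a @ _" "_ @ b"]
  by (simp add: iso_functionals_def)

text \<open>The functional \<open>x \<mapsto> cnj (f (x\<^sup>*))\<close>, as the generators are self-adjoint.\<close>

lemma star_functional:
  assumes f: "f \<in> iso_functionals"
  shows "(\<lambda>w. cnj (f (rev w))) \<in> iso_functionals"
  unfolding iso_functionals_def
proof (intro CollectI conjI allI ballI impI)
  fix a b :: "('i \<times> 'j) list"
  show "(\<Sum>j\<in>I2. cnj (f (rev (a @ (i, j) # b)))) = cnj (f (rev (a @ b)))" if "i \<in> I1" for i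
    using row_sum[OF f that, of "rev b" "rev a"] by (simp flip: cnj_sum)
  show "(\<Sum>i\<in>I1. cnj (f (rev (a @ (i, j) # b)))) = cnj (f (rev (a @ b)))" if "j \<in> I2" for j
    using col_sum[OF f that, of "rev b" "rev a"] by (simp flip: cnj_sum)
  fix i k j l assume ij: "i \<in> I1" "k \<in> I1" "j \<in> I2" "l \<in> I2" and ne: "r1 i k \<noteq> r2 j l"
  have "r1 k i \<noteq> r2 l j" using colour_sym[OF ij(2,1,4,3)] ne by blast
  from mismatch[OF f ij(2,1,4,3) this, of "rev b" "rev a"]
  show "cnj (f (rev (a @ (i, j) # (k, l) # b))) = 0" by simp
qed

text \<open>The generators are idempotent: in \<open>u\<^sub>i\<^sub>j = (\<Sum>l. u\<^sub>i\<^sub>j u\<^sub>i\<^sub>l)\<close> only the term \<open>l = j\<close> has matching colours.\<close>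

lemma same_row:
  assumes f: "f \<in> iso_functionals" and i: "i \<in> I1" and j: "j \<in> I2" "l \<in> I2"
  shows "f (a @ (i, j) # (i, l) # b) = (if j = l then f (a @ (i, j) # b) else 0)"
proof -
  have off: "f (a @ (i, j) # (i, l) # b) = 0" if "l \<in> I2" "j \<noteq> l" for l
    using mismatch[OF f i i j(1) that(1)] diag[OF i i j(1) that(1)] that(2) by blast
  have "f (a @ (i, j) # b) = (\<Sum>l\<in>I2. f (a @ (i, j) # (i, l) # b))"
    using row_sum[OF f i, of "a @ [(i, j)]" b] by simp
  also have "\<dots> = (\<Sum>l\<in>{j}. f (a @ (i, j) # (i, l) # b))"
    using j off by (intro sum.mono_neutral_right finite_I2) auto
  finally show ?thesis using off j by auto
qed

lemma same_col:
  assumes f: "f \<in> iso_functionals" and j: "j \<in> I2" and i: "i \<in> I1" "k \<in> I1"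
  shows "f (a @ (i, j) # (k, j) # b) = (if i = k then f (a @ (i, j) # b) else 0)"
proof -
  have off: "f (a @ (i, j) # (k, j) # b) = 0" if "k \<in> I1" "i \<noteq> k" for k
    using mismatch[OF f i(1) that(1) j j] diag[OF i(1) that(1) j j] that(2) by blast
  have "f (a @ (i, j) # b) = (\<Sum>k\<in>I1. f (a @ (i, j) # (k, j) # b))"
    using col_sum[OF f j, of "a @ [(i, j)]" b] by simp
  also have "\<dots> = (\<Sum>k\<in>{i}. f (a @ (i, j) # (k, j) # b))"
    using i off by (intro sum.mono_neutral_right finite_I1) auto
  finally show ?thesis using off i by auto
qed

text \<open>Tensor powers of \<open>u\<close> are unitary. The sum collapses from the innermost pair of letters outwards.\<close>

lemma sum_cancel:
  assumes f: "f \<in> iso_functionals"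
  shows "\<lbrakk>N \<in> words_of I2 p; N' \<in> words_of I2 p\<rbrakk> \<Longrightarrow>
    (\<Sum>M\<in>words_of I1 p. f (a @ zip M N @ rev (zip M N') @ b)) = (if N = N' then f (a @ b) else 0)"
proof (induction p arbitrary: N N' a b)
  case 0 then show ?case by simp
next
  case (Suc p)
  obtain n N0 where N: "N = n # N0" "n \<in> I2" "N0 \<in> words_of I2 p" using Suc.prems(1) by (rule words_of_SucE)
  obtain n' N0' where N': "N' = n' # N0'" "n' \<in> I2" "N0' \<in> words_of I2 p"
    using Suc.prems(2) by (rule words_of_SucE)
  have "(\<Sum>M\<in>words_of I1 (Suc p). f (a @ zip M N @ rev (zip M N') @ b)) =
      (\<Sum>m\<in>I1. \<Sum>M\<in>words_of I1 p. f ((a @ [(m, n)]) @ zip M N0 @ rev (zip M N0') @ ((m, n') # b)))"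
    by (simp add: sum_words_Suc N N')
  also have "\<dots> = (\<Sum>m\<in>I1. if N0 = N0' then f ((a @ [(m, n)]) @ ((m, n') # b)) else 0)"
    by (intro sum.cong refl Suc.IH N N')
  also have "\<dots> = (if N = N' then f (a @ b) else 0)"
    using col_sum[OF f N(2), of a b] same_row[OF f _ N(2) N'(2), of _ a b]
    by (cases "N0 = N0'"; cases "n = n'") (simp_all add: N(1) N'(1))
  finally show ?case .
qed

text \<open>The pairs \<open>(x1, x2)\<close> such that the \<open>n\<close>-th tensor power of \<open>u\<close> maps \<open>x2\<close> to the scalar vector \<open>x1\<close>.\<close>

definition Inv :: "nat \<Rightarrow> (('i list \<Rightarrow> complex) \<times> ('j list \<Rightarrow> complex)) set" where
  "Inv n = {(x1, x2). \<forall>f\<in>iso_functionals. \<forall>I\<in>words_of I1 n.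
     (\<Sum>J\<in>words_of I2 n. f (zip I J) * x2 J) = x1 I * f []}"

lemma InvI:
  "(\<And>f I. f \<in> iso_functionals \<Longrightarrow> I \<in> words_of I1 n \<Longrightarrow>
     (\<Sum>J\<in>words_of I2 n. f (zip I J) * x2 J) = x1 I * f []) \<Longrightarrow> (x1, x2) \<in> Inv n"
  by (simp add: Inv_def)

lemma InvD:
  assumes "(x1, x2) \<in> Inv n" "f \<in> iso_functionals" "I \<in> words_of I1 n"
  shows "(\<Sum>J\<in>words_of I2 n. f (a @ zip I J @ b) * x2 J) = x1 I * f (a @ b)"
  using assms shift[OF assms(2), of a b] by (auto simp: Inv_def)

lemma Inv_cong:
  assumes "(z1, z2) \<in> Inv n" "\<And>xs. length xs = n \<Longrightarrow> y1 xs = z1 xs" "\<And>xs. length xs = n \<Longrightarrow> y2 xs = z2 xs"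
  shows "(y1, y2) \<in> Inv n"
proof (rule InvI)
  fix f I assume f: "f \<in> iso_functionals" and I: "I \<in> words_of I1 n"
  show "(\<Sum>J\<in>words_of I2 n. f (zip I J) * y2 J) = y1 I * f []"
    using InvD[OF assms(1) f I, of "[]" "[]"] I by (simp add: assms(2,3) length_words_of)
qed

lemma pair_space_Inv: "pair_space (Inv n)"
  unfolding pair_space_def
proof (intro conjI allI impI InvI)
  fix x1 x2 f I assume x: "(x1, x2) \<in> Inv n" and f: "f \<in> iso_functionals" and I: "I \<in> words_of I1 n"
  note x' = InvD[OF x f I, of "[]" "[]", simplified]
  show "(\<Sum>J\<in>words_of I2 n. f (zip I J) * (c * x2 J)) = c * x1 I * f []" for c
    using x' by (simp add: mult.left_commute[of _ c] mult.assoc flip: sum_distrib_left)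
  fix y1 y2 assume y: "(y1, y2) \<in> Inv n"
  show "(\<Sum>J\<in>words_of I2 n. f (zip I J) * (x2 J + y2 J)) = (x1 I + y1 I) * f []"
    using x' InvD[OF y f I, of "[]" "[]", simplified] by (simp add: distrib_left distrib_right sum.distrib)
qed

lemma Inv_insert:
  assumes "(x1, x2) \<in> Inv n"
  shows "(\<lambda>xs. x1 (tl xs), \<lambda>xs. x2 (tl xs)) \<in> Inv (Suc n)"
proof (rule InvI)
  fix f I assume f: "f \<in> iso_functionals" and "I \<in> words_of I1 (Suc n)"
  then obtain i I0 where I: "I = i # I0" "i \<in> I1" "I0 \<in> words_of I1 n" by (elim words_of_SucE)
  have "(\<Sum>J\<in>words_of I2 (Suc n). f (zip I J) * x2 (tl J)) =
      (\<Sum>J\<in>words_of I2 n. (\<Sum>j\<in>I2. f ([] @ (i, j) # zip I0 J)) * x2 J)"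
    by (simp add: sum_words_Suc I sum_distrib_right sum.swap[of _ I2])
  also have "\<dots> = x1 I0 * f []"
    unfolding row_sum[OF f I(2)] using InvD[OF assms f I(3), of "[]" "[]"] by simp
  finally show "(\<Sum>J\<in>words_of I2 (Suc n). f (zip I J) * x2 (tl J)) = x1 (tl I) * f []" by (simp add: I)
qed

text \<open>The letter that the contracted index belongs to is supplied by a column sum.\<close>

lemma Inv_contract:
  assumes "(x1, x2) \<in> Inv (Suc n)"
  shows "(\<lambda>xs. \<Sum>i\<in>I1. x1 (i # xs), \<lambda>xs. \<Sum>j\<in>I2. x2 (j # xs)) \<in> Inv n"
proof (rule InvI)
  fix f I assume f: "f \<in> iso_functionals" and I: "I \<in> words_of I1 n"
  have "(\<Sum>J\<in>words_of I2 n. f (zip I J) * (\<Sum>j\<in>I2. x2 (j # J))) =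
      (\<Sum>J\<in>words_of I2 n. \<Sum>j\<in>I2. (\<Sum>i\<in>I1. f ((i, j) # zip I J)) * x2 (j # J))"
    using col_sum[OF f, of _ "[]"] by (simp add: sum_distrib_left)
  also have "\<dots> = (\<Sum>J\<in>words_of I2 n. \<Sum>j\<in>I2. \<Sum>i\<in>I1. f ((i, j) # zip I J) * x2 (j # J))"
    by (simp add: sum_distrib_right)
  also have "\<dots> = (\<Sum>J\<in>words_of I2 n. \<Sum>i\<in>I1. \<Sum>j\<in>I2. f ((i, j) # zip I J) * x2 (j # J))"
    by (intro sum.cong refl sum.swap)
  also have "\<dots> = (\<Sum>i\<in>I1. \<Sum>J\<in>words_of I2 n. \<Sum>j\<in>I2. f ((i, j) # zip I J) * x2 (j # J))"
    by (rule sum.swap)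
  also have "\<dots> = (\<Sum>i\<in>I1. \<Sum>j\<in>I2. \<Sum>J\<in>words_of I2 n. f ((i, j) # zip I J) * x2 (j # J))"
    by (intro sum.cong refl sum.swap)
  also have "\<dots> = (\<Sum>i\<in>I1. x1 (i # I) * f [])"
    using InvD[OF assms f, of "_ # I" "[]" "[]"] I by (simp add: sum_words_Suc)
  finally show "(\<Sum>J\<in>words_of I2 n. f (zip I J) * (\<Sum>j\<in>I2. x2 (j # J))) = (\<Sum>i\<in>I1. x1 (i # I)) * f []"
    by (simp add: sum_distrib_right)
qed

lemma Inv_colour:
  assumes "(x1, x2) \<in> Inv (Suc (Suc n))"
  shows "(\<lambda>xs. of_bool (r1 (xs ! 0) (xs ! 1) = c) * x1 xs,
          \<lambda>xs. of_bool (r2 (xs ! 0) (xs ! 1) = c) * x2 xs) \<in> Inv (Suc (Suc n))"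
proof (rule InvI)
  fix f I assume f: "f \<in> iso_functionals" and I': "I \<in> words_of I1 (Suc (Suc n))"
  then obtain i k I0 where I: "I = i # k # I0" "i \<in> I1" "k \<in> I1" "I0 \<in> words_of I1 n"
    by (auto elim!: words_of_SucE)
  have eq: "f (zip I J) * (of_bool (r2 (J ! 0) (J ! 1) = c) * x2 J) =
      of_bool (r1 (I ! 0) (I ! 1) = c) * (f (zip I J) * x2 J)" if J0: "J \<in> words_of I2 (Suc (Suc n))" for J
  proof -
    obtain j J' where J': "J = j # J'" "j \<in> I2" "J' \<in> words_of I2 (Suc n)"
      using J0 by (rule words_of_SucE)
    obtain l J0 where "J' = l # J0" "l \<in> I2" "J0 \<in> words_of I2 n"
      using J'(3) by (rule words_of_SucE)
    note J = J'(1)[unfolded this(1)] J'(2) this(2,3)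
    show ?thesis using mismatch[OF f I(2,3) J(2,3), of "[]" "zip I0 J0"] by (cases "r1 i k = r2 j l") (auto simp: I J)
  qed
  have "(\<Sum>J\<in>words_of I2 (Suc (Suc n)). f (zip I J) * (of_bool (r2 (J ! 0) (J ! 1) = c) * x2 J)) =
      (\<Sum>J\<in>words_of I2 (Suc (Suc n)). of_bool (r1 (I ! 0) (I ! 1) = c) * (f (zip I J) * x2 J))"
    by (intro sum.cong refl eq)
  also have "\<dots> = of_bool (r1 (I ! 0) (I ! 1) = c) * x1 I * f []"
    using InvD[OF assms f I', of "[]" "[]"] by (simp only: sum_distrib_left[symmetric] append_Nil append_Nil2 mult.assoc)
  finally show "(\<Sum>J\<in>words_of I2 (Suc (Suc n)). f (zip I J) * (of_bool (r2 (J ! 0) (J ! 1) = c) * x2 J)) =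
      of_bool (r1 (I ! 0) (I ! 1) = c) * x1 I * f []" .
qed

lemma Inv_star:
  assumes "(x1, x2) \<in> Inv n"
  shows "(\<lambda>xs. cnj (x1 (rev xs)), \<lambda>xs. cnj (x2 (rev xs))) \<in> Inv n"
proof (rule InvI)
  fix f I assume f: "f \<in> iso_functionals" and I: "I \<in> words_of I1 n"
  have "(\<Sum>J\<in>words_of I2 n. f (zip I J) * cnj (x2 (rev J))) =
      (\<Sum>J\<in>words_of I2 n. f (zip I (rev J)) * cnj (x2 J))"
    using sum_words_rev[of "\<lambda>J. f (zip I J) * cnj (x2 (rev J))", symmetric] by simp
  also have "\<dots> = cnj (\<Sum>J\<in>words_of I2 n. cnj (f (rev (zip (rev I) J))) * x2 J)"
    using I by (simp add: zip_rev[symmetric] length_words_of)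
  also have "(\<Sum>J\<in>words_of I2 n. cnj (f (rev (zip (rev I) J))) * x2 J) = x1 (rev I) * cnj (f [])"
    using InvD[OF assms star_functional[OF f], of "rev I" "[]" "[]"] I by simp
  finally show "(\<Sum>J\<in>words_of I2 n. f (zip I J) * cnj (x2 (rev J))) = cnj (x1 (rev I)) * f []" by simp
qed

text \<open>Write \<open>R l\<close> for the product of \<open>x2 (l # J)\<close> with the letters of \<open>J\<close>, summed over \<open>J\<close>. Multiplying the invariance
  equation for \<open>k # I0\<close> by \<open>u\<^sub>k\<^sub>l\<close> on the left and summing over \<open>k\<close> gives \<open>R l = (\<Sum>k. x1 (k # I0) u\<^sub>k\<^sub>l)\<close>; multiplying
  this by \<open>u\<^sub>i\<^sub>l\<close> on the right and summing over \<open>l\<close> leaves the term \<open>k = i\<close>.\<close>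

lemma Inv_rotate:
  assumes x: "(x1, x2) \<in> Inv (Suc n)"
  shows "(\<lambda>xs. x1 (last xs # butlast xs), \<lambda>xs. x2 (last xs # butlast xs)) \<in> Inv (Suc n)"
proof (rule InvI)
  fix f I assume f: "f \<in> iso_functionals" and I': "I \<in> words_of I1 (Suc n)"
  define i where "i = last I"
  define I0 where "I0 = butlast I"
  have I: "I = I0 @ [i]" "i \<in> I1" "I0 \<in> words_of I1 n"
  proof -
    have "I \<noteq> []" using I' by (auto simp: words_of_def)
    then show *: "I = I0 @ [i]" by (simp add: i_def I0_def)
    show "i \<in> I1" "I0 \<in> words_of I1 n" using I' unfolding * by (auto simp: words_of_def)
  qed
  have key: "(\<Sum>J\<in>words_of I2 n. f (a @ zip I0 J @ b) * x2 (l # J)) =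
      (\<Sum>k\<in>I1. x1 (k # I0) * f (a @ (k, l) # b))" if l: "l \<in> I2" for l a b
  proof -
    have 1: "x1 (k # I0) * f (a @ (k, l) # b) = (\<Sum>J\<in>words_of I2 n. f (a @ (k, l) # zip I0 J @ b) * x2 (l # J))"
      if k: "k \<in> I1" for k
    proof -
      have "x1 (k # I0) * f (a @ (k, l) # b) =
          (\<Sum>J\<in>words_of I2 (Suc n). f ((a @ [(k, l)]) @ zip (k # I0) J @ b) * x2 J)"
        using InvD[OF x f, of "k # I0" "a @ [(k, l)]" b] I k by simp
      also have "\<dots> = (\<Sum>j\<in>I2. \<Sum>J\<in>words_of I2 n. f (a @ (k, l) # (k, j) # zip I0 J @ b) * x2 (j # J))"
        by (simp add: sum_words_Suc)
      also have "\<dots> = (\<Sum>j\<in>I2. if l = j then \<Sum>J\<in>words_of I2 n. f (a @ (k, l) # zip I0 J @ b) * x2 (j # J) else 0)"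
        by (intro sum.cong refl) (simp add: same_row[OF f k l])
      also have "\<dots> = (\<Sum>J\<in>words_of I2 n. f (a @ (k, l) # zip I0 J @ b) * x2 (l # J))"
        using l finite_I2 by simp
      finally show ?thesis .
    qed
    have "(\<Sum>k\<in>I1. x1 (k # I0) * f (a @ (k, l) # b)) =
        (\<Sum>k\<in>I1. \<Sum>J\<in>words_of I2 n. f (a @ (k, l) # zip I0 J @ b) * x2 (l # J))"
      by (simp add: 1)
    also have "\<dots> = (\<Sum>J\<in>words_of I2 n. (\<Sum>k\<in>I1. f (a @ (k, l) # zip I0 J @ b)) * x2 (l # J))"
      by (subst sum.swap) (simp add: sum_distrib_right)
    finally show ?thesis by (simp add: col_sum[OF f l])
  qed
  have "(\<Sum>J\<in>words_of I2 (Suc n). f (zip I J) * x2 (last J # butlast J)) =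
      (\<Sum>l\<in>I2. \<Sum>J\<in>words_of I2 n. f ([] @ zip I0 J @ [(i, l)]) * x2 (l # J))"
    using I by (simp add: sum_words_snoc length_words_of)
  also have "\<dots> = (\<Sum>l\<in>I2. \<Sum>k\<in>I1. x1 (k # I0) * f ([(k, l), (i, l)]))"
    using key[of _ "[]" "[(i, _)]"] by simp
  also have "\<dots> = (\<Sum>l\<in>I2. \<Sum>k\<in>I1. if k = i then x1 (i # I0) * f [(i, l)] else 0)"
    using same_col[OF f _ _ I(2), of _ _ "[]" "[]"] by (intro sum.cong refl) auto
  also have "\<dots> = x1 (i # I0) * f []"
    using I(2) finite_I1 row_sum[OF f I(2), of "[]" "[]"] by (simp flip: sum_distrib_left)
  finally show "(\<Sum>J\<in>words_of I2 (Suc n). f (zip I J) * x2 (last J # butlast J)) = x1 (last I # butlast I) * f []"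
    by (simp add: I)
qed

text \<open>Conjugating the rotation by the star operation reverses its direction.\<close>

lemma Inv_rotate_back:
  assumes x: "(x1, x2) \<in> Inv (Suc n)"
  shows "(\<lambda>xs. x1 (rotate1 xs), \<lambda>xs. x2 (rotate1 xs)) \<in> Inv (Suc n)"
proof (rule Inv_cong[OF Inv_star[OF Inv_rotate[OF Inv_star[OF x]]]])
  have r: "rev (last (rev xs) # butlast (rev xs)) = rotate1 xs" if "length xs = Suc n" for xs :: "'z list"
    using that by (cases xs) auto
  show "x1 (rotate1 xs) = cnj (cnj (x1 (rev (last (rev xs) # butlast (rev xs)))))" if "length xs = Suc n" for xs
    by (simp only: r[OF that] complex_cnj_cnj)
  show "x2 (rotate1 xs) = cnj (cnj (x2 (rev (last (rev xs) # butlast (rev xs)))))" if "length xs = Suc n" for xs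
    by (simp only: r[OF that] complex_cnj_cnj)
qed

end

section \<open>The Haar trace\<close>

locale nontrivial_coloured_pair = coloured_pair +
  assumes nontrivial: "\<exists>f\<in>iso_functionals. f [] \<noteq> 0"
begin

text \<open>This is where \<open>1 \<noteq> 0\<close> enters.\<close>

lemma Inv_determined:
  assumes x: "(x1, x2) \<in> Inv n" and 0: "\<And>J. J \<in> words_of I2 n \<Longrightarrow> x2 J = 0"
  shows "\<forall>I\<in>words_of I1 n. x1 I = 0"
proof
  fix I assume I: "I \<in> words_of I1 n"
  obtain f where f: "f \<in> iso_functionals" "f [] \<noteq> 0" using nontrivial by blast
  show "x1 I = 0" using InvD[OF x f(1) I, of "[]" "[]"] f(2) by (simp add: 0)
qed

definition inv_frame :: "nat \<Rightarrow> nat \<times> (nat \<Rightarrow> 'a list \<Rightarrow> complex) \<times> (nat \<Rightarrow> 'b list \<Rightarrow> complex)" where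
  "inv_frame n = (SOME (m, b, d). frame (Inv n) (words_of I1 n) (words_of I2 n) m b d)"

text \<open>The matrix that maps an invariant \<open>x2\<close> to its \<open>x1\<close> and vanishes on the orthogonal complement of the
  invariant vectors.\<close>

definition inv_kernel :: "nat \<Rightarrow> 'a list \<Rightarrow> 'b list \<Rightarrow> complex" where
  "inv_kernel n I J = (case inv_frame n of (m, b, d) \<Rightarrow> \<Sum>k<m. b k I * cnj (d k J))"

lemma inv_frameE:
  obtains m b d where "frame (Inv n) (words_of I1 n) (words_of I2 n) m b d"
    and "\<And>I J. inv_kernel n I J = (\<Sum>k<m. b k I * cnj (d k J))"
proof -
  have "\<exists>x. case x of (m, b, d) \<Rightarrow> frame (Inv n) (words_of I1 n) (words_of I2 n) m b d"
    using frame_exists[OF finite_words_of[OF finite_I2] pair_space_Inv Inv_determined] by simp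
  then have "case inv_frame n of (m, b, d) \<Rightarrow> frame (Inv n) (words_of I1 n) (words_of I2 n) m b d"
    unfolding inv_frame_def by (rule someI_ex)
  then show thesis
    by (cases "inv_frame n") (auto simp: inv_kernel_def intro!: that)
qed

text \<open>Inserting an index on one side is adjoint to contracting it on the other.\<close>

lemma inv_kernel_row:
  assumes i: "i \<in> I1" and I: "I \<in> words_of I1 n" and J: "J \<in> words_of I2 n"
  shows "(\<Sum>j\<in>I2. inv_kernel (Suc n) (i # I) (j # J)) = inv_kernel n I J"
proof -
  obtain m b d where fr: "frame (Inv n) (words_of I1 n) (words_of I2 n) m b d"
    and k: "\<And>I J. inv_kernel n I J = (\<Sum>k<m. b k I * cnj (d k J))" by (rule inv_frameE) blast
  obtain m' b' d' where fr': "frame (Inv (Suc n)) (words_of I1 (Suc n)) (words_of I2 (Suc n)) m' b' d'"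
    and k': "\<And>I J. inv_kernel (Suc n) I J = (\<Sum>k<m'. b' k I * cnj (d' k J))" by (rule inv_frameE) blast
  have "(\<Sum>k<m. b k (tl (i # I)) * cnj (d k J)) = (\<Sum>l<m'. b' l (i # I) * cnj (\<Sum>j\<in>I2. d' l (j # J)))"
    by (rule frame_transfer[OF fr fr', where A = "\<lambda>x xs. x (tl xs)" and C = "\<lambda>x xs. x (tl xs)"
          and A' = "\<lambda>x xs. \<Sum>i\<in>I1. x (i # xs)" and C' = "\<lambda>x xs. \<Sum>i\<in>I2. x (i # xs)"])
       (use i I J Inv_insert Inv_contract in
         \<open>auto simp: cip_def sum_words_Suc sum_distrib_right intro: sum.swap\<close>)
  then show ?thesis by (simp add: k k' sum_distrib_left sum.swap[of _ "I2"])
qed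

lemma inv_kernel_col:
  assumes j: "j \<in> I2" and I: "I \<in> words_of I1 n" and J: "J \<in> words_of I2 n"
  shows "(\<Sum>i\<in>I1. inv_kernel (Suc n) (i # I) (j # J)) = inv_kernel n I J"
proof -
  obtain m b d where fr: "frame (Inv n) (words_of I1 n) (words_of I2 n) m b d"
    and k: "\<And>I J. inv_kernel n I J = (\<Sum>k<m. b k I * cnj (d k J))" by (rule inv_frameE) blast
  obtain m' b' d' where fr': "frame (Inv (Suc n)) (words_of I1 (Suc n)) (words_of I2 (Suc n)) m' b' d'"
    and k': "\<And>I J. inv_kernel (Suc n) I J = (\<Sum>k<m'. b' k I * cnj (d' k J))" by (rule inv_frameE) blast
  have "(\<Sum>k<m'. (\<Sum>i\<in>I1. b' k (i # I)) * cnj (d' k (j # J))) = (\<Sum>l<m. b l I * cnj (d l (tl (j # J))))"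
    by (rule frame_transfer[OF fr' fr, where A' = "\<lambda>x xs. x (tl xs)" and C' = "\<lambda>x xs. x (tl xs)"
          and A = "\<lambda>x xs. \<Sum>i\<in>I1. x (i # xs)" and C = "\<lambda>x xs. \<Sum>i\<in>I2. x (i # xs)"])
       (use j I J Inv_insert Inv_contract in
         \<open>auto simp: cip_def sum_words_Suc sum_distrib_left intro: sum.swap\<close>)
  then show ?thesis by (simp add: k k' sum_distrib_right sum.swap[of _ "I1"])
qed

text \<open>The projection onto the words that start with a pair of colour \<open>c\<close> is self-adjoint. For \<open>c\<close> the colour of the
  first two entries of \<open>I\<close>, it fixes the kernel on the side of \<open>I\<close> and annihilates it on the side of \<open>J\<close>.\<close>

lemma inv_kernel_colour:
  assumes I: "I \<in> words_of I1 (Suc (Suc n))" and J: "J \<in> words_of I2 (Suc (Suc n))"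
    and ne: "r1 (I ! 0) (I ! 1) \<noteq> r2 (J ! 0) (J ! 1)"
  shows "inv_kernel (Suc (Suc n)) I J = 0"
proof -
  define c where "c = r1 (I ! 0) (I ! 1)"
  let ?n = "Suc (Suc n)"
  obtain m b d where fr: "frame (Inv ?n) (words_of I1 ?n) (words_of I2 ?n) m b d"
    and k: "\<And>I J. inv_kernel ?n I J = (\<Sum>k<m. b k I * cnj (d k J))" by (rule inv_frameE) blast
  have "(\<Sum>k<m. (of_bool (r1 (I ! 0) (I ! 1) = c) * b k I) * cnj (d k J)) =
      (\<Sum>k<m. b k I * cnj (of_bool (r2 (J ! 0) (J ! 1) = c) * d k J))"
    by (rule frame_transfer[OF fr fr,
          where A = "\<lambda>x xs. of_bool (r1 (xs ! 0) (xs ! 1) = c) * x xs"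
          and C = "\<lambda>x xs. of_bool (r2 (xs ! 0) (xs ! 1) = c) * x xs"
          and A' = "\<lambda>x xs. of_bool (r1 (xs ! 0) (xs ! 1) = c) * x xs"
          and C' = "\<lambda>x xs. of_bool (r2 (xs ! 0) (xs ! 1) = c) * x xs"])
       (use I J Inv_colour in \<open>auto simp: cip_def mult_ac intro!: sum.cong\<close>)
  then show ?thesis using ne by (simp add: k c_def)
qed

lemma inv_kernel_rotate:
  assumes "i \<in> I1" and "I \<in> words_of I1 n" and "j \<in> I2" and "J \<in> words_of I2 n"
  shows "inv_kernel (Suc n) (i # I) (j # J) = inv_kernel (Suc n) (I @ [i]) (J @ [j])"
proof -
  let ?n = "Suc n"
  obtain m b d where fr: "frame (Inv ?n) (words_of I1 ?n) (words_of I2 ?n) m b d"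
    and k: "\<And>I J. inv_kernel ?n I J = (\<Sum>k<m. b k I * cnj (d k J))" by (rule inv_frameE) blast
  have "(\<Sum>k<m. b k (last (I @ [i]) # butlast (I @ [i])) * cnj (d k (j # J))) =
      (\<Sum>k<m. b k (I @ [i]) * cnj (d k (rotate1 (j # J))))"
  proof (rule frame_transfer[OF fr fr,
          where A = "\<lambda>x xs. x (last xs # butlast xs)" and C = "\<lambda>x xs. x (last xs # butlast xs)"
          and A' = "\<lambda>x xs. x (rotate1 xs)" and C' = "\<lambda>x xs. x (rotate1 xs)"])
    show "cip (words_of I2 ?n) g' (\<lambda>xs. g (last xs # butlast xs)) = cip (words_of I2 ?n) (\<lambda>xs. g' (rotate1 xs)) g" for g g'
      unfolding cip_def by (subst sum_words_snoc, subst sum_words_Suc) simp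
  qed (use assms Inv_rotate Inv_rotate_back snoc_in_words_of in auto)
  then show ?thesis by (simp add: k)
qed

definition haar :: "('a \<times> 'b) list \<Rightarrow> complex" where
  "haar w = (if set w \<subseteq> I1 \<times> I2 then inv_kernel (length w) (map fst w) (map snd w) else 0)"

lemma haar_outside: "\<not> set w \<subseteq> I1 \<times> I2 \<Longrightarrow> haar w = 0"
  by (simp add: haar_def)

lemma haar_inside:
  "set w \<subseteq> I1 \<times> I2 \<Longrightarrow> haar w = inv_kernel (length w) (map fst w) (map snd w) \<and>
    map fst w \<in> words_of I1 (length w) \<and> map snd w \<in> words_of I2 (length w)"
  by (auto simp: haar_def words_of_def)

lemma haar_Nil: "haar [] = 1"
proof -
  obtain m b d where fr: "frame (Inv 0) (words_of I1 0) (words_of I2 0) m b d"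
    and k: "\<And>I J. inv_kernel 0 I J = (\<Sum>k<m. b k I * cnj (d k J))" by (rule inv_frameE) blast
  have "(\<lambda>_. 1, \<lambda>_. 1) \<in> Inv 0" by (rule InvI) simp
  then have "\<forall>s\<in>words_of I1 0. (1::complex) = (\<Sum>k<m. cip (words_of I2 0) (d k) (\<lambda>_. 1) * b k s)"
    using fr unfolding frame_def by blast
  then show ?thesis by (simp add: haar_def k cip_def mult.commute)
qed

lemma haar_rotate1: "haar (x # w) = haar (w @ [x])"
proof (cases "set (x # w) \<subseteq> I1 \<times> I2")
  case True
  obtain i j where x: "x = (i, j)" by force
  show ?thesis using True haar_inside[of "x # w"] haar_inside[of "w @ [x]"] haar_inside[of w]
      inv_kernel_rotate[of i "map fst w" "length w" j "map snd w"] x by simp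
next
  case False
  then show ?thesis by (simp add: haar_outside)
qed

lemma haar_commute: "haar (a @ b) = haar (b @ a)"
proof (induction a arbitrary: b)
  case (Cons x a)
  show ?case using haar_rotate1[of x "a @ b"] Cons.IH[of "b @ [x]"] by simp
qed simp

text \<open>Since \<open>haar\<close> is a trace, each relation can be moved to the front of the word.\<close>

lemma haar_in_iso_functionals: "haar \<in> iso_functionals"
  unfolding iso_functionals_def
proof (intro CollectI conjI allI ballI impI)
  fix a b :: "('a \<times> 'b) list"
  have front: "haar (a @ (i, j) # b) = haar ((i, j) # b @ a)" for i j
    using haar_commute[of a "(i, j) # b"] by simp
  have ab: "haar (a @ b) = haar (b @ a)" by (rule haar_commute)
  show "(\<Sum>j\<in>I2. haar (a @ (i, j) # b)) = haar (a @ b)" if i: "i \<in> I1" for i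
  proof (cases "set (b @ a) \<subseteq> I1 \<times> I2")
    case True
    have "(\<Sum>j\<in>I2. haar ((i, j) # b @ a)) =
        (\<Sum>j\<in>I2. inv_kernel (Suc (length (b @ a))) (i # map fst (b @ a)) (j # map snd (b @ a)))"
      using True i by (intro sum.cong refl) (simp add: haar_def)
    also have "\<dots> = haar (b @ a)"
      using haar_inside[OF True] inv_kernel_row[OF i] by simp
    finally show ?thesis by (simp add: front ab)
  next
    case False then show ?thesis by (simp add: front ab haar_outside)
  qed
  show "(\<Sum>i\<in>I1. haar (a @ (i, j) # b)) = haar (a @ b)" if j: "j \<in> I2" for j
  proof (cases "set (b @ a) \<subseteq> I1 \<times> I2")
    case True
    have "(\<Sum>i\<in>I1. haar ((i, j) # b @ a)) =
        (\<Sum>i\<in>I1. inv_kernel (Suc (length (b @ a))) (i # map fst (b @ a)) (j # map snd (b @ a)))"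
      using True j by (intro sum.cong refl) (simp add: haar_def)
    also have "\<dots> = haar (b @ a)"
      using haar_inside[OF True] inv_kernel_col[OF j] by simp
    finally show ?thesis by (simp add: front ab)
  next
    case False then show ?thesis by (simp add: front ab haar_outside)
  qed
  fix i k j l assume ij: "i \<in> I1" "k \<in> I1" "j \<in> I2" "l \<in> I2" and ne: "r1 i k \<noteq> r2 j l"
  have eq: "haar (a @ (i, j) # (k, l) # b) = haar ((i, j) # (k, l) # b @ a)"
    using haar_commute[of a "(i, j) # (k, l) # b"] by simp
  show "haar (a @ (i, j) # (k, l) # b) = 0"
  proof (cases "set (b @ a) \<subseteq> I1 \<times> I2")
    case True
    show ?thesis
      using haar_inside[OF True] ij ne True unfolding eq
      by (simp add: haar_def) (rule inv_kernel_colour; simp)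
  next
    case False then show ?thesis by (simp add: eq haar_outside)
  qed
qed

section \<open>Positivity of the Haar trace\<close>

definition short_words :: "nat \<Rightarrow> 'x set \<Rightarrow> 'x list set" where
  "short_words N S = (\<Union>n\<le>N. words_of S n)"

lemma finite_short_words: "finite S \<Longrightarrow> finite (short_words N S)"
  by (simp add: short_words_def finite_words_of)

lemma short_words_iff: "xs \<in> short_words N S \<longleftrightarrow> xs \<in> words_of S (length xs) \<and> length xs \<le> N"
  by (auto simp: short_words_def words_of_def)

lemma sum_short_words: "finite S \<Longrightarrow> (\<Sum>xs\<in>short_words N S. g xs) = (\<Sum>n\<le>N. \<Sum>xs\<in>words_of S n. g xs)"
  unfolding short_words_def
  by (rule sum.UNION_disjoint) (simp_all add: finite_words_of, auto simp: words_of_def)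

text \<open>Pairs of intertwiners, in the form of invariant vectors: the entry at \<open>(I, K)\<close> is the coefficient at \<open>rev I @ K\<close>, so that
  the letters of \<open>I\<close> contribute the adjoint of their product. Rows and columns are indexed by the words of all lengths up to \<open>N\<close>, because
  a positive functional has to be tested on combinations of words of different lengths.\<close>

definition Endo ::
  "nat \<Rightarrow> (('a list \<times> 'a list \<Rightarrow> complex) \<times> ('b list \<times> 'b list \<Rightarrow> complex)) set" where
  "Endo N = {(X1, X2). \<forall>f\<in>iso_functionals. \<forall>I\<in>short_words N I1. \<forall>K\<in>short_words N I1.
     (\<Sum>J\<in>words_of I2 (length I). \<Sum>L\<in>words_of I2 (length K). f (rev (zip I J) @ zip K L) * X2 (J, L)) =
     X1 (I, K) * f []}"

lemma EndoI:
  "(\<And>f I K. f \<in> iso_functionals \<Longrightarrow> I \<in> short_words N I1 \<Longrightarrow> K \<in> short_words N I1 \<Longrightarrow>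
     (\<Sum>J\<in>words_of I2 (length I). \<Sum>L\<in>words_of I2 (length K). f (rev (zip I J) @ zip K L) * X2 (J, L)) =
     X1 (I, K) * f []) \<Longrightarrow> (X1, X2) \<in> Endo N"
  by (simp add: Endo_def)

lemma EndoD:
  assumes "(X1, X2) \<in> Endo N" "f \<in> iso_functionals" "I \<in> short_words N I1" "K \<in> short_words N I1"
  shows "(\<Sum>J\<in>words_of I2 (length I). \<Sum>L\<in>words_of I2 (length K).
     f (a @ rev (zip I J) @ zip K L @ b) * X2 (J, L)) = X1 (I, K) * f (a @ b)"
  using assms shift[OF assms(2), of a b] by (auto simp: Endo_def)

lemma pair_space_Endo: "pair_space (Endo N)"
  unfolding pair_space_def
proof (intro conjI allI impI EndoI)
  fix X1 X2 f I K assume x: "(X1, X2) \<in> Endo N" and f: "f \<in> iso_functionals"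
    and I: "I \<in> short_words N I1" and K: "K \<in> short_words N I1"
  note x' = EndoD[OF x f I K, of "[]" "[]", simplified]
  show "(\<Sum>J\<in>words_of I2 (length I). \<Sum>L\<in>words_of I2 (length K).
     f (rev (zip I J) @ zip K L) * (c * X2 (J, L))) = c * X1 (I, K) * f []" for c
    using x' by (simp add: mult.left_commute[of _ c] mult.assoc flip: sum_distrib_left)
  fix Y1 Y2 assume y: "(Y1, Y2) \<in> Endo N"
  show "(\<Sum>J\<in>words_of I2 (length I). \<Sum>L\<in>words_of I2 (length K).
     f (rev (zip I J) @ zip K L) * (X2 (J, L) + Y2 (J, L))) = (X1 (I, K) + Y1 (I, K)) * f []"
    using x' EndoD[OF y f I K, of "[]" "[]", simplified] by (simp add: distrib_left distrib_right sum.distrib)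
qed

lemma Endo_determined:
  assumes x: "(X1, X2) \<in> Endo N" and 0: "\<And>p. p \<in> short_words N I2 \<times> short_words N I2 \<Longrightarrow> X2 p = 0"
  shows "\<forall>p\<in>short_words N I1 \<times> short_words N I1. X1 p = 0"
proof
  fix p assume "p \<in> short_words N I1 \<times> short_words N I1"
  then obtain I K where p: "p = (I, K)" and I: "I \<in> short_words N I1" and K: "K \<in> short_words N I1" by auto
  obtain f where f: "f \<in> iso_functionals" "f [] \<noteq> 0" using nontrivial by blast
  have "X2 (J, L) = 0" if "J \<in> words_of I2 (length I)" "L \<in> words_of I2 (length K)" for J L
    using that I K by (intro 0) (auto simp: short_words_iff words_of_def)
  then show "X1 p = 0" using EndoD[OF x f(1) I K, of "[]" "[]"] f(2) p by simp
qed

lemma Endo_star: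
  assumes x: "(X1, X2) \<in> Endo N"
  shows "(mstar X1, mstar X2) \<in> Endo N"
proof (rule EndoI)
  fix f I K assume f: "f \<in> iso_functionals" and I: "I \<in> short_words N I1" and K: "K \<in> short_words N I1"
  have "(\<Sum>J\<in>words_of I2 (length I). \<Sum>L\<in>words_of I2 (length K). f (rev (zip I J) @ zip K L) * mstar X2 (J, L)) =
      cnj (\<Sum>J\<in>words_of I2 (length I). \<Sum>L\<in>words_of I2 (length K). cnj (f (rev (rev (zip K L) @ zip I J))) * X2 (L, J))"
    by (simp add: mstar_def)
  also have "(\<Sum>J\<in>words_of I2 (length I). \<Sum>L\<in>words_of I2 (length K). cnj (f (rev (rev (zip K L) @ zip I J))) * X2 (L, J))
      = X1 (K, I) * cnj (f [])"
    using EndoD[OF x star_functional[OF f] K I, of "[]" "[]"] by (subst sum.swap) simp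
  finally show "(\<Sum>J\<in>words_of I2 (length I). \<Sum>L\<in>words_of I2 (length K). f (rev (zip I J) @ zip K L) * mstar X2 (J, L)) =
      mstar X1 (I, K) * f []" by (simp add: mstar_def)
qed

text \<open>Between the two factors one can insert \<open>\<Sum>M. u\<^sub>M\<^sub>N u\<^sub>M\<^sub>N\<^sub>'\<^sup>*\<close>, which is 1 for \<open>N = N'\<close> and 0 otherwise; then the
  invariance of each factor applies to its own half of the word.\<close>

lemma Endo_prod:
  assumes x: "(X1, X2) \<in> Endo N" and y: "(Y1, Y2) \<in> Endo N"
  shows "(mprod (short_words N I1) X1 Y1, mprod (short_words N I2) X2 Y2) \<in> Endo N"
proof (rule EndoI)
  fix f I K assume f: "f \<in> iso_functionals" and I: "I \<in> short_words N I1" and K: "K \<in> short_words N I1"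
  let ?J = "words_of I2 (length I)" and ?L = "words_of I2 (length K)"
  have level: "(\<Sum>M\<in>words_of I1 p. X1 (I, M) * Y1 (M, K)) * f [] =
      (\<Sum>J\<in>?J. \<Sum>L\<in>?L. f (rev (zip I J) @ zip K L) * (\<Sum>N\<in>words_of I2 p. X2 (J, N) * Y2 (N, L)))"
    if p: "p \<le> N" for p
  proof -
    let ?P = "words_of I2 p"
    let ?g = "\<lambda>M J Q Q' L. f (rev (zip I J) @ zip M Q @ rev (zip M Q') @ zip K L)"
    have "X1 (I, M) * Y1 (M, K) * f [] =
        (\<Sum>Q'\<in>?P. \<Sum>L\<in>?L. \<Sum>J\<in>?J. \<Sum>Q\<in>?P. ?g M J Q Q' L * X2 (J, Q) * Y2 (Q', L))"
      if M: "M \<in> words_of I1 p" for M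
    proof -
      have Ms: "M \<in> short_words N I1" and Ml: "length M = p"
        using M p by (auto simp: short_words_iff words_of_def)
      have "X1 (I, M) * Y1 (M, K) * f [] = X1 (I, M) * (\<Sum>Q'\<in>?P. \<Sum>L\<in>?L. f (rev (zip M Q') @ zip K L) * Y2 (Q', L))"
        using EndoD[OF y f Ms K, of "[]" "[]"] by (simp add: Ml)
      also have "\<dots> = (\<Sum>Q'\<in>?P. \<Sum>L\<in>?L. (X1 (I, M) * f ([] @ (rev (zip M Q') @ zip K L))) * Y2 (Q', L))"
        by (simp add: sum_distrib_left mult.assoc)
      also have "\<dots> = (\<Sum>Q'\<in>?P. \<Sum>L\<in>?L. \<Sum>J\<in>?J. \<Sum>Q\<in>?P. ?g M J Q Q' L * X2 (J, Q) * Y2 (Q', L))"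
        unfolding EndoD[OF x f I Ms, symmetric] by (simp add: Ml sum_distrib_right)
      finally show ?thesis .
    qed
    then have "(\<Sum>M\<in>words_of I1 p. X1 (I, M) * Y1 (M, K)) * f [] =
        (\<Sum>M\<in>words_of I1 p. \<Sum>Q'\<in>?P. \<Sum>L\<in>?L. \<Sum>J\<in>?J. \<Sum>Q\<in>?P. ?g M J Q Q' L * X2 (J, Q) * Y2 (Q', L))"
      by (simp add: sum_distrib_right)
    also have "\<dots> = (\<Sum>Q'\<in>?P. \<Sum>M\<in>words_of I1 p. \<Sum>L\<in>?L. \<Sum>J\<in>?J. \<Sum>Q\<in>?P. ?g M J Q Q' L * X2 (J, Q) * Y2 (Q', L))"
      by (rule sum.swap)
    also have "\<dots> = (\<Sum>Q'\<in>?P. \<Sum>L\<in>?L. \<Sum>M\<in>words_of I1 p. \<Sum>J\<in>?J. \<Sum>Q\<in>?P. ?g M J Q Q' L * X2 (J, Q) * Y2 (Q', L))"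
      by (intro sum.cong refl sum.swap)
    also have "\<dots> = (\<Sum>Q'\<in>?P. \<Sum>L\<in>?L. \<Sum>J\<in>?J. \<Sum>M\<in>words_of I1 p. \<Sum>Q\<in>?P. ?g M J Q Q' L * X2 (J, Q) * Y2 (Q', L))"
      by (intro sum.cong refl sum.swap)
    also have "\<dots> = (\<Sum>Q'\<in>?P. \<Sum>L\<in>?L. \<Sum>J\<in>?J. \<Sum>Q\<in>?P. \<Sum>M\<in>words_of I1 p. ?g M J Q Q' L * X2 (J, Q) * Y2 (Q', L))"
      by (intro sum.cong refl sum.swap)
    also have "\<dots> = (\<Sum>Q'\<in>?P. \<Sum>L\<in>?L. \<Sum>J\<in>?J. \<Sum>Q\<in>?P.
        (if Q = Q' then f (rev (zip I J) @ zip K L) * X2 (J, Q') * Y2 (Q', L) else 0))"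
      by (intro sum.cong refl) (simp add: sum_cancel[OF f] flip: sum_distrib_right)
    also have "\<dots> = (\<Sum>Q'\<in>?P. \<Sum>L\<in>?L. \<Sum>J\<in>?J. f (rev (zip I J) @ zip K L) * X2 (J, Q') * Y2 (Q', L))"
      by (simp add: finite_words_of finite_I2)
    also have "\<dots> = (\<Sum>L\<in>?L. \<Sum>Q'\<in>?P. \<Sum>J\<in>?J. f (rev (zip I J) @ zip K L) * X2 (J, Q') * Y2 (Q', L))"
      by (rule sum.swap)
    also have "\<dots> = (\<Sum>L\<in>?L. \<Sum>J\<in>?J. \<Sum>Q'\<in>?P. f (rev (zip I J) @ zip K L) * X2 (J, Q') * Y2 (Q', L))"
      by (intro sum.cong refl sum.swap)
    also have "\<dots> = (\<Sum>J\<in>?J. \<Sum>L\<in>?L. \<Sum>Q'\<in>?P. f (rev (zip I J) @ zip K L) * X2 (J, Q') * Y2 (Q', L))"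
      by (rule sum.swap)
    finally show ?thesis by (simp add: sum_distrib_left mult.assoc)
  qed
  have "(\<Sum>J\<in>?J. \<Sum>L\<in>?L. f (rev (zip I J) @ zip K L) * mprod (short_words N I2) X2 Y2 (J, L)) =
      (\<Sum>J\<in>?J. \<Sum>L\<in>?L. \<Sum>p\<le>N. f (rev (zip I J) @ zip K L) * (\<Sum>M\<in>words_of I2 p. X2 (J, M) * Y2 (M, L)))"
    by (simp add: mprod_def sum_short_words finite_I2 sum_distrib_left)
  also have "\<dots> = (\<Sum>J\<in>?J. \<Sum>p\<le>N. \<Sum>L\<in>?L. f (rev (zip I J) @ zip K L) * (\<Sum>M\<in>words_of I2 p. X2 (J, M) * Y2 (M, L)))"
    by (intro sum.cong refl sum.swap)
  also have "\<dots> = (\<Sum>p\<le>N. \<Sum>J\<in>?J. \<Sum>L\<in>?L. f (rev (zip I J) @ zip K L) * (\<Sum>M\<in>words_of I2 p. X2 (J, M) * Y2 (M, L)))"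
    by (rule sum.swap)
  also have "\<dots> = (\<Sum>p\<le>N. (\<Sum>M\<in>words_of I1 p. X1 (I, M) * Y1 (M, K)) * f [])"
    by (simp add: level)
  also have "\<dots> = mprod (short_words N I1) X1 Y1 (I, K) * f []"
    by (simp add: mprod_def sum_short_words finite_I1 sum_distrib_right)
  finally show "(\<Sum>J\<in>?J. \<Sum>L\<in>?L. f (rev (zip I J) @ zip K L) * mprod (short_words N I2) X2 Y2 (J, L)) =
      mprod (short_words N I1) X1 Y1 (I, K) * f []" .
qed

text \<open>The blocks of an intertwiner are invariant vectors, and conversely each invariant vector fills one block
  (\<open>Inv_to_Endo\<close>); these two operations are adjoint to each other.\<close>

lemma Endo_to_Inv:
  assumes x: "(X1, X2) \<in> Endo N" and n: "n \<le> N" and m: "m \<le> N"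
  shows "(\<lambda>xs. X1 (rev (take n xs), drop n xs), \<lambda>xs. X2 (rev (take n xs), drop n xs)) \<in> Inv (n + m)"
proof (rule InvI)
  fix f I' assume f: "f \<in> iso_functionals" and I': "I' \<in> words_of I1 (n + m)"
  define I where "I = rev (take n I')"
  define K where "K = drop n I'"
  have IK: "I' = rev I @ K" "length I = n" "length K = m" "I \<in> short_words N I1" "K \<in> short_words N I1"
    using I' n m set_take_subset[of n I'] set_drop_subset[of n I']
    by (auto simp: I_def K_def words_of_def short_words_iff)
  have "(\<Sum>J\<in>words_of I2 (n + m). f (zip I' J) * X2 (rev (take n J), drop n J)) =
      (\<Sum>J\<in>words_of I2 n. \<Sum>L\<in>words_of I2 m. f (zip (rev I) J @ zip K L) * X2 (rev J, L))"
    unfolding sum_words_append by (intro sum.cong refl) (simp add: IK(1,2) length_words_of)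
  also have "\<dots> = (\<Sum>J\<in>words_of I2 n. \<Sum>L\<in>words_of I2 m. f (zip (rev I) (rev J) @ zip K L) * X2 (J, L))"
    by (subst sum_words_rev[symmetric]) simp
  also have "\<dots> = (\<Sum>J\<in>words_of I2 n. \<Sum>L\<in>words_of I2 m. f (rev (zip I J) @ zip K L) * X2 (J, L))"
    by (intro sum.cong refl) (simp add: zip_rev IK(2) length_words_of)
  also have "\<dots> = X1 (I, K) * f []"
    using EndoD[OF x f IK(4,5), of "[]" "[]"] by (simp add: IK(2,3))
  finally show "(\<Sum>J\<in>words_of I2 (n + m). f (zip I' J) * X2 (rev (take n J), drop n J)) =
      X1 (rev (take n I'), drop n I') * f []" by (simp add: I_def K_def)
qed

lemma Inv_to_Endo:
  assumes x: "(x1, x2) \<in> Inv (n + m)"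
  shows "(\<lambda>(I, K). if length I = n \<and> length K = m then x1 (rev I @ K) else 0,
          \<lambda>(J, L). if length J = n \<and> length L = m then x2 (rev J @ L) else 0) \<in> Endo N"
proof (rule EndoI)
  fix f I K assume f: "f \<in> iso_functionals" and I: "I \<in> short_words N I1" and K: "K \<in> short_words N I1"
  show "(\<Sum>J\<in>words_of I2 (length I). \<Sum>L\<in>words_of I2 (length K). f (rev (zip I J) @ zip K L) *
      (case (J, L) of (J, L) \<Rightarrow> if length J = n \<and> length L = m then x2 (rev J @ L) else 0)) =
      (case (I, K) of (I, K) \<Rightarrow> if length I = n \<and> length K = m then x1 (rev I @ K) else 0) * f []"
  proof (cases "length I = n \<and> length K = m")
    case True
    have IK: "rev I @ K \<in> words_of I1 (n + m)" using I K True by (auto simp: short_words_iff words_of_def)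
    have "(\<Sum>J\<in>words_of I2 n. \<Sum>L\<in>words_of I2 m. f (rev (zip I J) @ zip K L) * x2 (rev J @ L)) =
        (\<Sum>J\<in>words_of I2 n. \<Sum>L\<in>words_of I2 m. f (zip (rev I @ K) (rev J @ L)) * x2 (rev J @ L))"
      using True by (intro sum.cong refl) (simp add: zip_rev length_words_of)
    also have "\<dots> = (\<Sum>J\<in>words_of I2 n. \<Sum>L\<in>words_of I2 m. f (zip (rev I @ K) (J @ L)) * x2 (J @ L))"
      using sum_words_rev[of "\<lambda>J. \<Sum>L\<in>words_of I2 m. f (zip (rev I @ K) (J @ L)) * x2 (J @ L)"] .
    also have "\<dots> = x1 (rev I @ K) * f []"
      using InvD[OF x f IK, of "[]" "[]"] by (simp add: sum_words_append)
    finally show ?thesis using True by (simp add: length_words_of)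
  next
    case False
    then show ?thesis by (auto simp: length_words_of)
  qed
qed

lemma Endo_frame_exists:
  "\<exists>m b d. frame (Endo N) (short_words N I1 \<times> short_words N I1) (short_words N I2 \<times> short_words N I2) m b d"
proof (rule frame_exists)
  show "finite (short_words N I2 \<times> short_words N I2)"
    by (intro finite_cartesian_product finite_short_words finite_I2)
qed (rule pair_space_Endo, rule Endo_determined)

lemma Endo_kernel:
  assumes fr: "frame (Endo N) (short_words N I1 \<times> short_words N I1) (short_words N I2 \<times> short_words N I2) m b d"
    and I: "I \<in> words_of I1 n" and J: "J \<in> words_of I2 n" and K: "K \<in> words_of I1 p" and L: "L \<in> words_of I2 p"
    and le: "n \<le> N" "p \<le> N"
  shows "(\<Sum>k<m. b k (I, K) * cnj (d k (J, L))) = inv_kernel (n + p) (rev I @ K) (rev J @ L)"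
proof -
  obtain m' b' d' where fr': "frame (Inv (n + p)) (words_of I1 (n + p)) (words_of I2 (n + p)) m' b' d'"
    and k: "\<And>I J. inv_kernel (n + p) I J = (\<Sum>k<m'. b' k I * cnj (d' k J))" by (rule inv_frameE) blast
  have len: "length I = n" "length J = n" "length K = p" "length L = p"
    using I J K L by (auto simp: words_of_def)
  have "(\<Sum>k<m. b k (rev (take n (rev I @ K)), drop n (rev I @ K)) * cnj (d k (J, L))) =
      (\<Sum>l<m'. b' l (rev I @ K) *
        cnj (case (J, L) of (J, L) \<Rightarrow> if length J = n \<and> length L = p then d' l (rev J @ L) else 0))"
  proof (rule frame_transfer[OF fr fr', where
        A = "\<lambda>X xs. X (rev (take n xs), drop n xs)" and C = "\<lambda>X xs. X (rev (take n xs), drop n xs)" and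
        A' = "\<lambda>x (I, K). if length I = n \<and> length K = p then x (rev I @ K) else 0" and
        C' = "\<lambda>x (I, K). if length I = n \<and> length K = p then x (rev I @ K) else 0"])
    fix g g'
    let ?S = "short_words N I2"
    have "cip (?S \<times> ?S) (\<lambda>(I, K). if length I = n \<and> length K = p then g' (rev I @ K) else 0) g =
        (\<Sum>J\<in>?S. \<Sum>L\<in>?S. if length J = n \<and> length L = p then cnj (g' (rev J @ L)) * g (J, L) else 0)"
      unfolding cip_Times by (intro sum.cong refl) auto
    also have "\<dots> = (\<Sum>J\<in>words_of I2 n. \<Sum>L\<in>?S. if length J = n \<and> length L = p then cnj (g' (rev J @ L)) * g (J, L) else 0)"
      using le by (intro sum.mono_neutral_right)
        (auto simp: short_words_iff words_of_def intro: finite_short_words finite_I2)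
    also have "\<dots> = (\<Sum>J\<in>words_of I2 n. \<Sum>L\<in>words_of I2 p. if length J = n \<and> length L = p then cnj (g' (rev J @ L)) * g (J, L) else 0)"
      using le by (intro sum.cong refl sum.mono_neutral_right)
        (auto simp: short_words_iff words_of_def intro: finite_short_words finite_I2)
    also have "\<dots> = (\<Sum>J\<in>words_of I2 n. \<Sum>L\<in>words_of I2 p. cnj (g' (rev J @ L)) * g (rev (rev J), L))"
      by (intro sum.cong refl) (auto simp: length_words_of)
    also have "\<dots> = (\<Sum>J\<in>words_of I2 n. \<Sum>L\<in>words_of I2 p. cnj (g' (J @ L)) * g (rev J, L))"
      using sum_words_rev[of "\<lambda>J. \<Sum>L\<in>words_of I2 p. cnj (g' (J @ L)) * g (rev J, L)"] by simp
    also have "\<dots> = cip (words_of I2 (n + p)) g' (\<lambda>xs. g (rev (take n xs), drop n xs))"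
      unfolding cip_def sum_words_append by (intro sum.cong refl) (simp add: length_words_of)
    finally show "cip (words_of I2 (n + p)) g' (\<lambda>xs. g (rev (take n xs), drop n xs)) =
        cip (?S \<times> ?S) (\<lambda>(I, K). if length I = n \<and> length K = p then g' (rev I @ K) else 0) g" ..
  next
    show "(J, L) \<in> short_words N I2 \<times> short_words N I2"
      using J L le by (auto simp: short_words_iff words_of_def)
    show "rev I @ K \<in> words_of I1 (n + p)" using I K by (auto simp: words_of_def)
  qed (use Endo_to_Inv[OF _ le] Inv_to_Endo in auto)
  then show ?thesis by (simp add: len k)
qed

text \<open>The Gram matrix of the words is the Choi kernel of the *-isomorphism between the two algebras of intertwiners,
  restricted to pairs of words of equal length.\<close>

lemma haar_positive:
  assumes fin: "finite C"
  shows "(\<Sum>w\<in>C. \<Sum>v\<in>C. cnj (c w) * haar (rev w @ v) * c v) \<in> \<real>\<^sub>\<ge>\<^sub>0"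
proof -
  define D where "D = {w \<in> C. set w \<subseteq> I1 \<times> I2}"
  have "finite D" using fin by (simp add: D_def)
  define N where "N = Max (insert 0 (length ` D))"
  have N: "length w \<le> N" if "w \<in> D" for w using that \<open>finite D\<close> by (simp add: N_def)
  let ?S1 = "short_words N I1" and ?S2 = "short_words N I2"
  define e where "e = (\<lambda>(I, J). if length I = length J \<and> zip I J \<in> D then c (zip I J) else 0)"
  obtain m b d where fr: "frame (Endo N) (?S1 \<times> ?S1) (?S2 \<times> ?S2) m b d"
    using Endo_frame_exists by blast
  define kappa where "kappa = (\<lambda>p q. \<Sum>k<m. b k p * cnj (d k q))"
  have pos: "(\<Sum>I\<in>?S1. \<Sum>J\<in>?S2. \<Sum>K\<in>?S1. \<Sum>L\<in>?S2. cnj (e (I, J)) * kappa (I, K) (J, L) * e (K, L)) \<in> \<real>\<^sub>\<ge>\<^sub>0"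
    unfolding kappa_def
    by (rule choi_positive[OF _ _ _ _ fr]) (auto intro: finite_short_words finite_I1 finite_I2 Endo_prod Endo_star)
  have sumD: "(\<Sum>I\<in>?S1. \<Sum>J\<in>?S2. if length I = length J \<and> zip I J \<in> D then g (I, J) else 0) =
      (\<Sum>w\<in>D. g (map fst w, map snd w))" for g :: "_ \<Rightarrow> complex"
  proof -
    have "(\<Sum>I\<in>?S1. \<Sum>J\<in>?S2. if length I = length J \<and> zip I J \<in> D then g (I, J) else 0) =
        (\<Sum>p\<in>?S1 \<times> ?S2. if length (fst p) = length (snd p) \<and> zip (fst p) (snd p) \<in> D then g p else 0)"
      unfolding sum.cartesian_product by (intro sum.cong refl) auto
    also have "\<dots> = (\<Sum>p\<in>{p \<in> ?S1 \<times> ?S2. length (fst p) = length (snd p) \<and> zip (fst p) (snd p) \<in> D}. g p)"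
      by (rule sum.inter_filter[symmetric]) (intro finite_cartesian_product finite_short_words finite_I1 finite_I2)
    also have "\<dots> = (\<Sum>w\<in>D. g (map fst w, map snd w))"
      by (rule sum.reindex_bij_witness[of _ "\<lambda>w. (map fst w, map snd w)" "\<lambda>p. zip (fst p) (snd p)"])
         (use N in \<open>auto simp: short_words_iff words_of_def zip_map_fst_snd D_def\<close>)
    finally show ?thesis .
  qed
  have "(\<Sum>I\<in>?S1. \<Sum>J\<in>?S2. \<Sum>K\<in>?S1. \<Sum>L\<in>?S2. cnj (e (I, J)) * kappa (I, K) (J, L) * e (K, L)) =
      (\<Sum>I\<in>?S1. \<Sum>J\<in>?S2. if length I = length J \<and> zip I J \<in> D then
        (\<lambda>(I, J). \<Sum>K\<in>?S1. \<Sum>L\<in>?S2. if length K = length L \<and> zip K L \<in> D then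
          (\<lambda>(K, L). cnj (c (zip I J)) * kappa (I, K) (J, L) * c (zip K L)) (K, L) else 0) (I, J) else 0)"
    by (intro sum.cong refl) (auto simp: e_def intro!: sum.cong)
  also have "\<dots> = (\<Sum>w\<in>D. \<Sum>v\<in>D. cnj (c w) * kappa (map fst w, map fst v) (map snd w, map snd v) * c v)"
    unfolding sumD by (simp add: zip_map_fst_snd)
  also have "\<dots> = (\<Sum>w\<in>D. \<Sum>v\<in>D. cnj (c w) * haar (rev w @ v) * c v)"
  proof (intro sum.cong refl)
    fix w v assume wv: "w \<in> D" "v \<in> D"
    then have s: "set w \<subseteq> I1 \<times> I2" "set v \<subseteq> I1 \<times> I2" by (auto simp: D_def)
    have "kappa (map fst w, map fst v) (map snd w, map snd v) = haar (rev w @ v)"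
      using Endo_kernel[OF fr _ _ _ _ N[OF wv(1)] N[OF wv(2)]] haar_inside[OF s(1)] haar_inside[OF s(2)] s
      by (simp add: kappa_def haar_def rev_map)
    then show "cnj (c w) * kappa (map fst w, map fst v) (map snd w, map snd v) * c v =
      cnj (c w) * haar (rev w @ v) * c v" by simp
  qed
  also have "\<dots> = (\<Sum>w\<in>C. \<Sum>v\<in>C. cnj (c w) * haar (rev w @ v) * c v)"
  proof -
    have "(\<Sum>w\<in>C. \<Sum>v\<in>C. cnj (c w) * haar (rev w @ v) * c v) = (\<Sum>w\<in>D. \<Sum>v\<in>C. cnj (c w) * haar (rev w @ v) * c v)"
      by (rule sum.mono_neutral_right) (use fin in \<open>auto simp: D_def haar_outside\<close>)
    also have "\<dots> = (\<Sum>w\<in>D. \<Sum>v\<in>D. cnj (c w) * haar (rev w @ v) * c v)"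
      by (intro sum.cong refl sum.mono_neutral_right) (use fin in \<open>auto simp: D_def haar_outside\<close>)
    finally show ?thesis ..
  qed
  finally show ?thesis using pos by simp
qed

end

section \<open>Semi-inner products on spaces of functions\<close>

locale semi_inner =
  fixes V :: "('w \<Rightarrow> complex) set" and ip :: "('w \<Rightarrow> complex) \<Rightarrow> ('w \<Rightarrow> complex) \<Rightarrow> complex"
  assumes add_closed: "a \<in> V \<Longrightarrow> b \<in> V \<Longrightarrow> (\<lambda>w. a w + b w) \<in> V"
    and scale_closed: "a \<in> V \<Longrightarrow> (\<lambda>w. c * a w) \<in> V"
    and ip_add: "a \<in> V \<Longrightarrow> b \<in> V \<Longrightarrow> d \<in> V \<Longrightarrow> ip (\<lambda>w. a w + b w) d = ip a d + ip b d"
    and ip_scale: "a \<in> V \<Longrightarrow> d \<in> V \<Longrightarrow> ip (\<lambda>w. c * a w) d = c * ip a d"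
    and ip_herm: "a \<in> V \<Longrightarrow> d \<in> V \<Longrightarrow> ip a d = cnj (ip d a)"
    and ip_pos: "a \<in> V \<Longrightarrow> 0 \<le> Re (ip a a)"
begin

definition nrm :: "('w \<Rightarrow> complex) \<Rightarrow> real" where "nrm a = sqrt (Re (ip a a))"

lemma diff_closed: "a \<in> V \<Longrightarrow> b \<in> V \<Longrightarrow> (\<lambda>w. a w - b w) \<in> V"
  using add_closed[of a "\<lambda>w. (-1) * b w"] scale_closed[of b "-1"] by simp

lemma ip_add_right: "a \<in> V \<Longrightarrow> b \<in> V \<Longrightarrow> d \<in> V \<Longrightarrow> ip d (\<lambda>w. a w + b w) = ip d a + ip d b"
  by (simp add: ip_herm[of d] ip_add add_closed)

lemma ip_scale_right: "a \<in> V \<Longrightarrow> d \<in> V \<Longrightarrow> ip d (\<lambda>w. c * a w) = cnj c * ip d a"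
  by (simp add: ip_herm[of d] ip_scale scale_closed)

lemma ip_diff: "a \<in> V \<Longrightarrow> b \<in> V \<Longrightarrow> d \<in> V \<Longrightarrow> ip (\<lambda>w. a w - b w) d = ip a d - ip b d"
  using ip_add[of a "\<lambda>w. (-1) * b w" d] scale_closed[of b "-1"] ip_scale[of b d "-1"] by simp

lemma ip_diff_right: "a \<in> V \<Longrightarrow> b \<in> V \<Longrightarrow> d \<in> V \<Longrightarrow> ip d (\<lambda>w. a w - b w) = ip d a - ip d b"
  by (simp add: ip_herm[of d] ip_diff diff_closed)

lemma nrm_nonneg: "a \<in> V \<Longrightarrow> 0 \<le> nrm a"
  by (simp add: nrm_def ip_pos)

lemma ip_self: "a \<in> V \<Longrightarrow> ip a a = of_real ((nrm a)\<^sup>2)"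
  using ip_herm[of a a] by (simp add: nrm_def ip_pos complex_eq_iff)

lemma cauchy_schwarz:
  assumes a: "a \<in> V" and b: "b \<in> V"
  shows "cmod (ip a b) \<le> nrm a * nrm b"
proof -
  define p where "p = ip a b"
  have quad: "0 \<le> (nrm a)\<^sup>2 - 2 * t * (cmod p)\<^sup>2 + t\<^sup>2 * (cmod p)\<^sup>2 * (nrm b)\<^sup>2" for t :: real
  proof -
    define z where "z = - of_real t * p"
    have zb: "(\<lambda>w. z * b w) \<in> V" by (rule scale_closed[OF b])
    have ba: "ip b a = cnj p" using ip_herm[OF b a] by (simp add: p_def)
    have "ip (\<lambda>w. a w + z * b w) (\<lambda>w. a w + z * b w) = ip a a + z * ip b a + cnj z * ip a b + z * cnj z * ip b b"
      by (simp add: ip_add ip_add_right ip_scale ip_scale_right a b zb add_closed algebra_simps)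
    also have "\<dots> = of_real ((nrm a)\<^sup>2 - 2 * t * (cmod p)\<^sup>2 + t\<^sup>2 * (cmod p)\<^sup>2 * (nrm b)\<^sup>2)"
    proof -
      have pp: "p * cnj p = of_real ((cmod p)\<^sup>2)" by (rule complex_norm_square[symmetric])
      have "z * cnj p = - of_real t * (p * cnj p)" "cnj z * p = - of_real t * (p * cnj p)"
        "z * cnj z = (of_real t)\<^sup>2 * (p * cnj p)"
        by (simp_all add: z_def power2_eq_square mult_ac)
      then show ?thesis
        unfolding ip_self[OF a] ip_self[OF b] ba p_def[symmetric] pp by simp
    qed
    finally show ?thesis using ip_pos[OF add_closed[OF a zb]] by simp
  qed
  have "(cmod p)\<^sup>2 \<le> (nrm a)\<^sup>2 * (nrm b)\<^sup>2"
  proof (cases "nrm b = 0")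
    case True
    have "(cmod p)\<^sup>2 = 0"
    proof (rule ccontr)
      assume "(cmod p)\<^sup>2 \<noteq> 0"
      then have "2 * (((nrm a)\<^sup>2 + 1) / (cmod p)\<^sup>2) * (cmod p)\<^sup>2 = 2 * ((nrm a)\<^sup>2 + 1)"
        by simp
      then have "(nrm a)\<^sup>2 - 2 * (((nrm a)\<^sup>2 + 1) / (cmod p)\<^sup>2) * (cmod p)\<^sup>2 =
          (nrm a)\<^sup>2 - 2 * ((nrm a)\<^sup>2 + 1)" by (simp only:)
      also have "\<dots> < 0"
      proof -
        have "x - 2 * (x + 1) < 0" if "0 \<le> x" for x :: real using that by simp
        then show ?thesis using zero_le_power2 by blast
      qed
      finally have "(nrm a)\<^sup>2 - 2 * (((nrm a)\<^sup>2 + 1) / (cmod p)\<^sup>2) * (cmod p)\<^sup>2 < 0" .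
      with quad[of "((nrm a)\<^sup>2 + 1) / (cmod p)\<^sup>2"] True show False by simp
    qed
    then show ?thesis by simp
  next
    case False
    have "(nrm b)\<^sup>2 > 0" using False by simp
    have "P \<le> A * B" if "0 \<le> A - 2 * (1 / B) * P + (1 / B)\<^sup>2 * P * B" "B > 0" for A B P :: real
    proof -
      have "(1 / B)\<^sup>2 * P * B = P / B" using that(2) by (simp add: power2_eq_square)
      then have "P / B \<le> A" using that(1) by simp
      then show ?thesis using that(2) by (simp add: pos_divide_le_eq)
    qed
    from this[OF quad \<open>(nrm b)\<^sup>2 > 0\<close>] show ?thesis .
  qed
  then have "(cmod p)\<^sup>2 \<le> (nrm a * nrm b)\<^sup>2" by (simp only: power_mult_distrib)
  then have "cmod p \<le> nrm a * nrm b"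
    by (rule power2_le_imp_le) (intro mult_nonneg_nonneg nrm_nonneg a b)
  then show ?thesis by (simp only: p_def)
qed

lemma nrm_triangle:
  assumes a: "a \<in> V" and b: "b \<in> V"
  shows "nrm (\<lambda>w. a w + b w) \<le> nrm a + nrm b"
proof (rule power2_le_imp_le)
  have "(nrm (\<lambda>w. a w + b w))\<^sup>2 = Re (ip (\<lambda>w. a w + b w) (\<lambda>w. a w + b w))"
    by (simp add: nrm_def ip_pos add_closed a b)
  also have "\<dots> = (nrm a)\<^sup>2 + (nrm b)\<^sup>2 + Re (ip a b) + Re (ip b a)"
    by (simp add: ip_add ip_add_right add_closed a b ip_self)
  also have "Re (ip a b) \<le> nrm a * nrm b"
    using cauchy_schwarz[OF a b] complex_Re_le_cmod[of "ip a b"] by linarith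
  also have "Re (ip b a) \<le> nrm a * nrm b"
    using cauchy_schwarz[OF b a] complex_Re_le_cmod[of "ip b a"] by (simp add: mult.commute)
  finally show "(nrm (\<lambda>w. a w + b w))\<^sup>2 \<le> (nrm a + nrm b)\<^sup>2"
    by (simp add: power2_sum)
qed (simp add: nrm_nonneg a b)

lemma nrm_scale: "a \<in> V \<Longrightarrow> nrm (\<lambda>w. c * a w) = cmod c * nrm a"
proof -
  assume a: "a \<in> V"
  have "ip (\<lambda>w. c * a w) (\<lambda>w. c * a w) = of_real ((cmod c)\<^sup>2 * (nrm a)\<^sup>2)"
    by (simp add: ip_scale ip_scale_right scale_closed a ip_self complex_norm_square mult_ac del: of_real_power)
  then show ?thesis using nrm_nonneg[OF a]
    by (simp only: nrm_def[of "\<lambda>w. c * a w"] complex.sel Re_complex_of_real real_sqrt_mult) simp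
qed

lemma nrm_diff_commute: "a \<in> V \<Longrightarrow> b \<in> V \<Longrightarrow> nrm (\<lambda>w. a w - b w) = nrm (\<lambda>w. b w - a w)"
  using nrm_scale[of "\<lambda>w. a w - b w" "-1"] diff_closed[of a b] by simp

lemma nrm_diff_triangle:
  "a \<in> V \<Longrightarrow> b \<in> V \<Longrightarrow> d \<in> V \<Longrightarrow> nrm (\<lambda>w. a w - d w) \<le> nrm (\<lambda>w. a w - b w) + nrm (\<lambda>w. b w - d w)"
  using nrm_triangle[of "\<lambda>w. a w - b w" "\<lambda>w. b w - d w"] diff_closed by simp

end

section \<open>Finitely supported functions\<close>

definition fin_supp :: "('w \<Rightarrow> complex) set" where
  "fin_supp = {a. finite {w. a w \<noteq> 0}}"

text \<open>The linear extension of \<open>g\<close> from points to formal linear combinations.\<close>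

definition lin :: "('w \<Rightarrow> complex) \<Rightarrow> ('w \<Rightarrow> complex) \<Rightarrow> complex" where
  "lin a g = (\<Sum>w | a w \<noteq> 0. a w * g w)"

lemma lin_superset:
  assumes "finite C" "{w. a w \<noteq> 0} \<subseteq> C"
  shows "lin a g = (\<Sum>w\<in>C. a w * g w)"
  unfolding lin_def by (rule sum.mono_neutral_left) (use assms in auto)

lemma fin_supp_add: "a \<in> fin_supp \<Longrightarrow> b \<in> fin_supp \<Longrightarrow> (\<lambda>w. a w + b w) \<in> fin_supp"
  unfolding fin_supp_def mem_Collect_eq
  by (rule finite_subset[of _ "{w. a w \<noteq> 0} \<union> {w. b w \<noteq> 0}"]) auto

lemma fin_supp_scale: "a \<in> fin_supp \<Longrightarrow> (\<lambda>w. c * a w) \<in> fin_supp"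
  unfolding fin_supp_def mem_Collect_eq by (rule finite_subset[of _ "{w. a w \<noteq> 0}"]) auto

lemma lin_add:
  assumes "a \<in> fin_supp" "b \<in> fin_supp"
  shows "lin (\<lambda>w. a w + b w) g = lin a g + lin b g"
proof -
  let ?C = "{w. a w \<noteq> 0} \<union> {w. b w \<noteq> 0}"
  have fin: "finite ?C" using assms by (simp add: fin_supp_def)
  have "lin (\<lambda>w. a w + b w) g = (\<Sum>w\<in>?C. (a w + b w) * g w)" by (rule lin_superset[OF fin]) auto
  moreover have "lin a g = (\<Sum>w\<in>?C. a w * g w)" by (rule lin_superset[OF fin]) auto
  moreover have "lin b g = (\<Sum>w\<in>?C. b w * g w)" by (rule lin_superset[OF fin]) auto
  ultimately show ?thesis by (simp add: distrib_right sum.distrib)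
qed

lemma lin_scale: "a \<in> fin_supp \<Longrightarrow> lin (\<lambda>w. c * a w) g = c * lin a g"
  using lin_superset[of "{w. a w \<noteq> 0}" "\<lambda>w. c * a w" g]
  by (simp add: fin_supp_def lin_def sum_distrib_left mult_ac subset_iff)

lemma lin_add_right: "lin a (\<lambda>w. g w + g' w) = lin a g + lin a g'"
  by (simp add: lin_def distrib_left sum.distrib)

lemma lin_scale_right: "lin a (\<lambda>w. c * g w) = c * lin a g"
  by (simp add: lin_def sum_distrib_left mult_ac)

definition unit_coeff :: "'w \<Rightarrow> 'w \<Rightarrow> complex" where "unit_coeff v = (\<lambda>w. of_bool (w = v))"

lemma unit_coeff_fin_supp: "unit_coeff v \<in> fin_supp"
  by (simp add: unit_coeff_def fin_supp_def)

lemma lin_unit_coeff: "lin (unit_coeff v) g = g v"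
  using lin_superset[of "{v}" "unit_coeff v" g] by (simp add: unit_coeff_def)

definition push :: "('w \<Rightarrow> 'w) \<Rightarrow> ('w \<Rightarrow> complex) \<Rightarrow> 'w \<Rightarrow> complex" where
  "push t a = (\<lambda>w. \<Sum>v | a v \<noteq> 0 \<and> t v = w. a v)"

lemma push_supp: "{w. push t a w \<noteq> 0} \<subseteq> t ` {v. a v \<noteq> 0}"
proof
  fix w assume "w \<in> {w. push t a w \<noteq> 0}"
  then have "\<exists>v\<in>{v. a v \<noteq> 0 \<and> t v = w}. a v \<noteq> 0"
    unfolding push_def mem_Collect_eq by (meson sum.not_neutral_contains_not_neutral)
  then show "w \<in> t ` {v. a v \<noteq> 0}" by blast
qed

lemma push_fin_supp: "a \<in> fin_supp \<Longrightarrow> push t a \<in> fin_supp"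
  unfolding fin_supp_def mem_Collect_eq using push_supp by (rule finite_subset) simp

lemma lin_push:
  assumes "a \<in> fin_supp"
  shows "lin (push t a) g = lin a (\<lambda>v. g (t v))"
proof -
  let ?A = "{v. a v \<noteq> 0}"
  have fin: "finite ?A" using assms by (simp add: fin_supp_def)
  have "lin (push t a) g = (\<Sum>w\<in>t ` ?A. push t a w * g w)"
    using fin push_supp[of t a] by (intro lin_superset) auto
  also have "\<dots> = (\<Sum>w\<in>t ` ?A. \<Sum>v | v \<in> ?A \<and> t v = w. a v * g (t v))"
    by (intro sum.cong refl) (simp add: push_def sum_distrib_right)
  also have "\<dots> = lin a (\<lambda>v. g (t v))"
    unfolding lin_def by (rule sum.image_gen[OF fin, symmetric])
  finally show ?thesis .
qed

lemma push_diff: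
  fixes t :: "'w \<Rightarrow> 'w"
  assumes a: "a \<in> fin_supp" and b: "b \<in> fin_supp"
  shows "push t (\<lambda>w. a w - b w) = (\<lambda>w. push t a w - push t b w)"
proof
  fix w :: 'w
  let ?g = "\<lambda>v. of_bool (v = w) :: complex"
  have eq: "push t c w = lin c (\<lambda>v. ?g (t v))" if "c \<in> fin_supp" for c
    unfolding push_def lin_def using that
    by (intro sum.mono_neutral_cong_left) (auto simp: fin_supp_def)
  have m: "(\<lambda>w. (-1) * b w) \<in> fin_supp" by (rule fin_supp_scale[OF b])
  have d: "(\<lambda>w. a w + (-1) * b w) \<in> fin_supp" by (rule fin_supp_add[OF a m])
  have "push t (\<lambda>w. a w + (-1) * b w) w = push t a w - push t b w"
    unfolding eq[OF a] eq[OF b] eq[OF d] lin_add[OF a m] lin_scale[OF b] by simp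
  then show "push t (\<lambda>w. a w - b w) w = push t a w - push t b w" by simp
qed

section \<open>The reproducing kernel Hilbert space of a positive kernel\<close>

text \<open>The space is the completion of the span of the functions \<open>\<lambda>w. K w v\<close>, realised by functions: its elements are the
  pointwise limits of Cauchy sequences in the span. An operation on the index set then acts on all of the space by composition.\<close>

locale positive_kernel =
  fixes K :: "'w \<Rightarrow> 'w \<Rightarrow> complex"
  assumes psd: "finite C \<Longrightarrow> (\<Sum>w\<in>C. \<Sum>v\<in>C. cnj (c w) * K w v * c v) \<in> \<real>\<^sub>\<ge>\<^sub>0"
begin

lemma K_herm: "K v w = cnj (K w v)"
proof (cases "v = w")
  case True
  have "K v v \<in> \<real>\<^sub>\<ge>\<^sub>0" using psd[of "{v}" "\<lambda>_. 1"] by simp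
  then show ?thesis using True by (auto simp: complex_nonneg_Reals_iff complex_eq_iff)
next
  case False
  have d: "Im (K x x) = 0" for x
    using psd[of "{x}" "\<lambda>_. 1"] by (auto simp: complex_nonneg_Reals_iff)
  have "(\<Sum>x\<in>{v, w}. \<Sum>y\<in>{v, w}. cnj ((\<lambda>_. 1) x) * K x y * (\<lambda>_. 1) y) \<in> \<real>\<^sub>\<ge>\<^sub>0"
    by (rule psd) simp
  then have 1: "Im (K v w) + Im (K w v) = 0"
    using False d by (simp add: complex_nonneg_Reals_iff)
  have "(\<Sum>x\<in>{v, w}. \<Sum>y\<in>{v, w}. cnj (if x = v then 1 else \<i>) * K x y * (if y = v then 1 else \<i>)) \<in> \<real>\<^sub>\<ge>\<^sub>0"
    by (rule psd) simp
  then have 2: "Re (K v w) - Re (K w v) = 0"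
    using False d by (simp add: complex_nonneg_Reals_iff)
  show ?thesis using 1 2 by (simp add: complex_eq_iff)
qed

text \<open>Elements of the span are represented by their coefficients, which need not be unique; this is why \<open>ip0\<close> is only a
  semi-inner product on \<open>fin_supp\<close>.\<close>

definition ev :: "('w \<Rightarrow> complex) \<Rightarrow> 'w \<Rightarrow> complex" where "ev a w = lin a (\<lambda>v. K w v)"

definition ip0 :: "('w \<Rightarrow> complex) \<Rightarrow> ('w \<Rightarrow> complex) \<Rightarrow> complex" where
  "ip0 a b = cnj (lin b (\<lambda>w. cnj (ev a w)))"

lemma ip0_pos: "a \<in> fin_supp \<Longrightarrow> ip0 a a \<in> \<real>\<^sub>\<ge>\<^sub>0"
proof -
  assume a: "a \<in> fin_supp"
  have "ip0 a a = (\<Sum>w | a w \<noteq> 0. \<Sum>v | a v \<noteq> 0. cnj (a w) * K w v * a v)"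
    by (simp add: ip0_def ev_def lin_def sum_distrib_left mult_ac)
  also have "\<dots> \<in> \<real>\<^sub>\<ge>\<^sub>0" using a by (intro psd) (simp add: fin_supp_def)
  finally show ?thesis .
qed

sublocale pre: semi_inner fin_supp ip0
proof
  fix a b d :: "'w \<Rightarrow> complex" and c :: complex
  assume a: "a \<in> fin_supp" and d: "d \<in> fin_supp"
  show "ip0 (\<lambda>w. c * a w) d = c * ip0 a d"
    by (simp add: ip0_def ev_def[abs_def] lin_scale a lin_scale_right)
  show "ip0 a d = cnj (ip0 d a)"
  proof -
    have "ip0 a d = (\<Sum>w | d w \<noteq> 0. \<Sum>v | a v \<noteq> 0. cnj (d w) * K w v * a v)"
      by (simp add: ip0_def ev_def lin_def sum_distrib_left mult_ac)
    also have "\<dots> = (\<Sum>v | a v \<noteq> 0. \<Sum>w | d w \<noteq> 0. cnj (d w) * cnj (K v w) * a v)"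
      by (subst sum.swap) (simp add: K_herm[symmetric])
    also have "\<dots> = cnj (ip0 d a)"
      by (simp add: ip0_def ev_def lin_def sum_distrib_left mult_ac)
    finally show ?thesis .
  qed
  show "0 \<le> Re (ip0 a a)" using ip0_pos[OF a] by (simp add: complex_nonneg_Reals_iff)
next
  fix a b d :: "'w \<Rightarrow> complex"
  assume a: "a \<in> fin_supp" and b: "b \<in> fin_supp" and d: "d \<in> fin_supp"
  show "ip0 (\<lambda>w. a w + b w) d = ip0 a d + ip0 b d"
    by (simp add: ip0_def ev_def[abs_def] lin_add a b lin_add_right)
qed (rule fin_supp_add fin_supp_scale; assumption)+

lemma ev_add: "a \<in> fin_supp \<Longrightarrow> b \<in> fin_supp \<Longrightarrow> ev (\<lambda>w. a w + b w) v = ev a v + ev b v"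
  by (simp add: ev_def lin_add)

lemma ev_scale: "a \<in> fin_supp \<Longrightarrow> ev (\<lambda>w. c * a w) v = c * ev a v"
  by (simp add: ev_def lin_scale)

lemma ev_diff: "a \<in> fin_supp \<Longrightarrow> b \<in> fin_supp \<Longrightarrow> ev (\<lambda>w. a w - b w) v = ev a v - ev b v"
  using ev_add[of a "\<lambda>w. (-1) * b w" v] ev_scale[of b "-1" v] fin_supp_scale[of b "-1"] by simp

lemma ip0_unit: "a \<in> fin_supp \<Longrightarrow> ip0 a (unit_coeff w) = ev a w"
  by (simp add: ip0_def lin_unit_coeff)

lemma ev_bound: "a \<in> fin_supp \<Longrightarrow> cmod (ev a w) \<le> pre.nrm a * pre.nrm (unit_coeff w)"
  using pre.cauchy_schwarz[of a "unit_coeff w"] by (simp add: ip0_unit unit_coeff_fin_supp)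

definition approx :: "(nat \<Rightarrow> 'w \<Rightarrow> complex) \<Rightarrow> ('w \<Rightarrow> complex) \<Rightarrow> bool" where
  "approx s \<phi> \<longleftrightarrow> (\<forall>n. s n \<in> fin_supp) \<and>
     (\<forall>e>0. \<exists>N. \<forall>m\<ge>N. \<forall>n\<ge>N. pre.nrm (\<lambda>w. s m w - s n w) < e) \<and>
     (\<forall>w. (\<lambda>n. ev (s n) w) \<longlonglongrightarrow> \<phi> w)"

definition rkhs :: "('w \<Rightarrow> complex) set" where "rkhs = {\<phi>. \<exists>s. approx s \<phi>}"

lemma approx_fin: "approx s \<phi> \<Longrightarrow> s n \<in> fin_supp" by (simp add: approx_def)

lemma approx_cauchy:
  "approx s \<phi> \<Longrightarrow> 0 < e \<Longrightarrow> \<exists>N. \<forall>m\<ge>N. \<forall>n\<ge>N. pre.nrm (\<lambda>w. s m w - s n w) < e"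
  by (simp add: approx_def)

lemma approx_lim: "approx s \<phi> \<Longrightarrow> (\<lambda>n. ev (s n) w) \<longlonglongrightarrow> \<phi> w" by (simp add: approx_def)

lemma approx_add:
  assumes s: "approx s \<phi>" and t: "approx t \<psi>"
  shows "approx (\<lambda>n w. s n w + t n w) (\<lambda>w. \<phi> w + \<psi> w)"
  unfolding approx_def
proof (intro conjI allI impI)
  show "(\<lambda>w. s n w + t n w) \<in> fin_supp" for n by (intro fin_supp_add approx_fin[OF s] approx_fin[OF t])
  show "(\<lambda>n. ev (\<lambda>w. s n w + t n w) w) \<longlonglongrightarrow> \<phi> w + \<psi> w" for w
    unfolding ev_add[OF approx_fin[OF s] approx_fin[OF t]]
    by (intro tendsto_add approx_lim s t)
  fix e :: real assume "0 < e"
  then have e2: "0 < e / 2" by simp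
  obtain N where N: "\<And>m n. m \<ge> N \<Longrightarrow> n \<ge> N \<Longrightarrow> pre.nrm (\<lambda>w. s m w - s n w) < e / 2"
    using approx_cauchy[OF s e2] by blast
  obtain M where M: "\<And>m n. m \<ge> M \<Longrightarrow> n \<ge> M \<Longrightarrow> pre.nrm (\<lambda>w. t m w - t n w) < e / 2"
    using approx_cauchy[OF t e2] by blast
  show "\<exists>N. \<forall>m\<ge>N. \<forall>n\<ge>N. pre.nrm (\<lambda>w. s m w + t m w - (s n w + t n w)) < e"
  proof (intro exI allI impI)
    fix m n assume "max N M \<le> m" "max N M \<le> n"
    then have "pre.nrm (\<lambda>w. s m w - s n w) < e / 2" "pre.nrm (\<lambda>w. t m w - t n w) < e / 2" using N M by auto
    moreover have "pre.nrm (\<lambda>w. (s m w - s n w) + (t m w - t n w)) \<le>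
        pre.nrm (\<lambda>w. s m w - s n w) + pre.nrm (\<lambda>w. t m w - t n w)"
      by (intro pre.nrm_triangle pre.diff_closed approx_fin[OF s] approx_fin[OF t])
    ultimately show "pre.nrm (\<lambda>w. s m w + t m w - (s n w + t n w)) < e" by (simp add: algebra_simps)
  qed
qed

lemma approx_scale:
  assumes s: "approx s \<phi>"
  shows "approx (\<lambda>n w. c * s n w) (\<lambda>w. c * \<phi> w)"
  unfolding approx_def
proof (intro conjI allI impI)
  show "(\<lambda>w. c * s n w) \<in> fin_supp" for n by (intro fin_supp_scale approx_fin[OF s])
  show "(\<lambda>n. ev (\<lambda>w. c * s n w) w) \<longlonglongrightarrow> c * \<phi> w" for w
    unfolding ev_scale[OF approx_fin[OF s]] by (intro tendsto_mult_left approx_lim s)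
  fix e :: real assume "0 < e"
  then have "0 < e / (cmod c + 1)" by (simp add: add_nonneg_pos)
  from approx_cauchy[OF s this] obtain N where
    N: "\<And>m n. m \<ge> N \<Longrightarrow> n \<ge> N \<Longrightarrow> pre.nrm (\<lambda>w. s m w - s n w) < e / (cmod c + 1)" by auto
  show "\<exists>N. \<forall>m\<ge>N. \<forall>n\<ge>N. pre.nrm (\<lambda>w. c * s m w - c * s n w) < e"
  proof (intro exI allI impI)
    fix m n assume mn: "N \<le> m" "N \<le> n"
    have d: "(\<lambda>w. s m w - s n w) \<in> fin_supp" by (intro pre.diff_closed approx_fin[OF s])
    have "pre.nrm (\<lambda>w. c * s m w - c * s n w) = cmod c * pre.nrm (\<lambda>w. s m w - s n w)"
      using pre.nrm_scale[OF d, of c] by (simp add: right_diff_distrib)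
    also have "\<dots> \<le> (cmod c + 1) * pre.nrm (\<lambda>w. s m w - s n w)"
      using pre.nrm_nonneg[OF d] by (intro mult_right_mono) auto
    also have "\<dots> < e" using N[OF mn] by (simp add: pos_less_divide_eq add_nonneg_pos mult.commute)
    finally show "pre.nrm (\<lambda>w. c * s m w - c * s n w) < e" .
  qed
qed

lemma approx_diff: "approx s \<phi> \<Longrightarrow> approx t \<psi> \<Longrightarrow> approx (\<lambda>n w. s n w - t n w) (\<lambda>w. \<phi> w - \<psi> w)"
  using approx_add[of s \<phi> "\<lambda>n w. (-1) * t n w" "\<lambda>w. (-1) * \<psi> w"] approx_scale[of t \<psi> "-1"] by simp

lemma approx_const:
  assumes a: "a \<in> fin_supp"
  shows "approx (\<lambda>n. a) (ev a)"
proof -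
  have "pre.nrm (\<lambda>w. 0) = 0" using pre.nrm_scale[OF a, of 0] by simp
  then show ?thesis using a by (simp add: approx_def)
qed

lemma approx_bounded:
  assumes s: "approx s \<phi>"
  shows "\<exists>M>0. \<forall>n. pre.nrm (s n) \<le> M"
proof -
  obtain N where N: "\<And>m n. m \<ge> N \<Longrightarrow> n \<ge> N \<Longrightarrow> pre.nrm (\<lambda>w. s m w - s n w) < 1"
    using approx_cauchy[OF s, of 1] by auto
  define M where "M = Max ((\<lambda>n. pre.nrm (s n)) ` {..N}) + 1"
  have le: "pre.nrm (s n) \<le> M - 1" if "n \<le> N" for n using that by (simp add: M_def)
  have "pre.nrm (s n) \<le> M" for n
  proof (cases "n \<le> N")
    case True then show ?thesis using le[of n] by simp
  next
    case False
    have "pre.nrm (\<lambda>w. (s n w - s N w) + s N w) \<le> pre.nrm (\<lambda>w. s n w - s N w) + pre.nrm (s N)"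
      by (intro pre.nrm_triangle pre.diff_closed approx_fin[OF s])
    then show ?thesis using N[of n N] False le[of N] by simp
  qed
  moreover have "M > 0" using le[of 0] pre.nrm_nonneg[OF approx_fin[OF s], of 0] by simp
  ultimately show ?thesis by blast
qed

text \<open>In \<open>\<parallel>s n\<parallel>\<^sup>2 = \<langle>s n, s n - s N\<rangle> + \<langle>s n, s N\<rangle>\<close> the first summand is small by the Cauchy property. The second one is a finite
  combination of values of \<open>ev (s n)\<close>, as \<open>s N\<close> is finitely supported, and tends to 0. So the norm of a limit
  depends on the limit function only.\<close>

lemma approx_zero:
  assumes s: "approx s (\<lambda>_. 0)"
  shows "(\<lambda>n. pre.nrm (s n)) \<longlonglongrightarrow> 0"
proof -
  obtain M where M: "M > 0" "\<And>n. pre.nrm (s n) \<le> M" using approx_bounded[OF s] by blast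
  have "(\<lambda>n. (pre.nrm (s n))\<^sup>2) \<longlonglongrightarrow> 0"
  proof (rule LIMSEQ_I)
    fix e :: real assume e: "0 < e"
    then have "0 < e / (2 * M)" using M by simp
    from approx_cauchy[OF s this] obtain N where
      N: "\<And>m n. m \<ge> N \<Longrightarrow> n \<ge> N \<Longrightarrow> pre.nrm (\<lambda>w. s m w - s n w) < e / (2 * M)" by auto
    have "(\<lambda>n. ip0 (s n) (s N)) \<longlonglongrightarrow> cnj (\<Sum>w | s N w \<noteq> 0. s N w * cnj 0)"
      unfolding ip0_def lin_def by (intro tendsto_intros approx_lim[OF s])
    then have "(\<lambda>n. ip0 (s n) (s N)) \<longlonglongrightarrow> 0" by simp
    from LIMSEQ_D[OF this, of "e / 2"] e obtain N' where N': "\<And>n. n \<ge> N' \<Longrightarrow> cmod (ip0 (s n) (s N)) < e / 2" by auto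
    show "\<exists>N. \<forall>n\<ge>N. norm ((pre.nrm (s n))\<^sup>2 - 0) < e"
    proof (intro exI allI impI)
      fix n assume n: "max N N' \<le> n"
      note S = approx_fin[OF s]
      have "(pre.nrm (s n))\<^sup>2 = cmod (ip0 (s n) (s n))" by (simp add: pre.ip_self[OF S] norm_power)
      also have "ip0 (s n) (s n) = ip0 (s n) (\<lambda>w. s n w - s N w) + ip0 (s n) (s N)"
        by (simp add: pre.ip_diff_right S)
      also have "cmod \<dots> \<le> cmod (ip0 (s n) (\<lambda>w. s n w - s N w)) + cmod (ip0 (s n) (s N))"
        by (rule norm_triangle_ineq)
      also have "cmod (ip0 (s n) (\<lambda>w. s n w - s N w)) \<le> pre.nrm (s n) * pre.nrm (\<lambda>w. s n w - s N w)"
        by (intro pre.cauchy_schwarz pre.diff_closed S)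
      also have "\<dots> \<le> M * (e / (2 * M))"
        using M N[of n N] n pre.nrm_nonneg[OF pre.diff_closed[OF S S], of n N]
        by (intro mult_mono) (auto intro: less_imp_le)
      also have "\<dots> = e / 2" using M by simp
      also have "e / 2 + cmod (ip0 (s n) (s N)) < e" using N'[of n] n by simp
      finally show "norm ((pre.nrm (s n))\<^sup>2 - 0) < e" by simp
    qed
  qed
  then have "(\<lambda>n. sqrt ((pre.nrm (s n))\<^sup>2)) \<longlonglongrightarrow> sqrt 0" by (rule tendsto_real_sqrt)
  then show ?thesis using pre.nrm_nonneg[OF approx_fin[OF s]] by simp
qed

lemma ip0_diff_bound:
  assumes "a \<in> fin_supp" "b \<in> fin_supp" "a' \<in> fin_supp" "b' \<in> fin_supp"
  shows "cmod (ip0 a b - ip0 a' b') \<le> pre.nrm (\<lambda>w. a w - a' w) * pre.nrm b + pre.nrm a' * pre.nrm (\<lambda>w. b w - b' w)"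
proof -
  have "ip0 a b - ip0 a' b' = ip0 (\<lambda>w. a w - a' w) b + ip0 a' (\<lambda>w. b w - b' w)"
    using assms by (simp add: pre.ip_diff pre.ip_diff_right)
  also have "cmod \<dots> \<le> cmod (ip0 (\<lambda>w. a w - a' w) b) + cmod (ip0 a' (\<lambda>w. b w - b' w))"
    by (rule norm_triangle_ineq)
  also have "\<dots> \<le> pre.nrm (\<lambda>w. a w - a' w) * pre.nrm b + pre.nrm a' * pre.nrm (\<lambda>w. b w - b' w)"
    using assms by (intro add_mono pre.cauchy_schwarz pre.diff_closed)
  finally show ?thesis .
qed

lemma ip0_convergent:
  assumes s: "approx s \<phi>" and t: "approx t \<psi>"
  shows "convergent (\<lambda>n. ip0 (s n) (t n))"
proof -
  obtain M where M: "M > 0" "\<And>n. pre.nrm (s n) \<le> M" using approx_bounded[OF s] by blast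
  obtain M' where M': "M' > 0" "\<And>n. pre.nrm (t n) \<le> M'" using approx_bounded[OF t] by blast
  have "Cauchy (\<lambda>n. ip0 (s n) (t n))"
  proof (rule CauchyI)
    fix e :: real assume e: "0 < e"
    then obtain N N' where N: "\<And>m n. m \<ge> N \<Longrightarrow> n \<ge> N \<Longrightarrow> pre.nrm (\<lambda>w. s m w - s n w) < e / (2 * M')"
      and N': "\<And>m n. m \<ge> N' \<Longrightarrow> n \<ge> N' \<Longrightarrow> pre.nrm (\<lambda>w. t m w - t n w) < e / (2 * M)"
      using approx_cauchy[OF s, of "e / (2 * M')"] approx_cauchy[OF t, of "e / (2 * M)"] M M' by fastforce
    show "\<exists>N. \<forall>m\<ge>N. \<forall>n\<ge>N. norm (ip0 (s m) (t m) - ip0 (s n) (t n)) < e"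
    proof (intro exI allI impI)
      fix m n assume mn: "max N N' \<le> m" "max N N' \<le> n"
      note S = approx_fin[OF s] and T = approx_fin[OF t]
      have "cmod (ip0 (s m) (t m) - ip0 (s n) (t n)) \<le>
          pre.nrm (\<lambda>w. s m w - s n w) * pre.nrm (t m) + pre.nrm (s n) * pre.nrm (\<lambda>w. t m w - t n w)"
        by (rule ip0_diff_bound[OF S T S T])
      also have "\<dots> \<le> pre.nrm (\<lambda>w. s m w - s n w) * M' + M * pre.nrm (\<lambda>w. t m w - t n w)"
        using M M' by (intro add_mono mult_left_mono mult_right_mono pre.nrm_nonneg pre.diff_closed S T) auto
      also have "\<dots> < e / (2 * M') * M' + M * (e / (2 * M))"
        using M M' N[of m n] N'[of m n] mn by (intro add_strict_mono mult_strict_right_mono mult_strict_left_mono) auto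
      also have "\<dots> = e" using M M' by simp
      finally show "norm (ip0 (s m) (t m) - ip0 (s n) (t n)) < e" .
    qed
  qed
  then show ?thesis by (rule Cauchy_convergent)
qed

definition approximant :: "('w \<Rightarrow> complex) \<Rightarrow> nat \<Rightarrow> 'w \<Rightarrow> complex" where
  "approximant \<phi> = (SOME s. approx s \<phi>)"

text \<open>The limit does not depend on the choice of the approximating sequences, see \<open>ipH_lim\<close>.\<close>

definition ipH :: "('w \<Rightarrow> complex) \<Rightarrow> ('w \<Rightarrow> complex) \<Rightarrow> complex" where
  "ipH \<phi> \<psi> = lim (\<lambda>n. ip0 (approximant \<phi> n) (approximant \<psi> n))"

lemma approximant: "\<phi> \<in> rkhs \<Longrightarrow> approx (approximant \<phi>) \<phi>"
  unfolding rkhs_def approximant_def by (auto intro: someI[of "\<lambda>s. approx s \<phi>"])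

lemma approx_in_rkhs: "approx s \<phi> \<Longrightarrow> \<phi> \<in> rkhs" by (auto simp: rkhs_def)

lemma ipH_lim:
  assumes s: "approx s \<phi>" and t: "approx t \<psi>"
  shows "(\<lambda>n. ip0 (s n) (t n)) \<longlonglongrightarrow> ipH \<phi> \<psi>"
proof -
  define s' where "s' = approximant \<phi>"
  define t' where "t' = approximant \<psi>"
  have s': "approx s' \<phi>" and t': "approx t' \<psi>"
    using approximant approx_in_rkhs s t by (auto simp: s'_def t'_def)
  have 1: "(\<lambda>n. ip0 (s' n) (t' n)) \<longlonglongrightarrow> ipH \<phi> \<psi>"
    using ip0_convergent[OF s' t'] by (simp add: ipH_def s'_def t'_def convergent_LIMSEQ_iff)
  obtain M where M: "\<And>n. pre.nrm (s' n) \<le> M" using approx_bounded[OF s'] by blast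
  obtain M' where M': "\<And>n. pre.nrm (t n) \<le> M'" using approx_bounded[OF t] by blast
  note F = approx_fin[OF s] approx_fin[OF t] approx_fin[OF s'] approx_fin[OF t']
  have z: "(\<lambda>n. pre.nrm (\<lambda>w. s n w - s' n w)) \<longlonglongrightarrow> 0" "(\<lambda>n. pre.nrm (\<lambda>w. t n w - t' n w)) \<longlonglongrightarrow> 0"
    using approx_zero approx_diff[OF s s'] approx_diff[OF t t'] by auto
  have "(\<lambda>n. ip0 (s n) (t n) - ip0 (s' n) (t' n)) \<longlonglongrightarrow> 0"
  proof (rule tendsto_norm_zero_cancel, rule tendsto_sandwich[where f = "\<lambda>_. 0"])
    show "\<forall>\<^sub>F n in sequentially. cmod (ip0 (s n) (t n) - ip0 (s' n) (t' n)) \<le>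
        pre.nrm (\<lambda>w. s n w - s' n w) * M' + M * pre.nrm (\<lambda>w. t n w - t' n w)"
    proof (rule always_eventually, rule allI)
      fix n
      have "cmod (ip0 (s n) (t n) - ip0 (s' n) (t' n)) \<le>
          pre.nrm (\<lambda>w. s n w - s' n w) * pre.nrm (t n) + pre.nrm (s' n) * pre.nrm (\<lambda>w. t n w - t' n w)"
        by (rule ip0_diff_bound[OF F])
      also have "\<dots> \<le> pre.nrm (\<lambda>w. s n w - s' n w) * M' + M * pre.nrm (\<lambda>w. t n w - t' n w)"
        by (intro add_mono mult_left_mono mult_right_mono M M' pre.nrm_nonneg pre.diff_closed F)
      finally show "cmod (ip0 (s n) (t n) - ip0 (s' n) (t' n)) \<le>
          pre.nrm (\<lambda>w. s n w - s' n w) * M' + M * pre.nrm (\<lambda>w. t n w - t' n w)" .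
    qed
    have "(\<lambda>n. pre.nrm (\<lambda>w. s n w - s' n w) * M' + M * pre.nrm (\<lambda>w. t n w - t' n w)) \<longlonglongrightarrow> 0 * M' + M * 0"
      by (intro tendsto_intros z)
    then show "(\<lambda>n. pre.nrm (\<lambda>w. s n w - s' n w) * M' + M * pre.nrm (\<lambda>w. t n w - t' n w)) \<longlonglongrightarrow> 0" by simp
  qed auto
  from tendsto_add[OF this 1] show ?thesis by simp
qed

lemma ev_in_rkhs: "a \<in> fin_supp \<Longrightarrow> ev a \<in> rkhs"
  using approx_const approx_in_rkhs by blast

sublocale H: semi_inner rkhs ipH
proof
  fix a b assume "a \<in> rkhs" "b \<in> rkhs"
  then show "(\<lambda>w. a w + b w) \<in> rkhs" using approx_add[OF approximant approximant] approx_in_rkhs by blast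
next
  fix a c assume "a \<in> rkhs"
  then show "(\<lambda>w. c * a w) \<in> rkhs" using approx_scale[OF approximant] approx_in_rkhs by blast
next
  fix a b d assume "a \<in> rkhs" "b \<in> rkhs" "d \<in> rkhs"
  then obtain s t u where st: "approx s a" "approx t b" "approx u d" by (auto simp: rkhs_def)
  have "(\<lambda>n. ip0 (\<lambda>w. s n w + t n w) (u n)) \<longlonglongrightarrow> ipH (\<lambda>w. a w + b w) d"
    by (intro ipH_lim approx_add st)
  moreover have "(\<lambda>n. ip0 (\<lambda>w. s n w + t n w) (u n)) \<longlonglongrightarrow> ipH a d + ipH b d"
    by (simp add: pre.ip_add st[THEN approx_fin]) (intro tendsto_add ipH_lim st)
  ultimately show "ipH (\<lambda>w. a w + b w) d = ipH a d + ipH b d" by (rule LIMSEQ_unique)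
next
  fix a d c assume "a \<in> rkhs" "d \<in> rkhs"
  then obtain s u where st: "approx s a" "approx u d" by (auto simp: rkhs_def)
  have "(\<lambda>n. ip0 (\<lambda>w. c * s n w) (u n)) \<longlonglongrightarrow> ipH (\<lambda>w. c * a w) d"
    by (intro ipH_lim approx_scale st)
  moreover have "(\<lambda>n. ip0 (\<lambda>w. c * s n w) (u n)) \<longlonglongrightarrow> c * ipH a d"
    by (simp add: pre.ip_scale st[THEN approx_fin]) (intro tendsto_mult_left ipH_lim st)
  ultimately show "ipH (\<lambda>w. c * a w) d = c * ipH a d" by (rule LIMSEQ_unique)
next
  fix a d assume "a \<in> rkhs" "d \<in> rkhs"
  then obtain s u where st: "approx s a" "approx u d" by (auto simp: rkhs_def)
  have "(\<lambda>n. cnj (ip0 (u n) (s n))) \<longlonglongrightarrow> cnj (ipH d a)"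
    by (intro tendsto_cnj ipH_lim st)
  then have "(\<lambda>n. ip0 (s n) (u n)) \<longlonglongrightarrow> cnj (ipH d a)"
    using pre.ip_herm[OF approx_fin[OF st(1)] approx_fin[OF st(2)]] by simp
  then show "ipH a d = cnj (ipH d a)" using ipH_lim[OF st] LIMSEQ_unique by blast
next
  fix a assume "a \<in> rkhs"
  then obtain s where s: "approx s a" by (auto simp: rkhs_def)
  show "0 \<le> Re (ipH a a)"
    by (rule LIMSEQ_le_const[OF tendsto_Re[OF ipH_lim[OF s s]]]) (use pre.ip_pos[OF approx_fin[OF s]] in auto)
qed

lemma nrmH_lim: "approx s \<phi> \<Longrightarrow> (\<lambda>n. pre.nrm (s n)) \<longlonglongrightarrow> H.nrm \<phi>"
  unfolding pre.nrm_def H.nrm_def by (intro tendsto_real_sqrt tendsto_Re ipH_lim)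

lemma nrmH_ev: "a \<in> fin_supp \<Longrightarrow> H.nrm (ev a) = pre.nrm a"
  using nrmH_lim[OF approx_const] by (simp add: LIMSEQ_const_iff)

lemma point_bound:
  assumes "\<phi> \<in> rkhs"
  shows "cmod (\<phi> w) \<le> H.nrm \<phi> * pre.nrm (unit_coeff w)"
proof -
  note s = approximant[OF assms]
  show ?thesis
  proof (rule LIMSEQ_le)
    show "(\<lambda>n. cmod (ev (approximant \<phi> n) w)) \<longlonglongrightarrow> cmod (\<phi> w)" by (intro tendsto_norm approx_lim s)
    show "(\<lambda>n. pre.nrm (approximant \<phi> n) * pre.nrm (unit_coeff w)) \<longlonglongrightarrow> H.nrm \<phi> * pre.nrm (unit_coeff w)"
      by (intro tendsto_mult_right nrmH_lim s)
  qed (use ev_bound[OF approx_fin[OF s]] in auto)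
qed

lemma nrmH_eq_0: "\<phi> \<in> rkhs \<Longrightarrow> H.nrm \<phi> = 0 \<Longrightarrow> \<phi> = (\<lambda>_. 0)"
  using point_bound[of \<phi>] by auto

lemma rkhs_dense:
  assumes "\<phi> \<in> rkhs" "e > 0"
  shows "\<exists>a\<in>fin_supp. H.nrm (\<lambda>w. \<phi> w - ev a w) < e"
proof -
  obtain s where s: "approx s \<phi>" using assms by (auto simp: rkhs_def)
  obtain N where N: "\<And>m n. m \<ge> N \<Longrightarrow> n \<ge> N \<Longrightarrow> pre.nrm (\<lambda>w. s m w - s n w) < e / 2"
    using approx_cauchy[OF s, of "e / 2"] assms(2) by auto
  have "(\<lambda>n. pre.nrm (\<lambda>w. s n w - s N w)) \<longlonglongrightarrow> H.nrm (\<lambda>w. \<phi> w - ev (s N) w)"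
    by (intro nrmH_lim approx_diff s approx_const approx_fin[OF s])
  then have "H.nrm (\<lambda>w. \<phi> w - ev (s N) w) \<le> e / 2"
    by (rule LIMSEQ_le_const2) (use N in \<open>auto intro!: exI[of _ N] less_imp_le\<close>)
  then show ?thesis using approx_fin[OF s] assms(2) by (intro bexI[of _ "s N"]) auto
qed

text \<open>Replace each member of the Cauchy sequence by a nearby element of the span; the pointwise limit of these is the limit.\<close>

lemma rkhs_complete:
  assumes F: "\<And>k. F k \<in> rkhs"
    and C: "\<And>e. e > 0 \<Longrightarrow> \<exists>N. \<forall>m\<ge>N. \<forall>n\<ge>N. H.nrm (\<lambda>w. F m w - F n w) < e"
  shows "\<exists>\<phi>\<in>rkhs. (\<lambda>k. H.nrm (\<lambda>w. F k w - \<phi> w)) \<longlonglongrightarrow> 0"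
proof -
  have "\<exists>a\<in>fin_supp. H.nrm (\<lambda>w. F k w - ev a w) < 1 / Suc k" for k
    by (rule rkhs_dense[OF F]) simp
  then obtain s where s: "\<And>k. s k \<in> fin_supp" and near: "\<And>k. H.nrm (\<lambda>w. F k w - ev (s k) w) < 1 / Suc k"
    by metis
  note E = ev_in_rkhs[OF s]
  have cau: "\<exists>N. \<forall>m\<ge>N. \<forall>n\<ge>N. pre.nrm (\<lambda>w. s m w - s n w) < e" if e: "0 < e" for e
  proof -
    obtain N where N: "\<And>m n. m \<ge> N \<Longrightarrow> n \<ge> N \<Longrightarrow> H.nrm (\<lambda>w. F m w - F n w) < e / 3"
      using C[of "e / 3"] e by auto
    obtain M where M: "1 / real (Suc M) < e / 3" using reals_Archimedean[of "e / 3"] e by (auto simp: inverse_eq_divide)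
    have small: "H.nrm (\<lambda>w. F k w - ev (s k) w) < e / 3" if "k \<ge> M" for k
    proof -
      have "1 / real (Suc k) \<le> 1 / real (Suc M)" using that by (simp add: frac_le)
      then show ?thesis using near[of k] M by linarith
    qed
    show ?thesis
    proof (intro exI allI impI)
      fix m n assume mn: "max N M \<le> m" "max N M \<le> n"
      have "pre.nrm (\<lambda>w. s m w - s n w) = H.nrm (\<lambda>w. ev (s m) w - ev (s n) w)"
      proof -
        have "ev (\<lambda>w. s m w - s n w) = (\<lambda>w. ev (s m) w - ev (s n) w)" by (simp add: fun_eq_iff ev_diff s)
        then show ?thesis using nrmH_ev[OF pre.diff_closed[OF s s], of m n] by simp
      qed
      also have "\<dots> \<le> H.nrm (\<lambda>w. ev (s m) w - F m w) + H.nrm (\<lambda>w. F m w - ev (s n) w)"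
        by (rule H.nrm_diff_triangle[OF E F E])
      also have "H.nrm (\<lambda>w. F m w - ev (s n) w) \<le> H.nrm (\<lambda>w. F m w - F n w) + H.nrm (\<lambda>w. F n w - ev (s n) w)"
        by (rule H.nrm_diff_triangle[OF F F E])
      also have "H.nrm (\<lambda>w. ev (s m) w - F m w) = H.nrm (\<lambda>w. F m w - ev (s m) w)"
        by (rule H.nrm_diff_commute[OF E F])
      finally show "pre.nrm (\<lambda>w. s m w - s n w) < e"
        using N[of m n] small[of m] small[of n] mn by simp
    qed
  qed
  have "\<exists>l. (\<lambda>n. ev (s n) w) \<longlonglongrightarrow> l" for w
  proof -
    have "Cauchy (\<lambda>n. ev (s n) w)"
    proof (rule CauchyI)
      fix e :: real assume e: "0 < e"
      let ?k = "pre.nrm (unit_coeff w)"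
      have k: "0 \<le> ?k" by (rule pre.nrm_nonneg[OF unit_coeff_fin_supp])
      then have "0 < e / (?k + 1)" using e by simp
      from cau[OF this] obtain N where N: "\<And>m n. m \<ge> N \<Longrightarrow> n \<ge> N \<Longrightarrow> pre.nrm (\<lambda>w. s m w - s n w) < e / (?k + 1)" by auto
      have "norm (ev (s m) w - ev (s n) w) < e" if "m \<ge> N" "n \<ge> N" for m n
      proof -
        have d: "(\<lambda>w. s m w - s n w) \<in> fin_supp" by (rule pre.diff_closed[OF s s])
        have "norm (ev (s m) w - ev (s n) w) \<le> pre.nrm (\<lambda>w. s m w - s n w) * ?k"
          using ev_bound[OF d, of w] by (simp add: ev_diff s)
        also have "\<dots> \<le> pre.nrm (\<lambda>w. s m w - s n w) * (?k + 1)"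
          using pre.nrm_nonneg[OF d] by (intro mult_left_mono) auto
        also have "\<dots> < e" using N[OF that] k by (simp add: pos_less_divide_eq)
        finally show ?thesis .
      qed
      then show "\<exists>N. \<forall>m\<ge>N. \<forall>n\<ge>N. norm (ev (s m) w - ev (s n) w) < e" by blast
    qed
    then show ?thesis using Cauchy_convergent convergent_def by blast
  qed
  then obtain \<phi> where lim: "\<And>w. (\<lambda>n. ev (s n) w) \<longlonglongrightarrow> \<phi> w" by metis
  have ap: "approx s \<phi>" using s cau lim by (simp add: approx_def)
  have P: "\<phi> \<in> rkhs" by (rule approx_in_rkhs[OF ap])
  have "(\<lambda>k. H.nrm (\<lambda>w. F k w - \<phi> w)) \<longlonglongrightarrow> 0"
  proof (rule LIMSEQ_I)
    fix e :: real assume e: "0 < e"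
    obtain N where N: "\<And>m n. m \<ge> N \<Longrightarrow> n \<ge> N \<Longrightarrow> pre.nrm (\<lambda>w. s m w - s n w) < e / 3"
      using cau[of "e / 3"] e by auto
    obtain M where M: "1 / real (Suc M) < e / 3" using reals_Archimedean[of "e / 3"] e by (auto simp: inverse_eq_divide)
    show "\<exists>N. \<forall>k\<ge>N. norm (H.nrm (\<lambda>w. F k w - \<phi> w) - 0) < e"
    proof (intro exI allI impI)
      fix k assume k: "max N M \<le> k"
      have "1 / real (Suc k) \<le> 1 / real (Suc M)" using k by (simp add: frac_le)
      then have 1: "H.nrm (\<lambda>w. F k w - ev (s k) w) < e / 3" using near[of k] M by linarith
      have "(\<lambda>n. pre.nrm (\<lambda>w. s k w - s n w)) \<longlonglongrightarrow> H.nrm (\<lambda>w. ev (s k) w - \<phi> w)"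
        by (intro nrmH_lim approx_diff ap approx_const s)
      then have 2: "H.nrm (\<lambda>w. ev (s k) w - \<phi> w) \<le> e / 3"
        by (rule LIMSEQ_le_const2) (use N k in \<open>auto intro!: exI[of _ N] less_imp_le\<close>)
      have "H.nrm (\<lambda>w. F k w - \<phi> w) \<le> H.nrm (\<lambda>w. F k w - ev (s k) w) + H.nrm (\<lambda>w. ev (s k) w - \<phi> w)"
        by (rule H.nrm_diff_triangle[OF F E P])
      then show "norm (H.nrm (\<lambda>w. F k w - \<phi> w) - 0) < e"
        using 1 2 e H.nrm_nonneg[OF H.diff_closed[OF F P], of k] by simp
    qed
  qed
  then show ?thesis using P by blast
qed

text \<open>Linear relations between the values of the kernel are inherited by all elements of the space.\<close>

lemma rkhs_relation:
  assumes rel: "\<And>v. (\<Sum>x\<in>A. c x * K (g x) v) = 0" and P: "\<phi> \<in> rkhs"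
  shows "(\<Sum>x\<in>A. c x * \<phi> (g x)) = 0"
proof -
  obtain s where s: "approx s \<phi>" using P by (auto simp: rkhs_def)
  have "(\<Sum>x\<in>A. c x * ev a (g x)) = 0" for a
  proof -
    have "(\<Sum>x\<in>A. c x * ev a (g x)) = (\<Sum>v | a v \<noteq> 0. a v * (\<Sum>x\<in>A. c x * K (g x) v))"
      unfolding ev_def lin_def sum_distrib_left by (subst sum.swap) (simp add: mult_ac)
    then show ?thesis by (simp add: rel)
  qed
  moreover have "(\<lambda>n. \<Sum>x\<in>A. c x * ev (s n) (g x)) \<longlonglongrightarrow> (\<Sum>x\<in>A. c x * \<phi> (g x))"
    by (intro tendsto_sum tendsto_mult_left approx_lim s)
  ultimately show ?thesis by (simp add: LIMSEQ_const_iff)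
qed

text \<open>A map \<open>t\<close> that is symmetric and idempotent with respect to the kernel acts as an orthogonal projection by
  composition.\<close>

context
  fixes t :: "'w \<Rightarrow> 'w"
  assumes t_sym: "\<And>w v. K (t w) v = K w (t v)"
    and t_idem: "\<And>w v. K (t (t w)) v = K (t w) v"
begin

lemma ev_push: "a \<in> fin_supp \<Longrightarrow> ev (push t a) w = ev a (t w)"
  by (simp add: ev_def lin_push t_sym)

lemma ip0_push: "a \<in> fin_supp \<Longrightarrow> b \<in> fin_supp \<Longrightarrow> ip0 (push t a) b = ip0 a (push t b)"
  by (simp add: ip0_def lin_push ev_push)

lemma nrm_push:
  assumes a: "a \<in> fin_supp"
  shows "pre.nrm (push t a) \<le> pre.nrm a"
proof -
  note p = push_fin_supp[OF a, of t]
  have "ip0 (push t a) (push t a) = ip0 (push t (push t a)) a"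
    by (simp add: ip0_push[OF p a])
  also have "\<dots> = ip0 (push t a) a"
    by (simp add: ip0_def ev_push[OF p] ev_push[OF a]) (simp add: ev_def t_idem)
  finally have "cmod (ip0 (push t a) a) = (pre.nrm (push t a))\<^sup>2"
    unfolding pre.ip_self[OF p] by (metis abs_of_nonneg norm_of_real zero_le_power2)
  then have "(pre.nrm (push t a))\<^sup>2 = cmod (ip0 (push t a) a)" ..
  also have "\<dots> \<le> pre.nrm (push t a) * pre.nrm a" by (rule pre.cauchy_schwarz[OF p a])
  finally show ?thesis
    using pre.nrm_nonneg[OF p] pre.nrm_nonneg[OF a]
    by (cases "pre.nrm (push t a) = 0") (auto simp: power2_eq_square)
qed

text \<open>On coefficients, composition with \<open>t\<close> is the push-forward along \<open>t\<close>, a contraction.\<close>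

lemma approx_push:
  assumes s: "approx s \<phi>"
  shows "approx (\<lambda>n. push t (s n)) (\<lambda>w. \<phi> (t w))"
  unfolding approx_def
proof (intro conjI allI impI)
  note S = approx_fin[OF s]
  show "push t (s n) \<in> fin_supp" for n by (rule push_fin_supp[OF S])
  show "(\<lambda>n. ev (push t (s n)) w) \<longlonglongrightarrow> \<phi> (t w)" for w
    unfolding ev_push[OF S] by (rule approx_lim[OF s])
  fix e :: real assume "0 < e"
  then obtain N where N: "\<And>m n. m \<ge> N \<Longrightarrow> n \<ge> N \<Longrightarrow> pre.nrm (\<lambda>w. s m w - s n w) < e"
    using approx_cauchy[OF s, of e] by auto
  have "pre.nrm (\<lambda>w. push t (s m) w - push t (s n) w) < e" if "m \<ge> N" "n \<ge> N" for m n
    using nrm_push[OF pre.diff_closed[OF S S], of m n] N[OF that] by (simp add: push_diff S)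
  then show "\<exists>N. \<forall>m\<ge>N. \<forall>n\<ge>N. pre.nrm (\<lambda>w. push t (s m) w - push t (s n) w) < e" by blast
qed

lemma pullback_in_rkhs: "\<phi> \<in> rkhs \<Longrightarrow> (\<lambda>w. \<phi> (t w)) \<in> rkhs"
  using approx_push[OF approximant] approx_in_rkhs by blast

lemma pullback_symmetric:
  assumes "\<phi> \<in> rkhs" "\<psi> \<in> rkhs"
  shows "ipH (\<lambda>w. \<phi> (t w)) \<psi> = ipH \<phi> (\<lambda>w. \<psi> (t w))"
proof -
  obtain s u where su: "approx s \<phi>" "approx u \<psi>" using assms by (auto simp: rkhs_def)
  have "(\<lambda>n. ip0 (push t (s n)) (u n)) \<longlonglongrightarrow> ipH (\<lambda>w. \<phi> (t w)) \<psi>"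
    by (intro ipH_lim approx_push su)
  moreover have "(\<lambda>n. ip0 (push t (s n)) (u n)) \<longlonglongrightarrow> ipH \<phi> (\<lambda>w. \<psi> (t w))"
    unfolding ip0_push[OF approx_fin[OF su(1)] approx_fin[OF su(2)]] by (intro ipH_lim approx_push su)
  ultimately show ?thesis by (rule LIMSEQ_unique)
qed

lemma pullback_idem: "\<phi> \<in> rkhs \<Longrightarrow> \<phi> (t (t w)) = \<phi> (t w)"
  using rkhs_relation[where A = "{True, False}" and c = "\<lambda>b. if b then 1 else -1"
      and g = "\<lambda>b. if b then t (t w) else t w" and \<phi> = \<phi>]
  by (simp add: t_idem)

lemma pullback_contraction:
  assumes P: "\<phi> \<in> rkhs"
  shows "H.nrm (\<lambda>w. \<phi> (t w)) \<le> H.nrm \<phi>"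
proof -
  note Q = pullback_in_rkhs[OF P]
  have "ipH (\<lambda>w. \<phi> (t w)) (\<lambda>w. \<phi> (t w)) = ipH (\<lambda>w. \<phi> (t (t w))) \<phi>"
    using pullback_symmetric[OF Q P] by simp
  also have "\<dots> = ipH (\<lambda>w. \<phi> (t w)) \<phi>" by (simp add: pullback_idem[OF P])
  finally have "cmod (ipH (\<lambda>w. \<phi> (t w)) \<phi>) = (H.nrm (\<lambda>w. \<phi> (t w)))\<^sup>2"
    unfolding H.ip_self[OF Q] by (metis abs_of_nonneg norm_of_real zero_le_power2)
  then have "(H.nrm (\<lambda>w. \<phi> (t w)))\<^sup>2 \<le> H.nrm (\<lambda>w. \<phi> (t w)) * H.nrm \<phi>"
    using H.cauchy_schwarz[OF Q P] by simp
  then show ?thesis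
    using H.nrm_nonneg[OF Q] H.nrm_nonneg[OF P]
    by (cases "H.nrm (\<lambda>w. \<phi> (t w)) = 0") (auto simp: power2_eq_square)
qed

end

lemma reproducing:
  assumes P: "\<phi> \<in> rkhs"
  shows "ipH \<phi> (ev (unit_coeff w)) = \<phi> w"
proof -
  obtain s where s: "approx s \<phi>" using P by (auto simp: rkhs_def)
  have "(\<lambda>n. ip0 (s n) (unit_coeff w)) \<longlonglongrightarrow> ipH \<phi> (ev (unit_coeff w))"
    by (intro ipH_lim s approx_const unit_coeff_fin_supp)
  then have "(\<lambda>n. ev (s n) w) \<longlonglongrightarrow> ipH \<phi> (ev (unit_coeff w))"
    by (simp add: ip0_unit approx_fin[OF s])
  then show ?thesis using approx_lim[OF s] LIMSEQ_unique by blast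
qed

end

section \<open>Hilbert spaces and their bounded operators\<close>

lemma complex_ring_simps [simp]:
  "carrier complex_ring = UNIV" "\<zero>\<^bsub>complex_ring\<^esub> = 0" "\<one>\<^bsub>complex_ring\<^esub> = 1"
  "x \<oplus>\<^bsub>complex_ring\<^esub> y = x + y" "x \<otimes>\<^bsub>complex_ring\<^esub> y = x * y"
  by (simp_all add: complex_ring_def)

lemma bounded_opsD:
  assumes "T \<in> bounded_ops H"
  shows "v \<in> carrier H \<Longrightarrow> T v \<in> carrier H"
    and "v \<in> carrier H \<Longrightarrow> w \<in> carrier H \<Longrightarrow> T (v \<oplus>\<^bsub>H\<^esub> w) = T v \<oplus>\<^bsub>H\<^esub> T w"
    and "v \<in> carrier H \<Longrightarrow> T (c \<odot>\<^bsub>H\<^esub> v) = c \<odot>\<^bsub>H\<^esub> T v"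
    and "\<exists>K. \<forall>v \<in> carrier H. hnorm H (T v) \<le> K * hnorm H v"
    and "T \<in> extensional (carrier H)"
  using assms unfolding bounded_ops_def PiE_def by blast+

lemma bounded_opsI:
  assumes "\<And>v. v \<in> carrier H \<Longrightarrow> T v \<in> carrier H" "T \<in> extensional (carrier H)"
    and "\<And>v w. v \<in> carrier H \<Longrightarrow> w \<in> carrier H \<Longrightarrow> T (v \<oplus>\<^bsub>H\<^esub> w) = T v \<oplus>\<^bsub>H\<^esub> T w"
    and "\<And>v c. v \<in> carrier H \<Longrightarrow> T (c \<odot>\<^bsub>H\<^esub> v) = c \<odot>\<^bsub>H\<^esub> T v"
    and "\<And>v. v \<in> carrier H \<Longrightarrow> hnorm H (T v) \<le> K * hnorm H v"
  shows "T \<in> bounded_ops H"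
  using assms unfolding bounded_ops_def PiE_def by (auto intro!: exI[of _ K])

context hilbert_space
begin

lemma smult_closed' [simp]: "v \<in> carrier H \<Longrightarrow> c \<odot> v \<in> carrier H"
  using smult_closed[of c v] by simp

lemma smult_neg_one: "v \<in> carrier H \<Longrightarrow> (-1) \<odot> v = \<ominus> v"
proof -
  assume v: "v \<in> carrier H"
  have "(-1) \<odot> v \<oplus> v = (-1) \<odot> v \<oplus> 1 \<odot> v" using smult_one[OF v] by simp
  also have "\<dots> = (-1 + 1) \<odot> v" using smult_l_distr[of "-1" 1 v] v by simp
  also have "\<dots> = \<zero>" using smult_l_null[OF v] by simp
  finally show ?thesis using minus_equality[of "(-1) \<odot> v" v] v by simp
qed

lemma cinner_add_right:
  "u \<in> carrier H \<Longrightarrow> v \<in> carrier H \<Longrightarrow> w \<in> carrier H \<Longrightarrow> cinner H u (v \<oplus> w) = cinner H u v + cinner H u w"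
  by (subst (1 2 3) cinner_commute) (simp_all add: cinner_add_left)

lemma cinner_smult_right:
  "v \<in> carrier H \<Longrightarrow> w \<in> carrier H \<Longrightarrow> cinner H v (c \<odot> w) = cnj c * cinner H v w"
  by (subst (1 2) cinner_commute) (simp_all add: cinner_smult_left)

lemma cinner_zero_left [simp]: "v \<in> carrier H \<Longrightarrow> cinner H \<zero> v = 0"
  using cinner_smult_left[of \<zero> v 0] smult_l_null[of \<zero>] by simp

lemma cinner_zero_right [simp]: "v \<in> carrier H \<Longrightarrow> cinner H v \<zero> = 0"
  by (subst cinner_commute) simp_all

lemma cinner_diff_left:
  "u \<in> carrier H \<Longrightarrow> v \<in> carrier H \<Longrightarrow> w \<in> carrier H \<Longrightarrow> cinner H (u \<ominus> v) w = cinner H u w - cinner H v w"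
  using cinner_smult_left[of v w "-1"] by (simp add: minus_eq cinner_add_left smult_neg_one)

lemma cinner_diff_right:
  "u \<in> carrier H \<Longrightarrow> v \<in> carrier H \<Longrightarrow> w \<in> carrier H \<Longrightarrow> cinner H u (v \<ominus> w) = cinner H u v - cinner H u w"
  by (subst (1 2 3) cinner_commute) (simp_all add: cinner_diff_left)

lemma cinner_eq_zero:
  assumes "v \<in> carrier H" "cinner H v v = 0"
  shows "v = \<zero>"
  using cinner_pos[of v] assms by force

lemma cinner_self_real: "v \<in> carrier H \<Longrightarrow> cinner H v v = of_real ((hnorm H v)\<^sup>2)"
  and cinner_self_nonneg: "v \<in> carrier H \<Longrightarrow> 0 \<le> Re (cinner H v v)"
proof -
  assume v: "v \<in> carrier H"
  show pos: "0 \<le> Re (cinner H v v)" using cinner_pos[of v] v by (cases "v = \<zero>") auto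
  have "Im (cinner H v v) = 0" using cinner_commute[OF v v] by (simp add: complex_eq_iff)
  then show "cinner H v v = of_real ((hnorm H v)\<^sup>2)" using pos by (simp add: hnorm_def complex_eq_iff)
qed

lemma vector_eqI:
  assumes "v \<in> carrier H" "w \<in> carrier H" "\<And>u. u \<in> carrier H \<Longrightarrow> cinner H u v = cinner H u w"
  shows "v = w"
proof -
  have d: "v \<ominus> w \<in> carrier H" using assms by simp
  have "cinner H (v \<ominus> w) (v \<ominus> w) = 0"
    using assms(3)[OF d] by (simp add: cinner_diff_right assms(1,2))
  then have "v \<ominus> w = \<zero>" by (rule cinner_eq_zero[OF d])
  moreover have "(v \<ominus> w) \<oplus> w = v" using assms(1,2) by (simp add: minus_eq a_assoc l_neg)
  ultimately show ?thesis using assms(2) by simp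
qed

lemma hadjoint_eqI:
  assumes T: "T \<in> bounded_ops H" and S: "S \<in> bounded_ops H"
    and adj: "\<And>v w. v \<in> carrier H \<Longrightarrow> w \<in> carrier H \<Longrightarrow> cinner H (T v) w = cinner H v (S w)"
  shows "hadjoint H T = S"
  unfolding hadjoint_def
proof (rule the_equality)
  show "S \<in> bounded_ops H \<and> (\<forall>v\<in>carrier H. \<forall>w\<in>carrier H. cinner H (T v) w = cinner H v (S w))"
    using S adj by blast
next
  fix S' assume S': "S' \<in> bounded_ops H \<and> (\<forall>v\<in>carrier H. \<forall>w\<in>carrier H. cinner H (T v) w = cinner H v (S' w))"
  show "S' = S"
  proof (rule extensionalityI)
    show "S' \<in> extensional (carrier H)" "S \<in> extensional (carrier H)"
      using bounded_opsD(5) S S' by blast+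
    fix w assume w: "w \<in> carrier H"
    show "S' w = S w"
    proof (rule vector_eqI)
      show "S' w \<in> carrier H" "S w \<in> carrier H"
        using bounded_opsD(1)[OF conjunct1[OF S'] w] bounded_opsD(1)[OF S w] .
      show "cinner H u (S' w) = cinner H u (S w)" if "u \<in> carrier H" for u
        using S' adj[OF that w] that w by simp
    qed
  qed
qed

text \<open>A consequence of the parallelogram law that suffices to bound sums of operators.\<close>

lemma hnorm_add_square:
  assumes "v \<in> carrier H" "w \<in> carrier H"
  shows "(hnorm H (v \<oplus> w))\<^sup>2 \<le> 2 * (hnorm H v)\<^sup>2 + 2 * (hnorm H w)\<^sup>2"
proof -
  have eq: "Re (cinner H u u) = (hnorm H u)\<^sup>2" if "u \<in> carrier H" for u
    using cinner_self_real[OF that] by simp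
  have "(hnorm H (v \<oplus> w))\<^sup>2 + (hnorm H (v \<ominus> w))\<^sup>2 = 2 * (hnorm H v)\<^sup>2 + 2 * (hnorm H w)\<^sup>2"
    using assms by (simp add: eq[symmetric] cinner_add_left cinner_add_right cinner_diff_left cinner_diff_right)
  then show ?thesis using zero_le_power2[of "hnorm H (v \<ominus> w)"] by linarith
qed

lemma bounded_ops_add:
  assumes S: "S \<in> bounded_ops H" and T: "T \<in> bounded_ops H"
  shows "(\<lambda>v\<in>carrier H. S v \<oplus> T v) \<in> bounded_ops H"
proof -
  obtain K where K: "\<And>v. v \<in> carrier H \<Longrightarrow> hnorm H (S v) \<le> K * hnorm H v" using bounded_opsD(4)[OF S] by blast
  obtain L where L: "\<And>v. v \<in> carrier H \<Longrightarrow> hnorm H (T v) \<le> L * hnorm H v" using bounded_opsD(4)[OF T] by blast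
  note cl = bounded_opsD(1)[OF S] bounded_opsD(1)[OF T]
  have nn: "0 \<le> hnorm H v" if "v \<in> carrier H" for v by (simp add: hnorm_def cinner_self_nonneg[OF that])
  show ?thesis
  proof (rule bounded_opsI[where K = "sqrt (2 * K\<^sup>2 + 2 * L\<^sup>2)"])
    fix v assume v: "v \<in> carrier H"
    have "(hnorm H (S v \<oplus> T v))\<^sup>2 \<le> 2 * (hnorm H (S v))\<^sup>2 + 2 * (hnorm H (T v))\<^sup>2"
      by (rule hnorm_add_square[OF cl[OF v]])
    also have "\<dots> \<le> 2 * (K * hnorm H v)\<^sup>2 + 2 * (L * hnorm H v)\<^sup>2"
      using K[OF v] L[OF v] nn[OF cl(1)[OF v]] nn[OF cl(2)[OF v]] by (intro add_mono mult_left_mono power_mono) auto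
    also have "\<dots> = (sqrt (2 * K\<^sup>2 + 2 * L\<^sup>2) * hnorm H v)\<^sup>2"
      by (simp add: power_mult_distrib algebra_simps)
    finally show "hnorm H ((\<lambda>v\<in>carrier H. S v \<oplus> T v) v) \<le> sqrt (2 * K\<^sup>2 + 2 * L\<^sup>2) * hnorm H v"
      using v nn[OF v] by (auto intro: power2_le_imp_le)
  next
    fix v w assume "v \<in> carrier H" "w \<in> carrier H"
    then show "(\<lambda>v\<in>carrier H. S v \<oplus> T v) (v \<oplus> w) = (\<lambda>v\<in>carrier H. S v \<oplus> T v) v \<oplus> (\<lambda>v\<in>carrier H. S v \<oplus> T v) w"
      using cl by (simp add: bounded_opsD(2)[OF S] bounded_opsD(2)[OF T] a_ac)
  next
    fix v c assume "v \<in> carrier H"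
    then show "(\<lambda>v\<in>carrier H. S v \<oplus> T v) (c \<odot> v) = c \<odot> (\<lambda>v\<in>carrier H. S v \<oplus> T v) v"
      using cl smult_r_distr[of c] by (simp add: bounded_opsD(3)[OF S] bounded_opsD(3)[OF T])
  qed (use cl in auto)
qed

lemma zero_op_bounded: "(\<lambda>v\<in>carrier H. \<zero>) \<in> bounded_ops H"
  by (rule bounded_opsI[where K = 0]) (auto simp: hnorm_def cinner_self_nonneg smult_r_null)

lemma op_algebra_simps:
  "carrier (op_algebra H) = bounded_ops H" "\<zero>\<^bsub>op_algebra H\<^esub> = (\<lambda>v\<in>carrier H. \<zero>)"
  "\<one>\<^bsub>op_algebra H\<^esub> = (\<lambda>v\<in>carrier H. v)"
  "S \<oplus>\<^bsub>op_algebra H\<^esub> T = (\<lambda>v\<in>carrier H. S v \<oplus> T v)"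
  "S \<otimes>\<^bsub>op_algebra H\<^esub> T = compose (carrier H) S T"
  "c \<odot>\<^bsub>op_algebra H\<^esub> T = (\<lambda>v\<in>carrier H. c \<odot> T v)"
  "star (op_algebra H) = hadjoint H"
  by (simp_all add: op_algebra_def)

lemma abelian_monoid_op_algebra: "abelian_monoid (op_algebra H)"
proof (rule abelian_monoidI)
  fix R S T assume R: "R \<in> carrier (op_algebra H)" and S: "S \<in> carrier (op_algebra H)" and T: "T \<in> carrier (op_algebra H)"
  note cl = R S T
  note cl' = bounded_opsD(1)[OF R[unfolded op_algebra_simps]] bounded_opsD(1)[OF S[unfolded op_algebra_simps]]
    bounded_opsD(1)[OF T[unfolded op_algebra_simps]]
  show "R \<oplus>\<^bsub>op_algebra H\<^esub> S \<in> carrier (op_algebra H)"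
    using R S by (simp add: op_algebra_simps bounded_ops_add)
  show "R \<oplus>\<^bsub>op_algebra H\<^esub> S \<oplus>\<^bsub>op_algebra H\<^esub> T = R \<oplus>\<^bsub>op_algebra H\<^esub> (S \<oplus>\<^bsub>op_algebra H\<^esub> T)"
    using cl' by (intro extensionalityI[of _ "carrier H"]) (simp_all add: op_algebra_simps a_assoc)
  show "R \<oplus>\<^bsub>op_algebra H\<^esub> S = S \<oplus>\<^bsub>op_algebra H\<^esub> R"
    using cl' by (intro extensionalityI[of _ "carrier H"]) (simp_all add: op_algebra_simps a_comm)
  show "\<zero>\<^bsub>op_algebra H\<^esub> \<oplus>\<^bsub>op_algebra H\<^esub> R = R"
    using cl' bounded_opsD(5)[OF R[unfolded op_algebra_simps]]
    by (intro extensionalityI[of _ "carrier H"]) (simp_all add: op_algebra_simps)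
next
  show "\<zero>\<^bsub>op_algebra H\<^esub> \<in> carrier (op_algebra H)" by (simp add: op_algebra_simps zero_op_bounded)
qed

lemma finsum_op_apply:
  assumes "finite A" "\<And>a. a \<in> A \<Longrightarrow> P a \<in> bounded_ops H" "v \<in> carrier H"
  shows "(\<Oplus>\<^bsub>op_algebra H\<^esub>a\<in>A. P a) v = (\<Oplus>a\<in>A. P a v)"
  using assms(1,2)
proof (induction A rule: finite_induct)
  interpret O: abelian_monoid "op_algebra H" by (rule abelian_monoid_op_algebra)
  case empty
  show ?case using assms(3) by (simp add: op_algebra_simps)
next
  interpret O: abelian_monoid "op_algebra H" by (rule abelian_monoid_op_algebra)
  case (insert a A)
  have P: "P \<in> A \<rightarrow> carrier (op_algebra H)" "P a \<in> carrier (op_algebra H)" using insert by (auto simp: op_algebra_simps)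
  have Pv: "(\<lambda>a. P a v) \<in> A \<rightarrow> carrier H" "P a v \<in> carrier H"
    using bounded_opsD(1)[OF insert.prems assms(3)] by auto
  show ?case
    using insert P Pv assms(3) by (simp add: O.finsum_insert finsum_insert) (simp add: op_algebra_simps)
qed

lemma cinner_finsum_left:
  assumes "finite A" "\<And>a. a \<in> A \<Longrightarrow> g a \<in> carrier H" "v \<in> carrier H"
  shows "cinner H (\<Oplus>a\<in>A. g a) v = (\<Sum>a\<in>A. cinner H (g a) v)"
  using assms(1,2)
proof (induction A rule: finite_induct)
  case (insert a A)
  then have "g \<in> A \<rightarrow> carrier H" "g a \<in> carrier H" by auto
  then show ?case using insert assms(3) by (simp add: finsum_insert cinner_add_left)
qed (use assms in simp)

end

section \<open>Moving a Hilbert space of functions into a type\<close>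

text \<open>A complete space of functions whose carrier is transported along an injection \<open>enc\<close>.\<close>

locale encoded_space = semi_inner V ip
  for V :: "('w \<Rightarrow> complex) set" and ip +
  fixes enc :: "('w \<Rightarrow> complex) \<Rightarrow> 'h"
  assumes zero_in: "(\<lambda>_. 0) \<in> V"
    and enc_inj: "inj_on enc V"
    and definite: "a \<in> V \<Longrightarrow> nrm a = 0 \<Longrightarrow> a = (\<lambda>_. 0)"
    and complete_space: "\<lbrakk>\<And>k::nat. F k \<in> V; \<And>e. e > 0 \<Longrightarrow> \<exists>N. \<forall>m\<ge>N. \<forall>n\<ge>N. nrm (\<lambda>w. F m w - F n w) < e\<rbrakk>
      \<Longrightarrow> \<exists>f\<in>V. (\<lambda>k. nrm (\<lambda>w. F k w - f w)) \<longlonglongrightarrow> 0"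
begin

text \<open>The value outside the carrier is chosen such that the distance of \<open>enc_hilbert\<close> is symmetric and non-negative on the
  whole type, as \<^locale>\<open>Metric_space\<close> demands.\<close>

definition dec :: "'h \<Rightarrow> 'w \<Rightarrow> complex" where
  "dec x = (if x \<in> enc ` V then inv_into V enc x else (\<lambda>_. 0))"

definition enc_hilbert :: "'h hilbert" where
  "enc_hilbert = \<lparr>carrier = enc ` V, mult = (\<lambda>_ _. undefined), one = undefined,
     ring.zero = enc (\<lambda>_. 0), add = (\<lambda>x y. enc (\<lambda>w. dec x w + dec y w)),
     smult = (\<lambda>c x. enc (\<lambda>w. c * dec x w)), cinner = (\<lambda>x y. ip (dec x) (dec y))\<rparr>"

abbreviation "EH \<equiv> enc_hilbert"

lemma dec_enc [simp]: "a \<in> V \<Longrightarrow> dec (enc a) = a"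
  by (simp add: dec_def enc_inj)

lemma dec_in [simp]: "dec x \<in> V"
  by (simp add: dec_def zero_in inv_into_into)

lemma enc_dec [simp]: "x \<in> enc ` V \<Longrightarrow> enc (dec x) = x"
  by (auto simp: dec_def f_inv_into_f)

lemma EH_simps:
  "carrier EH = enc ` V" "\<zero>\<^bsub>EH\<^esub> = enc (\<lambda>_. 0)"
  "x \<oplus>\<^bsub>EH\<^esub> y = enc (\<lambda>w. dec x w + dec y w)" "c \<odot>\<^bsub>EH\<^esub> x = enc (\<lambda>w. c * dec x w)"
  "cinner EH x y = ip (dec x) (dec y)" "hnorm EH x = nrm (dec x)"
  by (simp_all add: enc_hilbert_def hnorm_def nrm_def)

lemma enc_eq_iff: "a \<in> V \<Longrightarrow> b \<in> V \<Longrightarrow> enc a = enc b \<longleftrightarrow> a = b"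
  using enc_inj by (simp add: inj_on_eq_iff)

lemma neg_in: "a \<in> V \<Longrightarrow> (\<lambda>w. - a w) \<in> V"
  using scale_closed[of a "-1"] by simp

lemma abelian_group_EH: "abelian_group EH"
proof (rule abelian_groupI)
  fix x assume "x \<in> carrier EH"
  then have x: "x \<in> enc ` V" by (simp add: EH_simps)
  have "enc (\<lambda>w. - dec x w) \<in> carrier EH" by (simp add: EH_simps neg_in)
  moreover have "enc (\<lambda>w. - dec x w) \<oplus>\<^bsub>EH\<^esub> x = \<zero>\<^bsub>EH\<^esub>" by (simp add: EH_simps neg_in)
  ultimately show "\<exists>y\<in>carrier EH. y \<oplus>\<^bsub>EH\<^esub> x = \<zero>\<^bsub>EH\<^esub>" by blast
qed (auto simp: EH_simps add_closed zero_in add_ac)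

lemma module_EH: "module complex_ring EH"
proof (rule moduleI)
  show "cring complex_ring" using field_complex_ring by (simp add: field_def domain_def)
qed (auto simp: abelian_group_EH EH_simps add_closed scale_closed distrib_left distrib_right mult.assoc)

lemma minus_EH: "x \<ominus>\<^bsub>EH\<^esub> y = enc (\<lambda>w. dec x w - dec y w)"
proof -
  interpret abelian_group EH by (rule abelian_group_EH)
  have "\<ominus>\<^bsub>EH\<^esub> y = enc (\<lambda>w. - dec y w)"
    unfolding a_inv_def m_inv_def
  proof (rule the_equality)
    show "enc (\<lambda>w. - dec y w) \<in> carrier (add_monoid EH) \<and>
        y \<otimes>\<^bsub>add_monoid EH\<^esub> enc (\<lambda>w. - dec y w) = \<one>\<^bsub>add_monoid EH\<^esub> \<and>
        enc (\<lambda>w. - dec y w) \<otimes>\<^bsub>add_monoid EH\<^esub> y = \<one>\<^bsub>add_monoid EH\<^esub>"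
      by (simp add: EH_simps neg_in)
    fix z assume z: "z \<in> carrier (add_monoid EH) \<and> y \<otimes>\<^bsub>add_monoid EH\<^esub> z = \<one>\<^bsub>add_monoid EH\<^esub> \<and>
        z \<otimes>\<^bsub>add_monoid EH\<^esub> y = \<one>\<^bsub>add_monoid EH\<^esub>"
    then have zV: "z \<in> enc ` V" and "enc (\<lambda>w. dec y w + dec z w) = enc (\<lambda>_. 0)" by (auto simp: EH_simps)
    then have "(\<lambda>w. dec y w + dec z w) = (\<lambda>_. 0)" by (simp add: enc_eq_iff add_closed zero_in)
    then have "dec z = (\<lambda>w. - dec y w)" by (auto simp: fun_eq_iff add_eq_0_iff)
    then show "z = enc (\<lambda>w. - dec y w)" using enc_dec[OF zV] by metis
  qed
  then show ?thesis by (simp add: a_minus_def EH_simps neg_in)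
qed

lemma hnorm_minus_EH: "hnorm EH (x \<ominus>\<^bsub>EH\<^esub> y) = nrm (\<lambda>w. dec x w - dec y w)"
  by (simp add: minus_EH EH_simps diff_closed)

lemma Metric_space_EH: "Metric_space (carrier EH) (\<lambda>v w. hnorm EH (v \<ominus>\<^bsub>EH\<^esub> w))"
proof
  fix x y z
  show "0 \<le> hnorm EH (x \<ominus>\<^bsub>EH\<^esub> y)" by (simp add: hnorm_minus_EH nrm_nonneg diff_closed)
  show "hnorm EH (x \<ominus>\<^bsub>EH\<^esub> y) = hnorm EH (y \<ominus>\<^bsub>EH\<^esub> x)"
    unfolding hnorm_minus_EH by (rule nrm_diff_commute[OF dec_in dec_in])
  show "hnorm EH (x \<ominus>\<^bsub>EH\<^esub> z) \<le> hnorm EH (x \<ominus>\<^bsub>EH\<^esub> y) + hnorm EH (y \<ominus>\<^bsub>EH\<^esub> z)"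
    by (simp add: hnorm_minus_EH nrm_diff_triangle)
  assume x: "x \<in> carrier EH" and y: "y \<in> carrier EH"
  have z: "nrm (\<lambda>_. 0) = 0" using nrm_scale[OF zero_in, of 0] by simp
  show "(hnorm EH (x \<ominus>\<^bsub>EH\<^esub> y) = 0) = (x = y)"
  proof
    assume "hnorm EH (x \<ominus>\<^bsub>EH\<^esub> y) = 0"
    then have "(\<lambda>w. dec x w - dec y w) = (\<lambda>_. 0)"
      by (intro definite diff_closed dec_in) (simp add: hnorm_minus_EH)
    then have "dec x = dec y" by (simp add: fun_eq_iff)
    then show "x = y" using x y enc_dec unfolding EH_simps by metis
  qed (simp add: hnorm_minus_EH z)
qed

lemma hilbert_space_EH: "hilbert_space EH"
proof -
  interpret module complex_ring EH by (rule module_EH)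
  show ?thesis
  proof
    fix u v w assume u: "u \<in> carrier EH" and v: "v \<in> carrier EH" and w: "w \<in> carrier EH"
    show "cinner EH (u \<oplus>\<^bsub>EH\<^esub> v) w = cinner EH u w + cinner EH v w"
      by (simp add: EH_simps add_closed ip_add)
  next
    fix v w c assume "v \<in> carrier EH" "w \<in> carrier EH"
    show "cinner EH (c \<odot>\<^bsub>EH\<^esub> v) w = c * cinner EH v w" by (simp add: EH_simps scale_closed ip_scale)
  next
    fix v w assume "v \<in> carrier EH" "w \<in> carrier EH"
    show "cinner EH v w = cnj (cinner EH w v)" by (simp only: EH_simps) (rule ip_herm[OF dec_in dec_in])
  next
    fix v assume v: "v \<in> carrier EH" "v \<noteq> \<zero>\<^bsub>EH\<^esub>"
    have "nrm (dec v) \<noteq> 0"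
    proof
      assume "nrm (dec v) = 0"
      then have "dec v = (\<lambda>_. 0)" by (intro definite dec_in)
      then show False using v enc_dec[of v] by (simp add: EH_simps)
    qed
    then have "0 < (nrm (dec v))\<^sup>2" by simp
    then show "0 < Re (cinner EH v v)" by (simp add: EH_simps ip_self del: of_real_power)
  next
    interpret M: Metric_space "carrier EH" "\<lambda>v w. hnorm EH (v \<ominus>\<^bsub>EH\<^esub> w)" by (rule Metric_space_EH)
    show "M.mcomplete"
      unfolding M.mcomplete_def
    proof (intro allI impI)
      fix s assume s: "M.MCauchy s"
      have car: "s k \<in> carrier EH" for k using s by (auto simp: M.MCauchy_def)
      have "\<exists>f\<in>V. (\<lambda>k. nrm (\<lambda>w. dec (s k) w - f w)) \<longlonglongrightarrow> 0"
      proof (rule complete_space)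
        fix e :: real assume e: "0 < e"
        have "\<exists>N. \<forall>m n. N \<le> m \<longrightarrow> N \<le> n \<longrightarrow> hnorm EH (s m \<ominus>\<^bsub>EH\<^esub> s n) < e"
          using s e unfolding M.MCauchy_def by blast
        then show "\<exists>N. \<forall>m\<ge>N. \<forall>n\<ge>N. nrm (\<lambda>w. dec (s m) w - dec (s n) w) < e"
          unfolding hnorm_minus_EH by blast
      qed simp
      then obtain f where f: "f \<in> V" "(\<lambda>k. nrm (\<lambda>w. dec (s k) w - f w)) \<longlonglongrightarrow> 0" by blast
      have "\<exists>N. \<forall>n\<ge>N. s n \<in> carrier EH \<and> hnorm EH (s n \<ominus>\<^bsub>EH\<^esub> enc f) < e" if "0 < e" for e
        using LIMSEQ_D[OF f(2) that] car f(1) nrm_nonneg[OF diff_closed[OF dec_in f(1)]]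
        by (auto simp: hnorm_minus_EH)
      moreover have "enc f \<in> carrier EH" using f by (simp add: EH_simps)
      ultimately show "\<exists>x. limitin M.mtopology s x sequentially"
        unfolding M.limit_metric_sequentially by blast
    qed
  qed
qed

definition bounded_on :: "(('w \<Rightarrow> complex) \<Rightarrow> 'w \<Rightarrow> complex) \<Rightarrow> bool" where
  "bounded_on T \<longleftrightarrow> (\<forall>a\<in>V. T a \<in> V) \<and>
     (\<forall>a\<in>V. \<forall>b\<in>V. T (\<lambda>w. a w + b w) = (\<lambda>w. T a w + T b w)) \<and>
     (\<forall>c. \<forall>a\<in>V. T (\<lambda>w. c * a w) = (\<lambda>w. c * T a w)) \<and>
     (\<exists>K. \<forall>a\<in>V. nrm (T a) \<le> K * nrm a)"

text \<open>Operators are handled as maps on functions, and are only encoded in the end.\<close>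

definition op_of :: "(('w \<Rightarrow> complex) \<Rightarrow> 'w \<Rightarrow> complex) \<Rightarrow> 'h \<Rightarrow> 'h" where
  "op_of T = (\<lambda>x\<in>carrier EH. enc (T (dec x)))"

lemma bounded_onD: "bounded_on T \<Longrightarrow> a \<in> V \<Longrightarrow> T a \<in> V"
  by (simp add: bounded_on_def)

lemma bounded_onE: "bounded_on T \<Longrightarrow> \<exists>K. \<forall>a\<in>V. nrm (T a) \<le> K * nrm a"
  by (simp add: bounded_on_def)

lemma op_of_apply: "x \<in> carrier EH \<Longrightarrow> op_of T x = enc (T (dec x))"
  by (simp add: op_of_def)

lemma op_of_bounded:
  assumes T: "bounded_on T"
  shows "op_of T \<in> bounded_ops EH"
proof -
  obtain K where K: "\<And>a. a \<in> V \<Longrightarrow> nrm (T a) \<le> K * nrm a" using bounded_onE[OF T] by blast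
  show ?thesis
  proof (rule bounded_opsI[where K = K])
    fix v assume v: "v \<in> carrier EH"
    show "op_of T v \<in> carrier EH" using v T by (simp add: op_of_apply) (simp add: EH_simps bounded_onD)
    show "hnorm EH (op_of T v) \<le> K * hnorm EH v"
      using v K[of "dec v"] T by (simp add: op_of_apply) (simp add: EH_simps bounded_onD)
    show "op_of T (c \<odot>\<^bsub>EH\<^esub> v) = c \<odot>\<^bsub>EH\<^esub> op_of T v" for c
      using T v by (simp add: op_of_def EH_simps scale_closed bounded_onD) (simp add: bounded_on_def)
    fix w assume w: "w \<in> carrier EH"
    show "op_of T (v \<oplus>\<^bsub>EH\<^esub> w) = op_of T v \<oplus>\<^bsub>EH\<^esub> op_of T w"
      using T v w by (simp add: op_of_def EH_simps add_closed bounded_onD) (simp add: bounded_on_def)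
  qed (simp add: op_of_def)
qed

lemma op_of_cong: "(\<And>a. a \<in> V \<Longrightarrow> T a = S a) \<Longrightarrow> op_of T = op_of S"
  unfolding op_of_def by (rule restrict_ext) simp

lemma op_of_mult: "bounded_on T \<Longrightarrow> op_of S \<otimes>\<^bsub>op_algebra EH\<^esub> op_of T = op_of (\<lambda>a. S (T a))"
  unfolding op_of_def op_algebra_def
  by (auto simp: compose_def EH_simps bounded_onD intro!: restrict_ext)

lemma op_of_add: "bounded_on S \<Longrightarrow> bounded_on T \<Longrightarrow>
    op_of S \<oplus>\<^bsub>op_algebra EH\<^esub> op_of T = op_of (\<lambda>a w. S a w + T a w)"
  unfolding op_of_def op_algebra_def
  by (auto simp: EH_simps bounded_onD intro!: restrict_ext)

lemma op_of_smult: "bounded_on T \<Longrightarrow> c \<odot>\<^bsub>op_algebra EH\<^esub> op_of T = op_of (\<lambda>a w. c * T a w)"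
  unfolding op_of_def op_algebra_def
  by (auto simp: EH_simps bounded_onD intro!: restrict_ext)

lemma op_of_one: "\<one>\<^bsub>op_algebra EH\<^esub> = op_of (\<lambda>a. a)"
  unfolding op_of_def op_algebra_def by (auto simp: EH_simps intro!: restrict_ext)

lemma op_of_zero: "\<zero>\<^bsub>op_algebra EH\<^esub> = op_of (\<lambda>a w. 0)"
  unfolding op_of_def op_algebra_def by (auto simp: EH_simps intro!: restrict_ext)

lemma op_of_star:
  assumes "bounded_on S" "bounded_on T" "\<And>a b. a \<in> V \<Longrightarrow> b \<in> V \<Longrightarrow> ip (S a) b = ip a (T b)"
  shows "star (op_algebra EH) (op_of S) = op_of T"
proof -
  have "hadjoint EH (op_of S) = op_of T"
  proof (rule hilbert_space.hadjoint_eqI[OF hilbert_space_EH])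
    fix v w assume "v \<in> carrier EH" "w \<in> carrier EH"
    then show "cinner EH (op_of S v) w = cinner EH v (op_of T w)"
      using assms by (simp add: op_of_apply) (simp add: EH_simps bounded_onD)
  qed (intro op_of_bounded assms)+
  then show ?thesis by (simp add: op_algebra_def)
qed

lemma op_of_positive:
  assumes T: "bounded_on T" and sym: "\<And>a b. a \<in> V \<Longrightarrow> b \<in> V \<Longrightarrow> ip (T a) b = ip a (T b)"
    and idem: "\<And>a. a \<in> V \<Longrightarrow> T (T a) = T a"
  shows "positive_op EH (op_of T)"
  unfolding positive_op_def
proof (intro conjI ballI op_of_bounded T)
  fix v assume v: "v \<in> carrier EH"
  have "cinner EH (op_of T v) v = ip (T (dec v)) (dec v)"
    using v T by (simp add: op_of_apply) (simp add: EH_simps bounded_onD)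
  also have "\<dots> = ip (T (dec v)) (T (dec v))"
    using sym[OF bounded_onD[OF T dec_in] dec_in, of v v] by (simp add: idem)
  finally show "cinner EH (op_of T v) v \<in> \<real>\<^sub>\<ge>\<^sub>0"
    using ip_pos[OF bounded_onD[OF T dec_in], of v] ip_self[OF bounded_onD[OF T dec_in], of v]
    by (simp add: complex_nonneg_Reals_iff)
qed

lemma bounded_on_add:
  assumes S: "bounded_on S" and T: "bounded_on T"
  shows "bounded_on (\<lambda>a w. S a w + T a w)"
proof -
  obtain K where K: "\<And>a. a \<in> V \<Longrightarrow> nrm (S a) \<le> K * nrm a" using bounded_onE[OF S] by blast
  obtain L where L: "\<And>a. a \<in> V \<Longrightarrow> nrm (T a) \<le> L * nrm a" using bounded_onE[OF T] by blast
  have "nrm (\<lambda>w. S a w + T a w) \<le> (K + L) * nrm a" if a: "a \<in> V" for a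
    using nrm_triangle[OF bounded_onD[OF S a] bounded_onD[OF T a]] K[OF a] L[OF a] by (simp add: distrib_right)
  then have "\<exists>K. \<forall>a\<in>V. nrm (\<lambda>w. S a w + T a w) \<le> K * nrm a" by blast
  moreover have "\<forall>a\<in>V. (\<lambda>w. S a w + T a w) \<in> V" by (simp add: add_closed S T bounded_onD)
  ultimately show ?thesis using S T
    unfolding bounded_on_def[of "\<lambda>a w. S a w + T a w"]
    by (simp add: bounded_on_def add_ac distrib_left mult.left_commute)
qed

lemma bounded_on_scale:
  assumes T: "bounded_on T"
  shows "bounded_on (\<lambda>a w. c * T a w)"
proof -
  obtain L where L: "\<And>a. a \<in> V \<Longrightarrow> nrm (T a) \<le> L * nrm a" using bounded_onE[OF T] by blast
  have "nrm (\<lambda>w. c * T a w) \<le> (cmod c * L) * nrm a" if a: "a \<in> V" for a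
    using nrm_scale[OF bounded_onD[OF T a], of c] mult_left_mono[OF L[OF a], of "cmod c"] by (simp add: mult.assoc)
  then have "\<exists>K. \<forall>a\<in>V. nrm (\<lambda>w. c * T a w) \<le> K * nrm a" by blast
  moreover have "\<forall>a\<in>V. (\<lambda>w. c * T a w) \<in> V" by (simp add: scale_closed T bounded_onD)
  ultimately show ?thesis using T
    unfolding bounded_on_def[of "\<lambda>a w. c * T a w"]
    by (simp add: bounded_on_def add_ac distrib_left mult.left_commute)
qed

lemma bounded_on_zero: "bounded_on (\<lambda>a w. 0)"
proof -
  have "nrm (\<lambda>_. 0) = 0" using nrm_scale[OF zero_in, of 0] by simp
  then show ?thesis by (auto simp: bounded_on_def zero_in intro!: exI[of _ 0])
qed

lemma bounded_on_sum:
  "finite A \<Longrightarrow> (\<And>x. x \<in> A \<Longrightarrow> bounded_on (T x)) \<Longrightarrow> bounded_on (\<lambda>a w. \<Sum>x\<in>A. T x a w)"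
  by (induction A rule: finite_induct) (simp_all add: bounded_on_zero bounded_on_add)

lemma finsum_op_of:
  assumes "finite A" "\<And>x. x \<in> A \<Longrightarrow> bounded_on (T x)"
  shows "(\<Oplus>\<^bsub>op_algebra EH\<^esub>x\<in>A. op_of (T x)) = op_of (\<lambda>a w. \<Sum>x\<in>A. T x a w)"
  using assms
proof (induction A rule: finite_induct)
  interpret O: abelian_monoid "op_algebra EH"
    by (rule hilbert_space.abelian_monoid_op_algebra[OF hilbert_space_EH])
  case empty
  show ?case by (simp add: op_of_zero)
next
  interpret O: abelian_monoid "op_algebra EH"
    by (rule hilbert_space.abelian_monoid_op_algebra[OF hilbert_space_EH])
  case (insert x A)
  have car: "carrier (op_algebra EH) = bounded_ops EH" by (simp add: op_algebra_def)
  have "(\<lambda>x. op_of (T x)) \<in> A \<rightarrow> carrier (op_algebra EH)" "op_of (T x) \<in> carrier (op_algebra EH)"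
    using insert.prems by (auto simp: car op_of_bounded)
  then show ?case using insert by (simp add: O.finsum_insert op_of_add bounded_on_sum)
qed

end

section \<open>Linear functionals on free *-algebras\<close>

text \<open>Extend a basis of \<open>W\<close> by \<open>x\<close> and then to a basis of the whole space.\<close>

lemma separating_functional:
  fixes W :: "('w \<Rightarrow> complex) set"
  assumes zero: "(\<lambda>_. 0) \<in> W" and add: "\<And>p q. p \<in> W \<Longrightarrow> q \<in> W \<Longrightarrow> (\<lambda>w. p w + q w) \<in> W"
    and scale: "\<And>c p. p \<in> W \<Longrightarrow> (\<lambda>w. c * p w) \<in> W" and x: "x \<notin> W"
  shows "\<exists>L. (\<forall>p q. L (\<lambda>w. p w + q w) = L p + L q) \<and> (\<forall>c p. L (\<lambda>w. c * p w) = c * L p) \<and>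
    (\<forall>p\<in>W. L p = 0) \<and> L x = (1 :: complex)"
proof -
  let ?scale = "\<lambda>(c::complex) (p :: 'w \<Rightarrow> complex) w. c * p w"
  interpret V: vector_space ?scale
  proof
    fix a b :: complex and x y :: "'w \<Rightarrow> complex"
    show "?scale a (x + y) = ?scale a x + ?scale a y" by (rule ext) (simp add: distrib_left)
    show "?scale (a + b) x = ?scale a x + ?scale b x" by (rule ext) (simp add: distrib_right)
    show "?scale a (?scale b x) = ?scale (a * b) x" by (rule ext) (simp add: mult.assoc)
    show "?scale 1 x = x" by (rule ext) simp
  qed
  interpret P: vector_space_pair ?scale "(*) :: complex \<Rightarrow> complex \<Rightarrow> complex"
    by (intro vector_space_pair.intro V.vector_space_axioms vector_space.intro)
       (simp_all add: distrib_left distrib_right mult.assoc)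
  have "V.subspace W"
    unfolding V.subspace_def using zero add scale by (simp add: zero_fun_def plus_fun_def)
  then have sp: "V.span W = W" by (rule V.span_eq_iff[THEN iffD2])
  obtain B where B: "B \<subseteq> W" "V.independent B" "W \<subseteq> V.span B"
    using V.maximal_independent_subset[of W] by blast
  have spB: "V.span B = W" using B(1,3) sp V.span_mono[OF B(1)] by blast
  have "V.independent (insert x B)" using B(2) x spB by (simp add: V.independent_insert)
  from P.linear_independent_extend[OF this, of "\<lambda>b. if b = x then 1 else 0"]
  obtain L where L: "Vector_Spaces.linear ?scale (*) L"
    and Lb: "\<And>b. b \<in> insert x B \<Longrightarrow> L b = (if b = x then 1 else 0)" by blast
  interpret L: Vector_Spaces.linear ?scale "(*)" L by (rule L)
  have "L p = 0" if "p \<in> W" for p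
  proof -
    have "p \<in> V.span B" using that spB by simp
    moreover have "L b = 0" if "b \<in> B" for b using Lb[of b] that B(1) x by auto
    ultimately show ?thesis by (rule L.eq_0_on_span[rotated])
  qed
  moreover have "L x = 1" using Lb[of x] by simp
  moreover have "L (\<lambda>w. p w + q w) = L p + L q" for p q using L.add[of p q] by (simp add: plus_fun_def)
  moreover have "L (\<lambda>w. c * p w) = c * L p" for c p using L.scale[of c p] by simp
  ultimately show ?thesis by blast
qed

lemma lin_expand:
  fixes L :: "('w \<Rightarrow> complex) \<Rightarrow> complex"
  assumes add: "\<And>p q. L (\<lambda>w. p w + q w) = L p + L q" and scale: "\<And>c p. L (\<lambda>w. c * p w) = c * L p"
    and r: "r \<in> fin_supp"
  shows "L r = lin r (\<lambda>w. L (unit_coeff w))"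
proof -
  have expand: "L (\<lambda>w. \<Sum>v\<in>C. r v * unit_coeff v w) = (\<Sum>v\<in>C. r v * L (unit_coeff v))" if "finite C" for C
    using that
  proof (induction C rule: finite_induct)
    case empty
    show ?case using scale[of 0 "\<lambda>_. 0"] by simp
  next
    case (insert v C)
    then show ?case using add[of "\<lambda>w. r v * unit_coeff v w" "\<lambda>w. \<Sum>v\<in>C. r v * unit_coeff v w"] scale by simp
  qed
  have "(\<Sum>v | r v \<noteq> 0. r v * unit_coeff v w) = r w" for w
  proof -
    have "(\<Sum>v | r v \<noteq> 0. r v * unit_coeff v w) = (\<Sum>v | r v \<noteq> 0. if v = w then r v else 0)"
      by (intro sum.cong refl) (auto simp: unit_coeff_def)
    also have "\<dots> = r w" using r by (simp add: fin_supp_def)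
    finally show ?thesis .
  qed
  then have "(\<lambda>w. \<Sum>v | r v \<noteq> 0. r v * unit_coeff v w) = r" by (rule ext)
  then show ?thesis using expand[of "{v. r v \<noteq> 0}"] r unfolding lin_def by (simp only: fin_supp_def mem_Collect_eq)
qed

lemma free_simps:
  "p \<otimes>\<^bsub>free_star_algebra G\<^esub> q = (\<lambda>w. \<Sum>k\<le>length w. p (take k w) * q (drop k w))"
  "p \<oplus>\<^bsub>free_star_algebra G\<^esub> q = (\<lambda>w. p w + q w)"
  "\<zero>\<^bsub>free_star_algebra G\<^esub> = (\<lambda>w. 0)"
  "c \<odot>\<^bsub>free_star_algebra G\<^esub> p = (\<lambda>w. c * p w)"
  by (simp_all add: free_star_algebra_def)

lemma free_one: "\<one>\<^bsub>free_star_algebra G\<^esub> = unit_coeff []"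
  by (simp add: free_star_algebra_def unit_coeff_def)

lemma free_gen_unit: "free_gen g = unit_coeff [(g, False)]"
  by (simp add: free_gen_def unit_coeff_def)

definition flip_word :: "('g \<times> bool) list \<Rightarrow> ('g \<times> bool) list" where
  "flip_word w = rev (map (\<lambda>(g, s). (g, \<not> s)) w)"

lemma flip_flip [simp]: "flip_word (flip_word w) = w"
  by (simp add: flip_word_def rev_map comp_def case_prod_unfold)

lemma map_fst_flip: "map fst (flip_word w) = rev (map fst w)"
  by (simp add: flip_word_def rev_map comp_def case_prod_unfold)

lemma free_star: "star (free_star_algebra G) p = (\<lambda>w. cnj (p (flip_word w)))"
  by (simp add: free_star_algebra_def flip_word_def)

lemma free_fin_supp: "p \<in> carrier (free_star_algebra G) \<Longrightarrow> p \<in> fin_supp"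
  by (simp add: free_star_algebra_def fin_supp_def)

lemma unit_coeff_carrier:
  "set u \<subseteq> G \<times> UNIV \<Longrightarrow> unit_coeff u \<in> carrier (free_star_algebra G)"
  by (rule free_star_algebra_carrierI[of "{u}"]) (auto simp: unit_coeff_def)

lemma unit_coeff_mult: "unit_coeff u \<otimes>\<^bsub>free_star_algebra G\<^esub> unit_coeff v = unit_coeff (u @ v)"
proof
  fix w
  have "(\<Sum>k\<le>length w. of_bool (take k w = u) * of_bool (drop k w = v)) = (of_bool (w = u @ v) :: complex)"
  proof (cases "w = u @ v")
    case True
    have "(\<Sum>k\<le>length w. of_bool (take k w = u) * of_bool (drop k w = v)) =
        (\<Sum>k\<in>{length u}. of_bool (take k w = u) * of_bool (drop k w = v) :: complex)"
    proof (rule sum.mono_neutral_right)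
      show "\<forall>k\<in>{..length w} - {length u}. of_bool (take k w = u) * of_bool (drop k w = v) = (0 :: complex)"
      proof
        fix k assume k: "k \<in> {..length w} - {length u}"
        then have "length (take k w) \<noteq> length u" by auto
        then have "take k w \<noteq> u" by blast
        then show "of_bool (take k w = u) * of_bool (drop k w = v) = (0 :: complex)" by simp
      qed
    qed (use True in auto)
    then show ?thesis using True by simp
  next
    case False
    then have "\<And>k. \<not> (take k w = u \<and> drop k w = v)" by (metis append_take_drop_id)
    then show ?thesis using False by (intro trans[OF sum.neutral]) auto
  qed
  then show "(unit_coeff u \<otimes>\<^bsub>free_star_algebra G\<^esub> unit_coeff v) w = unit_coeff (u @ v) w"
    by (simp add: free_simps unit_coeff_def)
qed

text \<open>By linearity in \<open>p\<close> it suffices to treat the product of a word with \<open>q\<close>.\<close>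

lemma lin_mult:
  assumes p: "p \<in> carrier (free_star_algebra G)" and q: "q \<in> carrier (free_star_algebra G)"
  shows "lin (p \<otimes>\<^bsub>free_star_algebra G\<^esub> q) g = lin p (\<lambda>u. lin q (\<lambda>v. g (u @ v)))"
proof -
  note fp = free_fin_supp[OF p] and fq = free_fin_supp[OF q]
  have "lin (p \<otimes>\<^bsub>free_star_algebra G\<^esub> q) g = lin p (\<lambda>u. lin (unit_coeff u \<otimes>\<^bsub>free_star_algebra G\<^esub> q) g)"
    (is "?L = _")
  proof -
    let ?C = "(\<lambda>(u, v). u @ v) ` ({w. p w \<noteq> 0} \<times> {w. q w \<noteq> 0})"
    have finC: "finite ?C" using fp fq by (simp add: fin_supp_def)
    have "{w. (p \<otimes>\<^bsub>free_star_algebra G\<^esub> q) w \<noteq> 0} \<subseteq> ?C"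
    proof
      fix w assume "w \<in> {w. (p \<otimes>\<^bsub>free_star_algebra G\<^esub> q) w \<noteq> 0}"
      then have "(\<Sum>k\<le>length w. p (take k w) * q (drop k w)) \<noteq> 0" by (simp add: free_simps)
      then obtain k where "p (take k w) * q (drop k w) \<noteq> 0" by (meson sum.not_neutral_contains_not_neutral)
      then show "w \<in> ?C" by (intro image_eqI[of _ _ "(take k w, drop k w)"]) auto
    qed
    then have "?L = (\<Sum>w\<in>?C. (p \<otimes>\<^bsub>free_star_algebra G\<^esub> q) w * g w)" by (rule lin_superset[OF finC])
    also have "\<dots> = lin p (\<lambda>u. \<Sum>w\<in>?C. (unit_coeff u \<otimes>\<^bsub>free_star_algebra G\<^esub> q) w * g w)"
    proof (rule lin_expand[OF _ _ fp, where L = "\<lambda>p. \<Sum>w\<in>?C. (p \<otimes>\<^bsub>free_star_algebra G\<^esub> q) w * g w"])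
    qed (simp_all add: free_simps distrib_right sum.distrib sum_distrib_left sum_distrib_right mult.assoc)
    also have "\<dots> = lin p (\<lambda>u. lin (unit_coeff u \<otimes>\<^bsub>free_star_algebra G\<^esub> q) g)"
      unfolding lin_def[of p]
    proof (intro sum.cong refl arg_cong2[where f = "(*)"])
      fix u assume u: "u \<in> {w. p w \<noteq> 0}"
      have "{w. (unit_coeff u \<otimes>\<^bsub>free_star_algebra G\<^esub> q) w \<noteq> 0} \<subseteq> ?C"
      proof
        fix w assume "w \<in> {w. (unit_coeff u \<otimes>\<^bsub>free_star_algebra G\<^esub> q) w \<noteq> 0}"
        then have "(\<Sum>k\<le>length w. unit_coeff u (take k w) * q (drop k w)) \<noteq> 0" by (simp add: free_simps)
        then obtain k where "unit_coeff u (take k w) * q (drop k w) \<noteq> 0" by (meson sum.not_neutral_contains_not_neutral)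
        then have "take k w = u" "q (drop k w) \<noteq> 0" by (auto simp: unit_coeff_def)
        then show "w \<in> ?C" using u by (intro image_eqI[of _ _ "(take k w, drop k w)"]) auto
      qed
      then show "(\<Sum>w\<in>?C. (unit_coeff u \<otimes>\<^bsub>free_star_algebra G\<^esub> q) w * g w) = lin (unit_coeff u \<otimes>\<^bsub>free_star_algebra G\<^esub> q) g"
        by (rule lin_superset[OF finC, symmetric])
    qed
    finally show ?thesis .
  qed
  also have "(\<lambda>u. lin (unit_coeff u \<otimes>\<^bsub>free_star_algebra G\<^esub> q) g) = (\<lambda>u. lin q (\<lambda>v. g (u @ v)))"
  proof
    fix u
    let ?C = "(\<lambda>v. u @ v) ` {w. q w \<noteq> 0}"
    have finC: "finite ?C" using fq by (simp add: fin_supp_def)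
    have eval: "(unit_coeff u \<otimes>\<^bsub>free_star_algebra G\<^esub> q) (u @ v) = q v" for v
    proof -
      have "(\<Sum>k\<le>length (u @ v). unit_coeff u (take k (u @ v)) * q (drop k (u @ v))) =
          (\<Sum>k\<in>{length u}. unit_coeff u (take k (u @ v)) * q (drop k (u @ v)))"
      proof (rule sum.mono_neutral_right)
        show "\<forall>k\<in>{..length (u @ v)} - {length u}. unit_coeff u (take k (u @ v)) * q (drop k (u @ v)) = 0"
        proof
          fix k assume k: "k \<in> {..length (u @ v)} - {length u}"
          then have "length (take k (u @ v)) \<noteq> length u" by auto
          then have "take k (u @ v) \<noteq> u" using arg_cong[of "take k (u @ v)" u length] by blast
          then show "unit_coeff u (take k (u @ v)) * q (drop k (u @ v)) = 0" by (simp add: unit_coeff_def)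
        qed
      qed auto
      then show ?thesis by (simp add: free_simps unit_coeff_def)
    qed
    have "{w. (unit_coeff u \<otimes>\<^bsub>free_star_algebra G\<^esub> q) w \<noteq> 0} \<subseteq> ?C"
    proof
      fix w assume "w \<in> {w. (unit_coeff u \<otimes>\<^bsub>free_star_algebra G\<^esub> q) w \<noteq> 0}"
      then have "(\<Sum>k\<le>length w. unit_coeff u (take k w) * q (drop k w)) \<noteq> 0" by (simp add: free_simps)
      then obtain k where "unit_coeff u (take k w) * q (drop k w) \<noteq> 0" by (meson sum.not_neutral_contains_not_neutral)
      then have "take k w = u" "q (drop k w) \<noteq> 0" by (auto simp: unit_coeff_def)
      then show "w \<in> ?C" by (intro image_eqI[of _ _ "drop k w"]) auto
    qed
    then have "lin (unit_coeff u \<otimes>\<^bsub>free_star_algebra G\<^esub> q) g = (\<Sum>w\<in>?C. (unit_coeff u \<otimes>\<^bsub>free_star_algebra G\<^esub> q) w * g w)"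
      by (rule lin_superset[OF finC])
    also have "\<dots> = (\<Sum>v | q v \<noteq> 0. (unit_coeff u \<otimes>\<^bsub>free_star_algebra G\<^esub> q) (u @ v) * g (u @ v))"
      by (simp add: sum.reindex inj_on_def)
    also have "\<dots> = lin q (\<lambda>v. g (u @ v))" by (simp add: eval lin_def)
    finally show "lin (unit_coeff u \<otimes>\<^bsub>free_star_algebra G\<^esub> q) g = lin q (\<lambda>v. g (u @ v))" .
  qed
  finally show ?thesis .
qed

lemma lin_star: "lin (star (free_star_algebra G) p) g = cnj (lin p (\<lambda>w. cnj (g (flip_word w))))"
proof -
  have "lin (star (free_star_algebra G) p) g = (\<Sum>w | p (flip_word w) \<noteq> 0. cnj (p (flip_word w)) * g w)"
    by (simp add: lin_def free_star)
  also have "\<dots> = (\<Sum>w | p w \<noteq> 0. cnj (p w) * g (flip_word w))"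
    by (rule sum.reindex_bij_witness[of _ flip_word flip_word]) auto
  finally show ?thesis by (simp add: lin_def)
qed

lemma free_uminus:
  assumes "q \<in> carrier (free_star_algebra G)"
  shows "\<ominus>\<^bsub>free_star_algebra G\<^esub> q = (\<lambda>w. - q w)"
proof -
  interpret ring "free_star_algebra G" by (rule ring_free_star_algebra)
  have "(\<lambda>w. - q w) \<in> carrier (free_star_algebra G)"
    using assms by (simp add: free_star_algebra_def)
  moreover have "(\<lambda>w. - q w) \<oplus>\<^bsub>free_star_algebra G\<^esub> q = \<zero>\<^bsub>free_star_algebra G\<^esub>"
    by (simp add: free_simps)
  ultimately show ?thesis using minus_equality assms by blast
qed

lemma free_minus:
  "q \<in> carrier (free_star_algebra G) \<Longrightarrow> p \<ominus>\<^bsub>free_star_algebra G\<^esub> q = (\<lambda>w. p w - q w)"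
  by (simp add: a_minus_def free_uminus free_simps)

lemma free_finsum:
  assumes "finite C" "\<And>x. x \<in> C \<Longrightarrow> p x \<in> carrier (free_star_algebra G)"
  shows "(\<Oplus>\<^bsub>free_star_algebra G\<^esub>x\<in>C. p x) = (\<lambda>w. \<Sum>x\<in>C. p x w)"
proof -
  interpret ring "free_star_algebra G" by (rule ring_free_star_algebra)
  show ?thesis using assms
  proof (induction C rule: finite_induct)
    case empty
    show ?case by (simp add: free_simps)
  next
    case (insert x C)
    then have "p \<in> C \<rightarrow> carrier (free_star_algebra G)" "p x \<in> carrier (free_star_algebra G)" by auto
    then show ?case using insert by (simp add: finsum_insert) (simp add: free_simps)
  qed
qed

lemma free_smult_closed:
  "p \<in> carrier (free_star_algebra G) \<Longrightarrow> (\<lambda>w. c * p w) \<in> carrier (free_star_algebra G)"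
  by (rule free_star_algebra_carrierI[of "{w. p w \<noteq> 0}"])
     (auto dest: free_star_algebra_carrierD)

lemma free_star_closed:
  assumes p: "p \<in> carrier (free_star_algebra G)"
  shows "star (free_star_algebra G) p \<in> carrier (free_star_algebra G)"
proof (rule free_star_algebra_carrierI[of "flip_word ` {w. p w \<noteq> 0}"])
  show "finite (flip_word ` {w. p w \<noteq> 0})" using free_star_algebra_carrierD(1)[OF p] by simp
  show "{w. star (free_star_algebra G) p w \<noteq> 0} \<subseteq> flip_word ` {w. p w \<noteq> 0}"
    by (auto simp: free_star intro: image_eqI[of _ _ "flip_word _"])
  have "flip_word w \<in> lists (G \<times> UNIV)" if "w \<in> lists (G \<times> UNIV)" for w :: "('a \<times> bool) list"
    using that by (auto simp: flip_word_def in_lists_conv_set)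
  then show "flip_word ` {w. p w \<noteq> 0} \<subseteq> lists (G \<times> UNIV)"
    using free_star_algebra_carrierD(2)[OF p] by blast
qed

section \<open>Functionals and ideals of game algebras\<close>

text \<open>The largest two-sided ideal on which \<open>f\<close> vanishes, where \<open>f\<close> takes the same value on a generator and on its adjoint.\<close>

definition functional_kernel :: "'g set \<Rightarrow> ('g list \<Rightarrow> complex) \<Rightarrow> (('g \<times> bool) list \<Rightarrow> complex) set" where
  "functional_kernel G f = {p \<in> carrier (free_star_algebra G). \<forall>a b. lin p (\<lambda>u. f (a @ map fst u @ b)) = 0}"

lemma ideal_functional_kernel: "ideal (functional_kernel G f) (free_star_algebra G)"
proof (rule idealI)
  let ?A = "free_star_algebra G"
  let ?N = "functional_kernel G f"
  interpret ring ?A by (rule ring_free_star_algebra)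
  show "ring ?A" by (rule ring_axioms)
  have uminus: "lin (\<lambda>w. - p w) g = - lin p g" for p :: "('a \<times> bool) list \<Rightarrow> complex" and g
    by (simp add: lin_def sum_negf)
  have minv: "inv\<^bsub>add_monoid ?A\<^esub> p = (\<lambda>w. - p w)" if "p \<in> carrier ?A" for p
    using free_uminus[OF that] by (simp add: a_inv_def)
  show "subgroup ?N (add_monoid ?A)"
  proof (rule group.subgroupI[OF a_group])
    show "?N \<subseteq> carrier (add_monoid ?A)" by (auto simp: functional_kernel_def)
    have "\<zero>\<^bsub>?A\<^esub> \<in> ?N" using zero_closed by (auto simp: functional_kernel_def free_simps lin_def)
    then show "?N \<noteq> {}" by blast
    show "inv\<^bsub>add_monoid ?A\<^esub> p \<in> ?N" if "p \<in> ?N" for p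
    proof -
      have p: "p \<in> carrier ?A" using that by (simp add: functional_kernel_def)
      show ?thesis using that a_inv_closed[OF p] unfolding minv[OF p] free_uminus[OF p]
        by (simp add: functional_kernel_def uminus)
    qed
    show "p \<otimes>\<^bsub>add_monoid ?A\<^esub> q \<in> ?N" if "p \<in> ?N" "q \<in> ?N" for p q
    proof -
      have c: "p \<in> carrier ?A" "q \<in> carrier ?A" using that by (auto simp: functional_kernel_def)
      show ?thesis using that a_closed[OF c] lin_add[OF free_fin_supp[OF c(1)] free_fin_supp[OF c(2)]]
        by (simp add: functional_kernel_def free_simps)
    qed
  qed
  fix p q assume p: "p \<in> ?N" and q: "q \<in> carrier ?A"
  then have pc: "p \<in> carrier ?A" and p0: "\<And>a b. lin p (\<lambda>u. f (a @ map fst u @ b)) = 0"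
    by (auto simp: functional_kernel_def)
  have "lin p (\<lambda>u. lin q (\<lambda>v. f (a @ map fst (u @ v) @ b))) = 0" for a b
  proof -
    have "lin p (\<lambda>u. lin q (\<lambda>v. f (a @ map fst (u @ v) @ b))) =
        lin q (\<lambda>v. lin p (\<lambda>u. f (a @ map fst u @ (map fst v @ b))))"
      unfolding lin_def sum_distrib_left by (subst sum.swap) (simp add: mult_ac)
    then show ?thesis by (simp only: p0) (simp add: lin_def)
  qed
  then show "p \<otimes>\<^bsub>?A\<^esub> q \<in> ?N" using m_closed[OF pc q] by (simp add: functional_kernel_def lin_mult[OF pc q])
  have "lin q (\<lambda>u. lin p (\<lambda>v. f (a @ map fst (u @ v) @ b))) = 0" for a b
  proof -
    have "lin p (\<lambda>v. f (a @ map fst (u @ v) @ b)) = 0" for u using p0[of "a @ map fst u" b] by simp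
    then show ?thesis by (simp add: lin_def)
  qed
  then show "q \<otimes>\<^bsub>?A\<^esub> p \<in> ?N" using m_closed[OF q pc] by (simp add: functional_kernel_def lin_mult[OF q pc])
qed

lemma gen_star_ideal_in_kernel:
  assumes herm: "\<And>w. f (rev w) = cnj (f w)" and S: "S \<subseteq> functional_kernel G f"
  shows "gen_star_ideal (free_star_algebra G) S \<subseteq> functional_kernel G f"
proof -
  let ?A = "free_star_algebra G"
  have "c \<odot>\<^bsub>?A\<^esub> p \<in> functional_kernel G f" if "p \<in> functional_kernel G f" for c p
    using that by (auto simp: functional_kernel_def free_simps free_smult_closed lin_scale free_fin_supp)
  moreover have "star ?A p \<in> functional_kernel G f" if p: "p \<in> functional_kernel G f" for p
  proof -
    have "lin (star ?A p) (\<lambda>u. f (a @ map fst u @ b)) = 0" for a b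
    proof -
      have "cnj (f (a @ map fst (flip_word w) @ b)) = f (rev b @ map fst w @ rev a)" for w
        unfolding map_fst_flip herm[symmetric] by simp
      then have "lin (star ?A p) (\<lambda>u. f (a @ map fst u @ b)) = cnj (lin p (\<lambda>w. f (rev b @ map fst w @ rev a)))"
        by (simp add: lin_star)
      then show ?thesis using p by (simp add: functional_kernel_def)
    qed
    then show ?thesis using p by (simp add: functional_kernel_def free_star_closed)
  qed
  ultimately show ?thesis
    unfolding gen_star_ideal_def using ideal_functional_kernel S by (intro Inter_lower) blast
qed

lemma lin_relations:
  fixes x a :: 'x and X :: "'x set"
  assumes x: "x \<in> X" and a: "a \<in> X"
  defines "A \<equiv> free_star_algebra (X \<times> X)"
  shows "lin (star A (free_gen (x, a)) \<ominus>\<^bsub>A\<^esub> free_gen (x, a)) g = g [((x, a), True)] - g [((x, a), False)]"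
    and "lin (free_gen (x, a) \<otimes>\<^bsub>A\<^esub> free_gen (x, a) \<ominus>\<^bsub>A\<^esub> free_gen (x, a)) g =
      g [((x, a), False), ((x, a), False)] - g [((x, a), False)]"
    and "finite X \<Longrightarrow> lin ((\<Oplus>\<^bsub>A\<^esub>a\<in>X. free_gen (x, a)) \<ominus>\<^bsub>A\<^esub> \<one>\<^bsub>A\<^esub>) g = (\<Sum>a\<in>X. g [((x, a), False)]) - g []"
    and "lin (free_gen (x, a) \<otimes>\<^bsub>A\<^esub> free_gen (y, b)) g = g [((x, a), False), ((y, b), False)]"
proof -
  have gen: "free_gen (x, a) \<in> carrier A" if "a \<in> X" for a
    unfolding free_gen_unit A_def by (rule unit_coeff_carrier) (use x that in auto)
  have one: "\<one>\<^bsub>A\<^esub> \<in> carrier A" unfolding A_def by (rule ring.ring_simprules(6)[OF ring_free_star_algebra])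
  have lindiff: "lin (\<lambda>w. p w - q w) g = lin p g - lin q g" if "p \<in> fin_supp" "q \<in> fin_supp"
    for p q :: "(('x \<times> 'x) \<times> bool) list \<Rightarrow> complex"
    using lin_add[OF that(1) fin_supp_scale[OF that(2), of "-1"], of g] lin_scale[OF that(2), of "-1" g] by simp
  have star: "star A (free_gen (x, a)) = unit_coeff [((x, a), True)]"
  proof
    fix w :: "(('x \<times> 'x) \<times> bool) list"
    have "w = [((x, a), True)]" if "flip_word w = [((x, a), False)]"
      using flip_flip[of w] unfolding that by (simp add: flip_word_def)
    then have "flip_word w = [((x, a), False)] \<longleftrightarrow> w = [((x, a), True)]"
      by (auto simp: flip_word_def)
    then show "star A (free_gen (x, a)) w = unit_coeff [((x, a), True)] w"
      by (simp add: A_def free_star free_gen_unit unit_coeff_def)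
  qed
  note fs = unit_coeff_fin_supp
  show "lin (star A (free_gen (x, a)) \<ominus>\<^bsub>A\<^esub> free_gen (x, a)) g = g [((x, a), True)] - g [((x, a), False)]"
    using free_minus[of "free_gen (x, a)" "X \<times> X"] gen[OF a]
    by (simp add: A_def[symmetric] star) (simp add: free_gen_unit lindiff fs lin_unit_coeff)
  have mult: "free_gen (x, a) \<otimes>\<^bsub>A\<^esub> free_gen (y, b) = unit_coeff [((x, a), False), ((y, b), False)]" for y b
    unfolding free_gen_unit A_def by (simp add: unit_coeff_mult)
  show "lin (free_gen (x, a) \<otimes>\<^bsub>A\<^esub> free_gen (x, a) \<ominus>\<^bsub>A\<^esub> free_gen (x, a)) g =
      g [((x, a), False), ((x, a), False)] - g [((x, a), False)]"
    using free_minus[of "free_gen (x, a)" "X \<times> X"] gen[OF a] unfolding mult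
    by (simp add: A_def[symmetric] lindiff free_gen_unit fs lin_unit_coeff)
  show "lin (free_gen (x, a) \<otimes>\<^bsub>A\<^esub> free_gen (y, b)) g = g [((x, a), False), ((y, b), False)]"
    by (simp add: mult lin_unit_coeff)
  assume fin: "finite X"
  have sum: "(\<Oplus>\<^bsub>A\<^esub>a\<in>X. free_gen (x, a)) = (\<lambda>w. \<Sum>a\<in>X. free_gen (x, a) w)"
    unfolding A_def by (rule free_finsum[OF fin]) (use gen in \<open>auto simp: A_def\<close>)
  have "(\<lambda>w. \<Sum>a\<in>C. unit_coeff [((x, a), False)] w) \<in> fin_supp \<and>
      lin (\<lambda>w. \<Sum>a\<in>C. unit_coeff [((x, a), False)] w) g = (\<Sum>a\<in>C. g [((x, a), False)])" if "finite C" for C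
    using that
  proof (induction C rule: finite_induct)
    case empty show ?case by (simp add: fin_supp_def lin_def)
  next
    case (insert a C)
    then show ?case by (simp add: lin_add fin_supp_add fs lin_unit_coeff)
  qed
  from this[OF fin] show "lin ((\<Oplus>\<^bsub>A\<^esub>a\<in>X. free_gen (x, a)) \<ominus>\<^bsub>A\<^esub> \<one>\<^bsub>A\<^esub>) g = (\<Sum>a\<in>X. g [((x, a), False)]) - g []"
    using free_minus[of "\<one>\<^bsub>A\<^esub>" "X \<times> X"] one
    by (simp add: A_def[symmetric] sum) (simp add: A_def free_one free_gen_unit lindiff fs lin_unit_coeff)
qed

text \<open>The relations of a game, for a functional given by its values on words of generators, in all contexts \<open>u \<dots> v\<close> from \<open>W\<close>.\<close>

definition game_functional ::
  "'x set \<Rightarrow> ('x \<Rightarrow> 'x \<Rightarrow> 'x \<Rightarrow> 'x \<Rightarrow> bool) \<Rightarrow> ('x \<times> 'x) list set \<Rightarrow> (('x \<times> 'x) list \<Rightarrow> complex) \<Rightarrow> bool" where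
  "game_functional X rule W f \<longleftrightarrow>
     (\<forall>u\<in>W. \<forall>v\<in>W. \<forall>x\<in>X. \<forall>a\<in>X. f (u @ (x, a) # (x, a) # v) = f (u @ (x, a) # v)) \<and>
     (\<forall>u\<in>W. \<forall>v\<in>W. \<forall>x\<in>X. (\<Sum>a\<in>X. f (u @ (x, a) # v)) = f (u @ v)) \<and>
     (\<forall>u\<in>W. \<forall>v\<in>W. \<forall>x\<in>X. \<forall>y\<in>X. \<forall>a\<in>X. \<forall>b\<in>X. \<not> rule x y a b \<longrightarrow> f (u @ (x, a) # (y, b) # v) = 0)"

definition game_ideal where
  "game_ideal X rule = gen_star_ideal (free_star_algebra (X \<times> X)) (game_relations X rule)"

lemma ideal_game_ideal: "ideal (game_ideal X rule) (free_star_algebra (X \<times> X))"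
  unfolding game_ideal_def by (rule ideal_gen_star_ideal[OF game_relations_subset])

lemma game_relations_in_kernel:
  assumes fin: "finite X" and f: "game_functional X rule UNIV f"
  shows "game_relations X rule \<subseteq> functional_kernel (X \<times> X) f"
proof
  fix r assume r: "r \<in> game_relations X rule"
  have "lin r (\<lambda>u. f (a @ map fst u @ b)) = 0" for a b
    using r f fin unfolding game_relations_def Let_def
    by (auto simp: lin_relations game_functional_def)
  then show "r \<in> functional_kernel (X \<times> X) f"
    using subsetD[OF game_relations_subset r] by (simp add: functional_kernel_def)
qed

lemma game_ideal_in_kernel:
  assumes "finite X" "game_functional X rule UNIV f" "\<And>w. f (rev w) = cnj (f w)"
  shows "game_ideal X rule \<subseteq> functional_kernel (X \<times> X) f"
  unfolding game_ideal_def
  by (rule gen_star_ideal_in_kernel[OF assms(3) game_relations_in_kernel[OF assms(1,2)]])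

lemma game_algebra_nonzero_iff:
  "carrier (game_algebra X rule) \<noteq> {\<zero>\<^bsub>game_algebra X rule\<^esub>} \<longleftrightarrow>
   \<one>\<^bsub>free_star_algebra (X \<times> X)\<^esub> \<notin> game_ideal X rule"
proof -
  let ?A = "free_star_algebra (X \<times> X)" and ?I = "game_ideal X rule"
  interpret I: ideal ?I ?A by (rule ideal_game_ideal)
  have zero: "\<zero>\<^bsub>game_algebra X rule\<^esub> = ?I"
    by (simp add: game_algebra_def quot_star_algebra_def FactRing_def game_ideal_def)
  have car: "carrier (game_algebra X rule) = a_rcosets\<^bsub>?A\<^esub> ?I"
    by (simp add: game_algebra_def quot_star_algebra_def FactRing_def game_ideal_def)
  have Iin: "?I \<in> a_rcosets\<^bsub>?A\<^esub> ?I"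
  proof -
    have "\<zero>\<^bsub>?A\<^esub> \<in> ?I" by (rule additive_subgroup.zero_closed[OF I.additive_subgroup_axioms])
    then have "?I +>\<^bsub>?A\<^esub> \<zero>\<^bsub>?A\<^esub> = ?I" by (rule I.a_rcos_const)
    then show ?thesis using I.a_rcosetsI[OF I.a_subset I.zero_closed] by simp
  qed
  show ?thesis
  proof
    assume "carrier (game_algebra X rule) \<noteq> {\<zero>\<^bsub>game_algebra X rule\<^esub>}"
    then obtain K where K: "K \<in> a_rcosets\<^bsub>?A\<^esub> ?I" "K \<noteq> ?I" using Iin by (auto simp: zero car)
    then obtain p where p: "p \<in> carrier ?A" "K = ?I +>\<^bsub>?A\<^esub> p" by (auto simp: A_RCOSETS_def')
    show "\<one>\<^bsub>?A\<^esub> \<notin> ?I"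
    proof
      assume "\<one>\<^bsub>?A\<^esub> \<in> ?I"
      then have "p \<in> ?I" using I.one_imp_carrier p(1) by simp
      then have "?I +>\<^bsub>?A\<^esub> p = ?I" by (rule I.a_rcos_const)
      then show False using K(2) p(2) by simp
    qed
  next
    assume one: "\<one>\<^bsub>?A\<^esub> \<notin> ?I"
    have "?I +>\<^bsub>?A\<^esub> \<one>\<^bsub>?A\<^esub> \<in> a_rcosets\<^bsub>?A\<^esub> ?I" by (rule I.a_rcosetsI[OF I.a_subset I.one_closed])
    moreover have "?I +>\<^bsub>?A\<^esub> \<one>\<^bsub>?A\<^esub> \<noteq> ?I"
      using I.a_rcos_self[OF I.one_closed] one by blast
    ultimately show "carrier (game_algebra X rule) \<noteq> {\<zero>\<^bsub>game_algebra X rule\<^esub>}" by (auto simp: zero car)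
  qed
qed

text \<open>The kernel of a Hermitian functional contains the ideal of relations, but not 1.\<close>

lemma game_functional_nonzero:
  assumes "finite X" "game_functional X rule UNIV f" "\<And>w. f (rev w) = cnj (f w)" "f [] \<noteq> 0"
  shows "carrier (game_algebra X rule) \<noteq> {\<zero>\<^bsub>game_algebra X rule\<^esub>}"
proof -
  have "\<one>\<^bsub>free_star_algebra (X \<times> X)\<^esub> \<notin> functional_kernel (X \<times> X) f"
  proof
    assume "\<one>\<^bsub>free_star_algebra (X \<times> X)\<^esub> \<in> functional_kernel (X \<times> X) f"
    then have "\<forall>a b. f (a @ b) = 0" by (simp add: functional_kernel_def free_one lin_unit_coeff)
    then have "f ([] @ []) = 0" by blast
    then show False using assms(4) by simp
  qed
  then show ?thesis using game_ideal_in_kernel[OF assms(1-3)] game_algebra_nonzero_iff by blast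
qed

text \<open>If 1 is not in the ideal of relations, then some functional vanishes on the ideal and is 1 at 1. The ideal is closed under adjoints, so the
  functional also respects the relations with their two factors interchanged.\<close>

lemma game_functional_exists:
  assumes fin: "finite X"
    and nz: "carrier (game_algebra X rule) \<noteq> {\<zero>\<^bsub>game_algebra X rule\<^esub>}"
  shows "\<exists>f. game_functional X rule (lists (X \<times> X)) f \<and>
    game_functional X (\<lambda>x y a b. rule y x b a) (lists (X \<times> X)) f \<and> f [] = 1"
proof -
  let ?A = "free_star_algebra (X \<times> X)" and ?I = "game_ideal X rule"
  interpret I: ideal ?I ?A by (rule ideal_game_ideal)
  have smult: "(\<lambda>w. c * p w) \<in> ?I" if p: "p \<in> ?I" for c p
    using p unfolding game_ideal_def gen_star_ideal_def by (auto simp: free_simps)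
  have "\<exists>L. (\<forall>p q. L (\<lambda>w. p w + q w) = L p + L q) \<and> (\<forall>c p. L (\<lambda>w. c * p w) = c * L p) \<and>
    (\<forall>p\<in>?I. L p = 0) \<and> L \<one>\<^bsub>?A\<^esub> = (1 :: complex)"
  proof (rule separating_functional)
    show "(\<lambda>_. 0) \<in> ?I"
      using additive_subgroup.zero_closed[OF I.additive_subgroup_axioms] by (simp add: free_simps)
    show "(\<lambda>w. p w + q w) \<in> ?I" if "p \<in> ?I" "q \<in> ?I" for p q
      using additive_subgroup.a_closed[OF I.additive_subgroup_axioms that] by (simp add: free_simps)
    show "\<one>\<^bsub>?A\<^esub> \<notin> ?I" using nz by (simp add: game_algebra_nonzero_iff)
  qed (rule smult)
  then obtain L where L: "\<And>p q. L (\<lambda>w. p w + q w) = L p + L q" "\<And>c p. L (\<lambda>w. c * p w) = c * L p"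
    and LI: "\<And>p. p \<in> ?I \<Longrightarrow> L p = 0" and L1: "L \<one>\<^bsub>?A\<^esub> = (1 :: complex)" by blast
  let ?m = "map (\<lambda>l :: 'a \<times> 'a. (l, False))"
  define f where "f = (\<lambda>w. L (unit_coeff (?m w)))"
  have rel: "lin r (\<lambda>w. L (unit_coeff (u @ w @ v))) = 0"
    if r: "r \<in> ?I" and u: "set u \<subseteq> (X \<times> X) \<times> UNIV" and v: "set v \<subseteq> (X \<times> X) \<times> UNIV" for r u v
  proof -
    have rc: "r \<in> carrier ?A" using r I.a_subset by blast
    note uc = unit_coeff_carrier[OF u] and vc = unit_coeff_carrier[OF v]
    from r have "unit_coeff u \<otimes>\<^bsub>?A\<^esub> r \<otimes>\<^bsub>?A\<^esub> unit_coeff v \<in> ?I"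
      by (intro I.I_l_closed I.I_r_closed uc vc)
    then have "L (unit_coeff u \<otimes>\<^bsub>?A\<^esub> r \<otimes>\<^bsub>?A\<^esub> unit_coeff v) = 0" by (rule LI)
    moreover have "L (unit_coeff u \<otimes>\<^bsub>?A\<^esub> r \<otimes>\<^bsub>?A\<^esub> unit_coeff v) =
        lin r (\<lambda>w. L (unit_coeff u \<otimes>\<^bsub>?A\<^esub> unit_coeff w \<otimes>\<^bsub>?A\<^esub> unit_coeff v))"
    proof (rule lin_expand[OF _ _ free_fin_supp[OF rc],
          where L = "\<lambda>r. L (unit_coeff u \<otimes>\<^bsub>?A\<^esub> r \<otimes>\<^bsub>?A\<^esub> unit_coeff v)"])
      fix p q :: "(('a \<times> 'a) \<times> bool) list \<Rightarrow> complex" and c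
      show "L (unit_coeff u \<otimes>\<^bsub>?A\<^esub> (\<lambda>w. p w + q w) \<otimes>\<^bsub>?A\<^esub> unit_coeff v) =
          L (unit_coeff u \<otimes>\<^bsub>?A\<^esub> p \<otimes>\<^bsub>?A\<^esub> unit_coeff v) +
          L (unit_coeff u \<otimes>\<^bsub>?A\<^esub> q \<otimes>\<^bsub>?A\<^esub> unit_coeff v)"
        unfolding L(1)[symmetric] by (simp add: free_simps distrib_left distrib_right sum.distrib)
      show "L (unit_coeff u \<otimes>\<^bsub>?A\<^esub> (\<lambda>w. c * p w) \<otimes>\<^bsub>?A\<^esub> unit_coeff v) =
          c * L (unit_coeff u \<otimes>\<^bsub>?A\<^esub> p \<otimes>\<^bsub>?A\<^esub> unit_coeff v)"
        unfolding L(2)[symmetric] by (simp add: free_simps sum_distrib_left sum_distrib_right mult_ac)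
    qed
    ultimately show ?thesis by (simp add: unit_coeff_mult)
  qed
  have relI: "game_relations X rule \<subseteq> ?I" unfolding game_ideal_def gen_star_ideal_def by blast
  have m: "set (?m u) \<subseteq> (X \<times> X) \<times> UNIV" if "u \<in> lists (X \<times> X)" for u using that by auto
  have game: "game_functional X rule (lists (X \<times> X)) f"
    unfolding game_functional_def
  proof (intro conjI ballI impI)
    fix u v assume u: "u \<in> lists (X \<times> X)" and v: "v \<in> lists (X \<times> X)"
    fix x assume x: "x \<in> X"
    show "(\<Sum>a\<in>X. f (u @ (x, a) # v)) = f (u @ v)"
    proof -
      have "(\<Oplus>\<^bsub>?A\<^esub>a\<in>X. free_gen (x, a)) \<ominus>\<^bsub>?A\<^esub> \<one>\<^bsub>?A\<^esub> \<in> game_relations X rule"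
        unfolding game_relations_def Let_def using x by blast
      from rel[OF subsetD[OF relI this] m[OF u] m[OF v]] show ?thesis by (simp add: lin_relations(3)[OF x x fin] f_def)
    qed
    fix a assume a: "a \<in> X"
    show "f (u @ (x, a) # (x, a) # v) = f (u @ (x, a) # v)"
    proof -
      have "free_gen (x, a) \<otimes>\<^bsub>?A\<^esub> free_gen (x, a) \<ominus>\<^bsub>?A\<^esub> free_gen (x, a) \<in> game_relations X rule"
        unfolding game_relations_def Let_def using x a by blast
      from rel[OF subsetD[OF relI this] m[OF u] m[OF v]] show ?thesis by (simp add: lin_relations(2)[OF x a] f_def)
    qed
  next
    fix u v x y a b assume u: "u \<in> lists (X \<times> X)" and v: "v \<in> lists (X \<times> X)"
      and x: "x \<in> X" and "y \<in> X" and a: "a \<in> X" and "b \<in> X" and "\<not> rule x y a b"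
    then have "free_gen (x, a) \<otimes>\<^bsub>?A\<^esub> free_gen (y, b) \<in> game_relations X rule"
      unfolding game_relations_def Let_def by blast
    from rel[OF subsetD[OF relI this] m[OF u] m[OF v]] show "f (u @ (x, a) # (y, b) # v) = 0" by (simp add: lin_relations(4)[OF x a] f_def)
  qed
  \<comment> \<open>A generator and its adjoint are congruent modulo the ideal, so the flags of the letters can be cleared.\<close>
  have flag: "L (unit_coeff (u @ (l, True) # v)) = L (unit_coeff (u @ (l, False) # v))"
    if l: "l \<in> X \<times> X" and u: "set u \<subseteq> (X \<times> X) \<times> UNIV" and v: "set v \<subseteq> (X \<times> X) \<times> UNIV" for l u v
  proof -
    obtain x a where xa: "l = (x, a)" "x \<in> X" "a \<in> X" using l by auto
    then have "star ?A (free_gen (x, a)) \<ominus>\<^bsub>?A\<^esub> free_gen (x, a) \<in> game_relations X rule"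
      unfolding game_relations_def Let_def by blast
    from rel[OF subsetD[OF relI this] u v] show ?thesis by (simp add: lin_relations(1)[OF xa(2,3)] xa(1))
  qed
  have "game_functional X (\<lambda>x y a b. rule y x b a) (lists (X \<times> X)) f"
    unfolding game_functional_def
  proof (intro conjI)
    show "\<forall>u\<in>lists (X \<times> X). \<forall>v\<in>lists (X \<times> X). \<forall>x\<in>X. \<forall>y\<in>X. \<forall>a\<in>X. \<forall>b\<in>X.
        \<not> rule y x b a \<longrightarrow> f (u @ (x, a) # (y, b) # v) = 0"
    proof (intro ballI impI)
      fix u v x y a b assume u: "u \<in> lists (X \<times> X)" and v: "v \<in> lists (X \<times> X)"
        and xy: "x \<in> X" "y \<in> X" "a \<in> X" "b \<in> X" "\<not> rule y x b a"
      then have "free_gen (y, b) \<otimes>\<^bsub>?A\<^esub> free_gen (x, a) \<in> game_relations X rule"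
        unfolding game_relations_def Let_def by blast
      then have "star ?A (free_gen (y, b) \<otimes>\<^bsub>?A\<^esub> free_gen (x, a)) \<in> ?I"
        using relI unfolding game_ideal_def gen_star_ideal_def by blast
      from rel[OF this m[OF u] m[OF v]]
      have "L (unit_coeff (?m u @ ((x, a), True) # ((y, b), True) # ?m v)) = 0"
        by (simp add: lin_star lin_relations(4)[OF xy(2,4)] flip_word_def)
      also have "L (unit_coeff (?m u @ ((x, a), True) # ((y, b), True) # ?m v)) =
          L (unit_coeff (?m u @ ((x, a), False) # ((y, b), True) # ?m v))"
        using xy m[OF u] m[OF v] by (intro flag) auto
      also have "\<dots> = L (unit_coeff ((?m u @ [((x, a), False)]) @ ((y, b), True) # ?m v))" by simp
      also have "\<dots> = L (unit_coeff ((?m u @ [((x, a), False)]) @ ((y, b), False) # ?m v))"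
        using xy m[OF u] m[OF v] by (intro flag) auto
      finally show "f (u @ (x, a) # (y, b) # v) = 0" by (simp add: f_def)
    qed
  qed (use game in \<open>auto simp: game_functional_def\<close>)
  moreover have "f [] = 1" using L1 by (simp add: f_def free_one)
  ultimately show ?thesis using game by blast
qed

section \<open>Realising a tracial state on a Hilbert space\<close>

lemma (in semi_inner) ip_sum:
  assumes d: "d \<in> V" and a: "\<And>x. x \<in> A \<Longrightarrow> a x \<in> V" and A: "finite A"
  shows "(\<lambda>w. \<Sum>x\<in>A. c x * a x w) \<in> V \<and> ip (\<lambda>w. \<Sum>x\<in>A. c x * a x w) d = (\<Sum>x\<in>A. c x * ip (a x) d)"
  using A a
proof (induction A rule: finite_induct)
  case empty
  show ?case using scale_closed[OF d, of 0] ip_scale[OF d d, of 0] by simp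
next
  case (insert x A)
  then show ?case using scale_closed[of "a x" "c x"] ip_scale[of "a x" d "c x"]
    by (simp add: add_closed ip_add d)
qed

text \<open>There are no more than continuum many such functions, as each is described by countably many real numbers, and a real number by
  a set of natural numbers.\<close>

lemma countable_functions_embed:
  assumes "countable (\<Omega> :: 'w set)"
  shows "\<exists>e :: ('w \<Rightarrow> complex) \<Rightarrow> complex. inj_on e {\<phi>. \<forall>w. w \<notin> \<Omega> \<longrightarrow> \<phi> w = 0}"
proof -
  have "(UNIV :: real set) \<lesssim> (UNIV :: nat set set)" "(UNIV :: nat set set) \<lesssim> (UNIV :: real set)"
    using nat_sets_eqpoll_reals eqpoll_imp_lepoll eqpoll_sym by blast+
  then obtain a :: "real \<Rightarrow> nat set" and b :: "nat set \<Rightarrow> real" where a: "inj a" and b: "inj b"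
    unfolding lepoll_def by auto
  define S where "S = (\<lambda>\<phi> :: 'w \<Rightarrow> complex.
     {prod_encode (to_nat_on \<Omega> w, prod_encode (0, k)) |w k. w \<in> \<Omega> \<and> k \<in> a (Re (\<phi> w))} \<union>
     {prod_encode (to_nat_on \<Omega> w, prod_encode (1, k)) |w k. w \<in> \<Omega> \<and> k \<in> a (Im (\<phi> w))})"
  have mem: "prod_encode (to_nat_on \<Omega> w, prod_encode (0, k)) \<in> S \<phi> \<longleftrightarrow> k \<in> a (Re (\<phi> w))"
    "prod_encode (to_nat_on \<Omega> w, prod_encode (1, k)) \<in> S \<phi> \<longleftrightarrow> k \<in> a (Im (\<phi> w))"
    if "w \<in> \<Omega>" for w k \<phi>
    using that assms unfolding S_def by (auto dest: inj_onD[OF inj_on_to_nat_on])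
  have "inj_on (\<lambda>\<phi>. complex_of_real (b (S \<phi>))) {\<phi>. \<forall>w. w \<notin> \<Omega> \<longrightarrow> \<phi> w = 0}"
  proof (rule inj_onI)
    fix \<phi> \<psi> :: "'w \<Rightarrow> complex"
    assume p: "\<phi> \<in> {\<phi>. \<forall>w. w \<notin> \<Omega> \<longrightarrow> \<phi> w = 0}" "\<psi> \<in> {\<phi>. \<forall>w. w \<notin> \<Omega> \<longrightarrow> \<phi> w = 0}"
      and "complex_of_real (b (S \<phi>)) = complex_of_real (b (S \<psi>))"
    then have eq: "S \<phi> = S \<psi>" using b by (simp add: inj_eq)
    show "\<phi> = \<psi>"
    proof
      fix w
      show "\<phi> w = \<psi> w"
      proof (cases "w \<in> \<Omega>")
        case True
        have "a (Re (\<phi> w)) = a (Re (\<psi> w))" "a (Im (\<phi> w)) = a (Im (\<psi> w))"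
          using mem[OF True, of _ \<phi>] mem[OF True, of _ \<psi>] eq by auto
        then show ?thesis using a by (simp add: inj_eq complex_eq_iff)
      qed (use p in auto)
    qed
  qed
  then show ?thesis by blast
qed

lemma mem_coset_iff: "x \<in> I +>\<^bsub>R\<^esub> q \<longleftrightarrow> (\<exists>i\<in>I. x = i \<oplus>\<^bsub>R\<^esub> q)"
  by (simp add: a_r_coset_def r_coset_def)

lemma game_ideal_carrier: "i \<in> game_ideal X rule \<Longrightarrow> i \<in> carrier (free_star_algebra (X \<times> X))"
  using additive_subgroup.a_subset[OF ideal.axioms(1)[OF ideal_game_ideal]] by blast

text \<open>A representation of the free algebra that is constant on the cosets of the ideal descends to the game algebra.\<close>

lemma game_algebra_hom_exists:
  fixes B :: "'b star_algebra" and X :: "'x set" and game_rule :: "'x \<Rightarrow> 'x \<Rightarrow> 'x \<Rightarrow> 'x \<Rightarrow> bool"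
  defines "A \<equiv> free_star_algebra (X \<times> X)" and "J \<equiv> game_ideal X game_rule"
  assumes closed: "\<And>p q. p \<in> carrier A \<Longrightarrow> q \<in> carrier A \<Longrightarrow> R p \<in> carrier B"
    and mult: "\<And>p q. p \<in> carrier A \<Longrightarrow> q \<in> carrier A \<Longrightarrow> R (p \<otimes>\<^bsub>A\<^esub> q) = R p \<otimes>\<^bsub>B\<^esub> R q"
    and add: "\<And>p q. p \<in> carrier A \<Longrightarrow> q \<in> carrier A \<Longrightarrow> R (p \<oplus>\<^bsub>A\<^esub> q) = R p \<oplus>\<^bsub>B\<^esub> R q"
    and smult: "\<And>p q c. p \<in> carrier A \<Longrightarrow> q \<in> carrier A \<Longrightarrow> R (c \<odot>\<^bsub>A\<^esub> p) = c \<odot>\<^bsub>B\<^esub> R p"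
    and star: "\<And>p q. p \<in> carrier A \<Longrightarrow> q \<in> carrier A \<Longrightarrow> R (star A p) = star B (R p)"
    and kernel: "\<And>i p. i \<in> J \<Longrightarrow> p \<in> carrier A \<Longrightarrow> R (i \<oplus>\<^bsub>A\<^esub> p) = R p"
    and one: "R \<one>\<^bsub>A\<^esub> = \<one>\<^bsub>B\<^esub>"
  shows "star_hom (game_algebra X game_rule) B \<noteq> {}"
proof -
  let ?Q = "game_algebra X game_rule"
  interpret J: ideal J A unfolding A_def J_def by (rule ideal_game_ideal)
  note m_cl = ring.ring_simprules(5)[OF J.ring_axioms] and a_cl = ring.ring_simprules(1)[OF J.ring_axioms]
  define h where "h = (\<lambda>K. R (SOME p. p \<in> K))"
  have h: "h (J +>\<^bsub>A\<^esub> p) = R p" if p: "p \<in> carrier A" for p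
  proof -
    have "(SOME q. q \<in> J +>\<^bsub>A\<^esub> p) \<in> J +>\<^bsub>A\<^esub> p"
      using someI[of "\<lambda>q. q \<in> J +>\<^bsub>A\<^esub> p" p, OF J.a_rcos_self[OF p]] .
    then obtain i where "i \<in> J" "(SOME q. q \<in> J +>\<^bsub>A\<^esub> p) = i \<oplus>\<^bsub>A\<^esub> p" unfolding mem_coset_iff by blast
    then show ?thesis using kernel p by (simp add: h_def)
  qed
  have Q: "carrier ?Q = a_rcosets\<^bsub>A\<^esub> J" "K \<otimes>\<^bsub>?Q\<^esub> L = rcoset_mult A J K L"
    "K \<oplus>\<^bsub>?Q\<^esub> L = K <+>\<^bsub>A\<^esub> L" "\<one>\<^bsub>?Q\<^esub> = J +>\<^bsub>A\<^esub> \<one>\<^bsub>A\<^esub>"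
    "c \<odot>\<^bsub>?Q\<^esub> K = (\<Union>x\<in>K. J +>\<^bsub>A\<^esub> (c \<odot>\<^bsub>A\<^esub> x))" "star ?Q K = (\<Union>x\<in>K. J +>\<^bsub>A\<^esub> star A x)" for K L c
    by (simp_all add: game_algebra_def quot_star_algebra_def FactRing_def game_ideal_def A_def J_def)
  have cosetE: "\<exists>p\<in>carrier A. K = J +>\<^bsub>A\<^esub> p" if "K \<in> carrier ?Q" for K
    using that unfolding Q A_RCOSETS_def' by blast
  have J_smult: "c \<odot>\<^bsub>A\<^esub> i \<in> J" and J_star: "star A i \<in> J" if "i \<in> J" for i c
    using that unfolding J_def A_def game_ideal_def gen_star_ideal_def by blast+
  have union: "(\<Union>x\<in>J +>\<^bsub>A\<^esub> p. J +>\<^bsub>A\<^esub> F x) = J +>\<^bsub>A\<^esub> F p"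
    if p: "p \<in> carrier A" and F: "\<And>x. x \<in> carrier A \<Longrightarrow> F x \<in> carrier A" "\<And>i. i \<in> J \<Longrightarrow> F i \<in> J"
      "\<And>x y. x \<in> carrier A \<Longrightarrow> y \<in> carrier A \<Longrightarrow> F (x \<oplus>\<^bsub>A\<^esub> y) = F x \<oplus>\<^bsub>A\<^esub> F y" for p F
  proof -
    have "J +>\<^bsub>A\<^esub> F x = J +>\<^bsub>A\<^esub> F p" if x: "x \<in> J +>\<^bsub>A\<^esub> p" for x
    proof -
      obtain i where i: "i \<in> J" "x = i \<oplus>\<^bsub>A\<^esub> p" using x unfolding mem_coset_iff by blast
      have "i \<in> carrier A" using i(1) J.a_subset by blast
      then have "F x = F i \<oplus>\<^bsub>A\<^esub> F p" using i(2) F(3) p by simp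
      then have "F x \<in> J +>\<^bsub>A\<^esub> F p" using F(2)[OF i(1)] unfolding mem_coset_iff by blast
      from J.a_repr_independence'[OF this F(1)[OF p]] show ?thesis by simp
    qed
    then show ?thesis using J.a_rcos_self[OF p] by blast
  qed
  have "h \<in> ring_hom ?Q B"
  proof (rule ring_hom_memI)
    fix K assume "K \<in> carrier ?Q"
    then obtain p where "p \<in> carrier A" "K = J +>\<^bsub>A\<^esub> p" using cosetE by blast
    then show "h K \<in> carrier B" using closed by (simp add: h)
  next
    fix K L assume "K \<in> carrier ?Q" "L \<in> carrier ?Q"
    then obtain p q where p: "p \<in> carrier A" "K = J +>\<^bsub>A\<^esub> p" and q: "q \<in> carrier A" "L = J +>\<^bsub>A\<^esub> q"
      using cosetE by metis
    show "h (K \<otimes>\<^bsub>?Q\<^esub> L) = h K \<otimes>\<^bsub>B\<^esub> h L"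
      unfolding p(2) q(2) Q J.rcoset_mult_add[OF p(1) q(1)] h[OF p(1)] h[OF q(1)] h[OF m_cl[OF p(1) q(1)]]
      by (rule mult[OF p(1) q(1)])
    show "h (K \<oplus>\<^bsub>?Q\<^esub> L) = h K \<oplus>\<^bsub>B\<^esub> h L"
      unfolding p(2) q(2) Q J.a_rcos_sum[OF p(1) q(1)] h[OF p(1)] h[OF q(1)] h[OF a_cl[OF p(1) q(1)]]
      by (rule add[OF p(1) q(1)])
  next
    show "h \<one>\<^bsub>?Q\<^esub> = \<one>\<^bsub>B\<^esub>" unfolding Q h[OF J.one_closed] by (rule one)
  qed
  moreover have "h (c \<odot>\<^bsub>?Q\<^esub> K) = c \<odot>\<^bsub>B\<^esub> h K" "h (star ?Q K) = star B (h K)" if K: "K \<in> carrier ?Q" for K c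
  proof -
    obtain p where p: "p \<in> carrier A" "K = J +>\<^bsub>A\<^esub> p" using cosetE[OF K] by blast
    have cp: "c \<odot>\<^bsub>A\<^esub> x \<in> carrier A" and sp: "star A x \<in> carrier A" if "x \<in> carrier A" for x c
      using that free_smult_closed free_star_closed unfolding A_def free_simps by blast+
    have dist: "c \<odot>\<^bsub>A\<^esub> (x \<oplus>\<^bsub>A\<^esub> y) = c \<odot>\<^bsub>A\<^esub> x \<oplus>\<^bsub>A\<^esub> c \<odot>\<^bsub>A\<^esub> y"
      "star A (x \<oplus>\<^bsub>A\<^esub> y) = star A x \<oplus>\<^bsub>A\<^esub> star A y" for x y
      unfolding A_def free_simps free_star by (simp_all add: distrib_left)
    have "c \<odot>\<^bsub>?Q\<^esub> K = J +>\<^bsub>A\<^esub> (c \<odot>\<^bsub>A\<^esub> p)"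
      unfolding p(2) Q by (rule union[OF p(1)]) (rule cp J_smult dist; assumption?)+
    then show "h (c \<odot>\<^bsub>?Q\<^esub> K) = c \<odot>\<^bsub>B\<^esub> h K"
      using h[OF cp[OF p(1)]] h[OF p(1)] smult[OF p(1) p(1)] p(2) by simp
    have "star ?Q K = J +>\<^bsub>A\<^esub> star A p"
      unfolding p(2) Q by (rule union[OF p(1)]) (rule sp J_star dist; assumption?)+
    then show "h (star ?Q K) = star B (h K)"
      using h[OF sp[OF p(1)]] h[OF p(1)] star[OF p(1) p(1)] p(2) by simp
  qed
  ultimately have "h \<in> star_hom ?Q B" by (simp add: star_hom_def)
  then show ?thesis by blast
qed

text \<open>A tracial state on the game algebra, given by its values on products of generators.\<close>

locale tracial_game_state =
  fixes X :: "'x set" and rule :: "'x \<Rightarrow> 'x \<Rightarrow> 'x \<Rightarrow> 'x \<Rightarrow> bool" and \<tau> :: "('x \<times> 'x) list \<Rightarrow> complex"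
  assumes finite_X: "finite X"
    and tau_psd: "finite C \<Longrightarrow> (\<Sum>w\<in>C. \<Sum>v\<in>C. cnj (c w) * \<tau> (rev w @ v) * c v) \<in> \<real>\<^sub>\<ge>\<^sub>0"
    and tau_Nil: "\<tau> [] = 1"
    and tau_trace: "\<tau> (a @ b) = \<tau> (b @ a)"
    and tau_game: "game_functional X rule UNIV \<tau>"
    and tau_supp: "\<not> set w \<subseteq> X \<times> X \<Longrightarrow> \<tau> w = 0"
begin

lemma tau_idem: "\<tau> (u @ l # l # v) = \<tau> (u @ l # v)"
proof (cases "l \<in> X \<times> X")
  case True
  then show ?thesis using tau_game by (auto simp: game_functional_def)
next
  case False
  then show ?thesis by (simp add: tau_supp)
qed

text \<open>The inner product of the words \<open>v\<close> and \<open>w\<close> is the trace of \<open>w\<^sup>*v\<close>. In the resulting space of functions, prepending a letter is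
  the action of left multiplication by a generator, and appending one that of right multiplication.\<close>

sublocale positive_kernel "\<lambda>w v. \<tau> (rev w @ v)"
  by standard (rule tau_psd)

lemma tau_herm: "\<tau> (rev w) = cnj (\<tau> w)"
  using K_herm[of w "[]"] by simp

lemma left_sym: "\<tau> (rev (l # w) @ v) = \<tau> (rev w @ (l # v))" by simp

lemma left_idem: "\<tau> (rev (l # l # w) @ v) = \<tau> (rev (l # w) @ v)"
  using tau_idem[of "rev w" l v] by simp

lemma right_sym: "\<tau> (rev (w @ [l]) @ v) = \<tau> (rev w @ (v @ [l]))"
  using tau_trace[of "[l]" "rev w @ v"] by simp

lemma right_idem: "\<tau> (rev ((w @ [l]) @ [l]) @ v) = \<tau> (rev (w @ [l]) @ v)"
  using tau_idem[of "[]" l "rev w @ v"] by simp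

lemmas left_op = pullback_in_rkhs[of "Cons l" for l, OF left_sym left_idem]
  pullback_symmetric[of "Cons l" for l, OF left_sym left_idem]
  pullback_idem[of "Cons l" for l, OF left_sym left_idem]
  pullback_contraction[of "Cons l" for l, OF left_sym left_idem]

lemmas right_op = pullback_in_rkhs[of "\<lambda>w. w @ [l]" for l, OF right_sym right_idem]
  pullback_symmetric[of "\<lambda>w. w @ [l]" for l, OF right_sym right_idem]
  pullback_idem[of "\<lambda>w. w @ [l]" for l, OF right_sym right_idem]
  pullback_contraction[of "\<lambda>w. w @ [l]" for l, OF right_sym right_idem]

lemma rkhs_supp:
  assumes "\<phi> \<in> rkhs" "\<not> set w \<subseteq> X \<times> X"
  shows "\<phi> w = 0"
  using rkhs_relation[where A = "{()}" and c = "\<lambda>_. 1" and g = "\<lambda>_. w" and \<phi> = \<phi>]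
    assms tau_supp[of "rev w @ _"] by simp

lemma rkhs_sum:
  assumes P: "\<phi> \<in> rkhs" and x: "x \<in> X"
  shows "(\<Sum>a\<in>X. \<phi> ((x, a) # w)) = \<phi> w" "(\<Sum>a\<in>X. \<phi> (w @ [(x, a)])) = \<phi> w"
proof -
  have fin: "finite (Some ` X)" using finite_X by simp
  have rel: "(\<Sum>z\<in>insert None (Some ` X). (if z = None then -1 else 1) * F (case z of None \<Rightarrow> w | Some a \<Rightarrow> g a)) =
      (\<Sum>a\<in>X. F (g a)) - F w" for F :: "('x \<times> 'x) list \<Rightarrow> complex" and g
    using finite_X by (simp add: sum.reindex)
  have 1: "(\<Sum>a\<in>X. \<tau> (rev ((x, a) # w) @ v)) - \<tau> (rev w @ v) = 0" for v
    using tau_game x by (simp add: game_functional_def)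
  show "(\<Sum>a\<in>X. \<phi> ((x, a) # w)) = \<phi> w"
    using rkhs_relation[where A = "insert None (Some ` X)" and c = "\<lambda>z. if z = None then -1 else 1"
        and g = "\<lambda>z. case z of None \<Rightarrow> w | Some a \<Rightarrow> (x, a) # w" and \<phi> = \<phi>, OF _ P]
    unfolding rel 1 rel[of "\<lambda>w. \<tau> (rev w @ _)"] by simp
  have 2: "(\<Sum>a\<in>X. \<tau> (rev (w @ [(x, a)]) @ v)) - \<tau> (rev w @ v) = 0" for v
  proof -
    have "(\<Sum>a\<in>X. \<tau> ([] @ (x, a) # (rev w @ v))) = \<tau> ([] @ (rev w @ v))"
      using tau_game x unfolding game_functional_def by blast
    then show ?thesis by simp
  qed
  show "(\<Sum>a\<in>X. \<phi> (w @ [(x, a)])) = \<phi> w"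
    using rkhs_relation[where A = "insert None (Some ` X)" and c = "\<lambda>z. if z = None then -1 else 1"
        and g = "\<lambda>z. case z of None \<Rightarrow> w | Some a \<Rightarrow> w @ [(x, a)]" and \<phi> = \<phi>, OF _ P]
    unfolding rel 2 rel[of "\<lambda>w. \<tau> (rev w @ _)"] by simp
qed

text \<open>The vector of the trace, that is, the element 1 of the algebra.\<close>

definition vacuum :: "('x \<times> 'x) list \<Rightarrow> complex" where "vacuum = ev (unit_coeff [])"

lemma vacuum_in: "vacuum \<in> rkhs"
  unfolding vacuum_def by (rule ev_in_rkhs[OF unit_coeff_fin_supp])

lemma vacuum_apply: "vacuum w = \<tau> (rev w)"
  by (simp add: vacuum_def ev_def lin_unit_coeff)

lemma ip_vacuum: "\<phi> \<in> rkhs \<Longrightarrow> ipH \<phi> vacuum = \<phi> []"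
  unfolding vacuum_def by (rule reproducing)

lemma nrm_vacuum: "H.nrm vacuum = 1"
  by (simp add: H.nrm_def ip_vacuum[OF vacuum_in] vacuum_apply tau_Nil)

text \<open>The action of the product of the letters of \<open>u\<close>; the word is reversed because composition with maps is contravariant.\<close>

definition word_op :: "('x \<times> 'x) list \<Rightarrow> (('x \<times> 'x) list \<Rightarrow> complex) \<Rightarrow> ('x \<times> 'x) list \<Rightarrow> complex" where
  "word_op u \<phi> = (\<lambda>w. \<phi> (rev u @ w))"

lemma word_op_Cons: "word_op (l # u) \<phi> = (\<lambda>w. word_op u \<phi> (l # w))"
  by (simp add: word_op_def)

lemma word_op_in: "\<phi> \<in> rkhs \<Longrightarrow> word_op u \<phi> \<in> rkhs \<and> H.nrm (word_op u \<phi>) \<le> H.nrm \<phi>"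
proof (induction u)
  case Nil
  then show ?case by (simp add: word_op_def)
next
  case (Cons l u)
  then show ?case unfolding word_op_Cons
    using left_op(1)[of "word_op u \<phi>" l] left_op(4)[of "word_op u \<phi>" l] by linarith
qed

lemma word_op_adjoint:
  "\<phi> \<in> rkhs \<Longrightarrow> \<psi> \<in> rkhs \<Longrightarrow> ipH (word_op u \<phi>) \<psi> = ipH \<phi> (word_op (rev u) \<psi>)"
proof (induction u arbitrary: \<psi>)
  case Nil
  then show ?case by (simp add: word_op_def)
next
  case (Cons l u)
  have u: "word_op u \<phi> \<in> rkhs" using word_op_in[OF Cons.prems(1)] by blast
  have l: "(\<lambda>w. \<psi> (l # w)) \<in> rkhs" by (rule left_op(1)[OF Cons.prems(2)])
  have "ipH (word_op (l # u) \<phi>) \<psi> = ipH (word_op u \<phi>) (\<lambda>w. \<psi> (l # w))"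
    unfolding word_op_Cons by (rule left_op(2)[OF u Cons.prems(2)])
  also have "\<dots> = ipH \<phi> (word_op (rev u) (\<lambda>w. \<psi> (l # w)))" by (rule Cons.IH[OF Cons.prems(1) l])
  also have "word_op (rev u) (\<lambda>w. \<psi> (l # w)) = word_op (rev (l # u)) \<psi>" by (simp add: word_op_def)
  finally show ?case .
qed

definition rep :: "((('x \<times> 'x) \<times> bool) list \<Rightarrow> complex) \<Rightarrow> (('x \<times> 'x) list \<Rightarrow> complex) \<Rightarrow> ('x \<times> 'x) list \<Rightarrow> complex" where
  "rep p \<phi> = (\<lambda>w. lin p (\<lambda>u. word_op (map fst u) \<phi> w))"

lemma rep_sum: "rep p \<phi> = (\<lambda>w. \<Sum>u | p u \<noteq> 0. p u * word_op (map fst u) \<phi> w)"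
  by (simp add: rep_def lin_def)

lemma rep_mult:
  assumes "p \<in> carrier (free_star_algebra G)" "q \<in> carrier (free_star_algebra G)"
  shows "rep (p \<otimes>\<^bsub>free_star_algebra G\<^esub> q) \<phi> = rep p (rep q \<phi>)"
  by (simp add: rep_def lin_mult[OF assms] word_op_def)

lemma rep_add: "p \<in> fin_supp \<Longrightarrow> q \<in> fin_supp \<Longrightarrow> rep (\<lambda>u. p u + q u) \<phi> = (\<lambda>w. rep p \<phi> w + rep q \<phi> w)"
  by (simp add: rep_def lin_add)

lemma rep_smult: "p \<in> fin_supp \<Longrightarrow> rep (\<lambda>u. c * p u) \<phi> = (\<lambda>w. c * rep p \<phi> w)"
  by (simp add: rep_def lin_scale)

lemma rep_one: "rep (unit_coeff []) \<phi> = \<phi>"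
  by (simp add: rep_def lin_unit_coeff word_op_def)

lemma rep_adjoint:
  assumes p: "p \<in> carrier (free_star_algebra G)" and P: "\<phi> \<in> rkhs" and Q: "\<psi> \<in> rkhs"
  shows "ipH (rep p \<phi>) \<psi> = ipH \<phi> (rep (star (free_star_algebra G) p) \<psi>)"
proof -
  let ?A = "{u. p u \<noteq> 0}"
  have fin: "finite ?A" using free_fin_supp[OF p] by (simp add: fin_supp_def)
  have wp: "word_op u \<phi> \<in> rkhs" and wq: "word_op u \<psi> \<in> rkhs" for u
    using word_op_in P Q by blast+
  have star: "rep (star (free_star_algebra G) p) \<psi> = (\<lambda>w. \<Sum>u\<in>?A. cnj (p u) * word_op (rev (map fst u)) \<psi> w)"
    by (simp add: rep_def lin_star map_fst_flip) (simp add: lin_def)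
  have "ipH (rep p \<phi>) \<psi> = (\<Sum>u\<in>?A. p u * ipH (word_op (map fst u) \<phi>) \<psi>)"
    unfolding rep_sum using H.ip_sum[OF Q wp fin] by blast
  also have "\<dots> = (\<Sum>u\<in>?A. p u * ipH \<phi> (word_op (rev (map fst u)) \<psi>))"
    by (simp add: word_op_adjoint P Q)
  also have "\<dots> = cnj (\<Sum>u\<in>?A. cnj (p u) * ipH (word_op (rev (map fst u)) \<psi>) \<phi>)"
    using H.ip_herm[OF P wq] by simp
  also have "\<dots> = cnj (ipH (rep (star (free_star_algebra G) p) \<psi>) \<phi>)"
    unfolding star using H.ip_sum[OF P wq fin] by simp
  also have "\<dots> = ipH \<phi> (rep (star (free_star_algebra G) p) \<psi>)"
  proof -
    have "rep (star (free_star_algebra G) p) \<psi> \<in> rkhs"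
      unfolding star by (rule conjunct1[OF H.ip_sum[OF P wq fin]])
    from H.ip_herm[OF P this] show ?thesis by simp
  qed
  finally show ?thesis .
qed

text \<open>The ideal of relations lies in the kernel of the trace, which by \<open>rkhs_relation\<close> acts as 0.\<close>

lemma rep_kernel:
  assumes p: "p \<in> game_ideal X rule" and P: "\<phi> \<in> rkhs"
  shows "rep p \<phi> = (\<lambda>_. 0)"
proof
  fix w
  have k: "lin p (\<lambda>u. \<tau> (a @ map fst u @ b)) = 0" for a b
    using subsetD[OF game_ideal_in_kernel[OF finite_X tau_game tau_herm] p] by (simp add: functional_kernel_def)
  show "rep p \<phi> w = 0"
    unfolding rep_sum word_op_def
  proof (rule rkhs_relation[OF _ P])
    show "(\<Sum>u | p u \<noteq> 0. p u * \<tau> (rev (rev (map fst u) @ w) @ v)) = 0" for v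
      using k[of "rev w" v] by (simp add: lin_def)
  qed
qed

end

locale encoded_game_state = tracial_game_state +
  fixes enc :: "(('a \<times> 'a) list \<Rightarrow> complex) \<Rightarrow> 'h"
  assumes enc_inj: "inj_on enc rkhs"
begin

sublocale E: encoded_space rkhs ipH enc
proof
  show "(\<lambda>_. 0) \<in> rkhs" using H.scale_closed[OF vacuum_in, of 0] by simp
  show "\<exists>f\<in>rkhs. (\<lambda>k. H.nrm (\<lambda>w. F k w - f w)) \<longlonglongrightarrow> 0"
    if "\<And>k. F k \<in> rkhs" "\<And>e. 0 < e \<Longrightarrow> \<exists>N. \<forall>m\<ge>N. \<forall>n\<ge>N. H.nrm (\<lambda>w. F m w - F n w) < e" for F
    using rkhs_complete[OF that] .
qed (use enc_inj nrmH_eq_0 in auto)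

lemma left_bounded: "E.bounded_on (\<lambda>\<phi> w. \<phi> (l # w))"
  unfolding E.bounded_on_def using left_op(1)[of _ l] left_op(4)[of _ l] by (auto intro!: exI[of _ 1])

lemma right_bounded: "E.bounded_on (\<lambda>\<phi> w. \<phi> (w @ [l]))"
  unfolding E.bounded_on_def using right_op(1)[of _ l] right_op(4)[of _ l] by (auto intro!: exI[of _ 1])

lemma word_op_bounded: "E.bounded_on (word_op u)"
  unfolding E.bounded_on_def using word_op_in by (auto intro!: exI[of _ 1]) (simp_all add: word_op_def)

lemma rep_bounded: "p \<in> fin_supp \<Longrightarrow> E.bounded_on (rep p)"
proof -
  assume p: "p \<in> fin_supp"
  have "E.bounded_on (\<lambda>\<phi> w. \<Sum>u | p u \<noteq> 0. p u * word_op (map fst u) \<phi> w)"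
    by (intro E.bounded_on_sum E.bounded_on_scale word_op_bounded) (use p in \<open>simp add: fin_supp_def\<close>)
  then show ?thesis by (simp add: rep_sum[abs_def])
qed

text \<open>Alice measures by left and Bob by right multiplication; the correlation at the vacuum vector is the trace of the product of
  two generators.\<close>

lemma qc_strategy: "perfect_qc_strategy TYPE('h) X rule"
proof -
  define P where "P = (\<lambda>x a. E.op_of (\<lambda>\<phi> w. \<phi> ((x, a) # w)))"
  define Q where "Q = (\<lambda>y b. E.op_of (\<lambda>\<phi> w. \<phi> (w @ [(y, b)])))"
  have povmP: "povm E.EH X (P x)" if x: "x \<in> X" for x
    unfolding povm_def
  proof (intro conjI ballI)
    show "positive_op E.EH (P x a)" for a
      unfolding P_def by (rule E.op_of_positive[OF left_bounded left_op(2)]) (auto simp: left_op(3))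
    have "(\<Oplus>\<^bsub>op_algebra E.EH\<^esub>a\<in>X. P x a) = E.op_of (\<lambda>\<phi> w. \<Sum>a\<in>X. \<phi> ((x, a) # w))"
      unfolding P_def by (rule E.finsum_op_of[OF finite_X left_bounded])
    also have "\<dots> = \<one>\<^bsub>op_algebra E.EH\<^esub>"
      unfolding E.op_of_one by (rule E.op_of_cong) (simp add: rkhs_sum(1) x)
    finally show "(\<Oplus>\<^bsub>op_algebra E.EH\<^esub>a\<in>X. P x a) = \<one>\<^bsub>op_algebra E.EH\<^esub>" .
  qed
  have povmQ: "povm E.EH X (Q x)" if x: "x \<in> X" for x
    unfolding povm_def
  proof (intro conjI ballI)
    show "positive_op E.EH (Q x a)" for a
      unfolding Q_def by (rule E.op_of_positive[OF right_bounded right_op(2)])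
        (use right_op(3) in \<open>auto simp del: append_assoc\<close>)
    have "(\<Oplus>\<^bsub>op_algebra E.EH\<^esub>a\<in>X. Q x a) = E.op_of (\<lambda>\<phi> w. \<Sum>a\<in>X. \<phi> (w @ [(x, a)]))"
      unfolding Q_def by (rule E.finsum_op_of[OF finite_X right_bounded])
    also have "\<dots> = \<one>\<^bsub>op_algebra E.EH\<^esub>"
      unfolding E.op_of_one by (rule E.op_of_cong) (simp add: rkhs_sum(2) x)
    finally show "(\<Oplus>\<^bsub>op_algebra E.EH\<^esub>a\<in>X. Q x a) = \<one>\<^bsub>op_algebra E.EH\<^esub>" .
  qed
  have PQ: "P x a \<otimes>\<^bsub>op_algebra E.EH\<^esub> Q y b = E.op_of (\<lambda>\<phi> w. \<phi> ((x, a) # w @ [(y, b)]))" for x a y b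
    unfolding P_def Q_def E.op_of_mult[OF right_bounded] by simp
  have QP: "Q y b \<otimes>\<^bsub>op_algebra E.EH\<^esub> P x a = E.op_of (\<lambda>\<phi> w. \<phi> ((x, a) # w @ [(y, b)]))" for x a y b
    unfolding P_def Q_def E.op_of_mult[OF left_bounded] by simp
  have v: "enc vacuum \<in> carrier E.EH" by (simp add: E.EH_simps vacuum_in)
  have zero: "cinner E.EH ((P x a \<otimes>\<^bsub>op_algebra E.EH\<^esub> Q y b) (enc vacuum)) (enc vacuum) = 0"
    if "x \<in> X" "y \<in> X" "a \<in> X" "b \<in> X" "\<not> rule x y a b" for x y a b
  proof -
    have in': "(\<lambda>w. vacuum ((x, a) # w @ [(y, b)])) \<in> rkhs"
      using right_op(1)[OF left_op(1)[OF vacuum_in], of "(x, a)" "(y, b)"] by simp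
    have "cinner E.EH ((P x a \<otimes>\<^bsub>op_algebra E.EH\<^esub> Q y b) (enc vacuum)) (enc vacuum) =
        ipH (\<lambda>w. vacuum ((x, a) # w @ [(y, b)])) vacuum"
      unfolding PQ by (simp add: E.op_of_apply[OF v]) (simp add: E.EH_simps vacuum_in in')
    also have "\<dots> = \<tau> ([(y, b)] @ [(x, a)])" unfolding ip_vacuum[OF in'] by (simp add: vacuum_apply)
    also have "\<dots> = \<tau> ([] @ (x, a) # (y, b) # [])" using tau_trace[of "[(y, b)]" "[(x, a)]"] by simp
    also have "\<dots> = 0" using tau_game that unfolding game_functional_def by blast
    finally show ?thesis .
  qed
  have norm: "hnorm E.EH (enc vacuum) = 1"
    by (simp add: E.EH_simps vacuum_in nrm_vacuum)
  show ?thesis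
    unfolding perfect_qc_strategy_def
    by (rule exI[of _ E.EH], rule exI[of _ "enc vacuum"], rule exI[of _ P], rule exI[of _ Q])
       (use E.hilbert_space_EH v norm povmP povmQ zero in \<open>auto simp: PQ QP\<close>)
qed

lemma nonzero_space: "carrier E.EH \<noteq> {\<zero>\<^bsub>E.EH\<^esub>}"
proof
  assume "carrier E.EH = {\<zero>\<^bsub>E.EH\<^esub>}"
  then have "enc vacuum = enc (\<lambda>_. 0)" using vacuum_in by (auto simp: E.EH_simps)
  then have "vacuum = (\<lambda>_. 0)" by (simp add: E.enc_eq_iff vacuum_in E.zero_in)
  then show False using vacuum_apply[of "[]"] by (simp add: tau_Nil)
qed

lemma star_representation: "star_hom (game_algebra X rule) (op_algebra E.EH) \<noteq> {}"
proof (rule game_algebra_hom_exists[where R = "\<lambda>p. E.op_of (rep p)"])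
  fix p q assume p: "p \<in> carrier (free_star_algebra (X \<times> X))" and q: "q \<in> carrier (free_star_algebra (X \<times> X))"
  note fp = free_fin_supp[OF p] and fq = free_fin_supp[OF q]
  note bp = rep_bounded[OF fp] and bq = rep_bounded[OF fq]
  show "E.op_of (rep p) \<in> carrier (op_algebra E.EH)"
    using E.op_of_bounded[OF bp] by (simp add: op_algebra_def)
  show "E.op_of (rep (p \<otimes>\<^bsub>free_star_algebra (X \<times> X)\<^esub> q)) =
      E.op_of (rep p) \<otimes>\<^bsub>op_algebra E.EH\<^esub> E.op_of (rep q)"
    unfolding E.op_of_mult[OF bq] by (rule E.op_of_cong) (rule rep_mult[OF p q])
  show "E.op_of (rep (p \<oplus>\<^bsub>free_star_algebra (X \<times> X)\<^esub> q)) =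
      E.op_of (rep p) \<oplus>\<^bsub>op_algebra E.EH\<^esub> E.op_of (rep q)"
    unfolding E.op_of_add[OF bp bq] free_simps by (rule E.op_of_cong) (rule rep_add[OF fp fq])
  show "E.op_of (rep (c \<odot>\<^bsub>free_star_algebra (X \<times> X)\<^esub> p)) = c \<odot>\<^bsub>op_algebra E.EH\<^esub> E.op_of (rep p)" for c
    unfolding E.op_of_smult[OF bp] free_simps by (rule E.op_of_cong) (rule rep_smult[OF fp])
  show "E.op_of (rep (star (free_star_algebra (X \<times> X)) p)) = star (op_algebra E.EH) (E.op_of (rep p))"
    by (rule E.op_of_star[OF bp rep_bounded[OF free_fin_supp[OF free_star_closed[OF p]]] rep_adjoint[OF p], symmetric])
next
  fix i p assume i: "i \<in> game_ideal X rule" and p: "p \<in> carrier (free_star_algebra (X \<times> X))"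
  have "i \<in> carrier (free_star_algebra (X \<times> X))" using i by (rule game_ideal_carrier)
  note fi = free_fin_supp[OF this] and fp = free_fin_supp[OF p]
  show "E.op_of (rep (i \<oplus>\<^bsub>free_star_algebra (X \<times> X)\<^esub> p)) = E.op_of (rep p)"
    unfolding free_simps by (rule E.op_of_cong) (simp add: rep_add[OF fi fp] rep_kernel[OF i])
next
  show "E.op_of (rep \<one>\<^bsub>free_star_algebra (X \<times> X)\<^esub>) = \<one>\<^bsub>op_algebra E.EH\<^esub>"
    unfolding E.op_of_one free_one by (rule E.op_of_cong) (rule rep_one)
qed

end

lemma (in tracial_game_state) realisations:
  assumes "\<exists>f :: complex \<Rightarrow> 'h. inj f"
  shows "perfect_qc_strategy TYPE('h) X rule"
    and "\<exists>H :: 'h hilbert. hilbert_space H \<and> carrier H \<noteq> {\<zero>\<^bsub>H\<^esub>} \<and>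
      star_hom (game_algebra X rule) (op_algebra H) \<noteq> {}"
proof -
  obtain f :: "complex \<Rightarrow> 'h" where f: "inj f" using assms by blast
  have "countable (lists (X \<times> X))" using finite_X by (intro countable_lists countable_finite) simp
  from countable_functions_embed[OF this] obtain e :: "(('x \<times> 'x) list \<Rightarrow> complex) \<Rightarrow> complex"
    where e: "inj_on e {\<phi>. \<forall>w. w \<notin> lists (X \<times> X) \<longrightarrow> \<phi> w = 0}" by blast
  have "rkhs \<subseteq> {\<phi>. \<forall>w. w \<notin> lists (X \<times> X) \<longrightarrow> \<phi> w = 0}"
    using rkhs_supp by (auto simp: in_lists_conv_set)
  then have "inj_on e rkhs" by (rule inj_on_subset[OF e])
  then have inj: "inj_on (\<lambda>\<phi>. f (e \<phi>)) rkhs" using f by (auto simp: inj_on_def)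
  interpret encoded_game_state X rule \<tau> "\<lambda>\<phi>. f (e \<phi>)" by standard (rule inj)
  show "perfect_qc_strategy TYPE('h) X rule" by (rule qc_strategy)
  show "\<exists>H :: 'h hilbert. hilbert_space H \<and> carrier H \<noteq> {\<zero>\<^bsub>H\<^esub>} \<and>
      star_hom (game_algebra X rule) (op_algebra H) \<noteq> {}"
    using E.hilbert_space_EH nonzero_space star_representation by blast
qed

section \<open>From perfect strategies to functionals\<close>

context hilbert_space
begin

definition linear_op :: "('h \<Rightarrow> 'h) \<Rightarrow> bool" where
  "linear_op T \<longleftrightarrow> (\<forall>v\<in>carrier H. T v \<in> carrier H) \<and>
     (\<forall>v\<in>carrier H. \<forall>w\<in>carrier H. T (v \<oplus> w) = T v \<oplus> T w) \<and> (\<forall>c. \<forall>v\<in>carrier H. T (c \<odot> v) = c \<odot> T v)"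

lemma linear_opD:
  assumes "linear_op T"
  shows "v \<in> carrier H \<Longrightarrow> T v \<in> carrier H"
    and "v \<in> carrier H \<Longrightarrow> w \<in> carrier H \<Longrightarrow> T (v \<oplus> w) = T v \<oplus> T w"
    and "v \<in> carrier H \<Longrightarrow> T (c \<odot> v) = c \<odot> T v"
  using assms by (simp_all add: linear_op_def)

lemma linear_op_zero: "linear_op T \<Longrightarrow> T \<zero> = \<zero>"
  using linear_opD(3)[of T \<zero> 0] smult_l_null linear_opD(1)[of T \<zero>] by simp

lemma linear_op_diff:
  assumes T: "linear_op T" and v: "v \<in> carrier H" and w: "w \<in> carrier H"
  shows "T (v \<ominus> w) = T v \<ominus> T w"
  using linear_opD(2)[OF T v smult_closed'[OF w], of "-1"] linear_opD(3)[OF T w, of "-1"]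
    smult_neg_one[OF w] smult_neg_one[OF linear_opD(1)[OF T w]] by (simp add: minus_eq)

lemma bounded_linear_op: "T \<in> bounded_ops H \<Longrightarrow> linear_op T"
  unfolding linear_op_def using bounded_opsD(1,2,3)[of T H] by blast

text \<open>Polarisation: the form \<open>\<langle>T v, w\<rangle>\<close> is Hermitian because it is real on the diagonal.\<close>

lemma positive_symmetric:
  assumes T: "linear_op T" and pos: "\<And>v. v \<in> carrier H \<Longrightarrow> cinner H (T v) v \<in> \<real>\<^sub>\<ge>\<^sub>0"
    and v: "v \<in> carrier H" and w: "w \<in> carrier H"
  shows "cinner H (T v) w = cinner H v (T w)"
proof -
  note cl = linear_opD(1)[OF T]
  have im: "Im (cinner H (T u) u) = 0" if "u \<in> carrier H" for u
    using pos[OF that] by (simp add: complex_nonneg_Reals_iff)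
  have "Im (cinner H (T (v \<oplus> w)) (v \<oplus> w)) = 0" by (intro im a_closed v w)
  then have 1: "Im (cinner H (T v) w) + Im (cinner H (T w) v) = 0"
    by (simp add: linear_opD[OF T] v w cl cinner_add_left cinner_add_right im)
  have "Im (cinner H (T (v \<oplus> \<i> \<odot> w)) (v \<oplus> \<i> \<odot> w)) = 0" by (intro im a_closed v smult_closed' w)
  then have 2: "Re (cinner H (T w) v) - Re (cinner H (T v) w) = 0"
    by (simp add: linear_opD[OF T] v w cl cinner_add_left cinner_add_right cinner_smult_left cinner_smult_right im)
  have "cinner H (T v) w = cnj (cinner H (T w) v)" using 1 2 by (simp add: complex_eq_iff)
  also have "\<dots> = cinner H v (T w)" using cinner_commute[OF v cl[OF w]] by simp
  finally show ?thesis .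
qed

text \<open>With \<open>w = T v\<close>, the quadratic form is \<open>- 2 t \<parallel>w\<parallel>\<^sup>2 + t\<^sup>2 \<langle>T w, w\<rangle>\<close> at \<open>v - t w\<close>, which is negative for small \<open>t > 0\<close> unless \<open>w = 0\<close>.\<close>

lemma positive_null_vector:
  assumes T: "linear_op T" and pos: "\<And>v. v \<in> carrier H \<Longrightarrow> cinner H (T v) v \<in> \<real>\<^sub>\<ge>\<^sub>0"
    and v: "v \<in> carrier H" and null: "cinner H (T v) v = 0"
  shows "T v = \<zero>"
proof -
  define w where "w = T v"
  define n where "n = Re (cinner H w w)"
  define c where "c = Re (cinner H (T w) w)"
  have w: "w \<in> carrier H" using linear_opD(1)[OF T v] by (simp add: w_def)
  note tw = linear_opD(1)[OF T w]
  have nn: "cinner H w w = of_real n" using cinner_self_real[OF w] by (simp add: n_def)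
  have cc: "0 \<le> c" using pos[OF w] by (simp add: complex_nonneg_Reals_iff c_def)
  define t where "t = n / (c + 1)"
  have "cinner H (T w) v = cinner H w w" using positive_symmetric[OF T pos w v] by (simp add: w_def)
  then have "Re (cinner H (T (v \<oplus> of_real (- t) \<odot> w)) (v \<oplus> of_real (- t) \<odot> w)) = - 2 * t * n + t\<^sup>2 * c"
    using v w tw null
    by (simp add: linear_opD[OF T] cinner_add_left cinner_add_right cinner_smult_left cinner_smult_right
        w_def[symmetric] nn power2_eq_square c_def) (simp add: algebra_simps)
  moreover have "0 \<le> Re (cinner H (T (v \<oplus> of_real (- t) \<odot> w)) (v \<oplus> of_real (- t) \<odot> w))"
    using pos[of "v \<oplus> of_real (- t) \<odot> w"] v w by (simp add: complex_nonneg_Reals_iff)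
  moreover have n: "n = t * (c + 1)" using cc by (simp add: t_def)
  moreover have "- 2 * t * (t * (c + 1)) + t\<^sup>2 * c = - (t\<^sup>2 * (c + 2))"
    by (simp add: power2_eq_square algebra_simps)
  ultimately have "t\<^sup>2 * (c + 2) \<le> 0" by simp
  then have "t = 0" using cc by (simp add: mult_le_0_iff)
  then have "n = 0" using n by simp
  then show ?thesis using cinner_eq_zero[OF w] nn by (simp add: w_def)
qed

end

locale qc_strategy = hilbert_space H for H :: "'h hilbert" (structure) +
  fixes X :: "'x set" and rule :: "'x \<Rightarrow> 'x \<Rightarrow> 'x \<Rightarrow> 'x \<Rightarrow> bool" and \<xi> :: 'h
    and P Q :: "'x \<Rightarrow> 'x \<Rightarrow> 'h \<Rightarrow> 'h"
  assumes finite_X: "finite X"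
    and synchronous: "\<lbrakk>x \<in> X; a \<in> X; b \<in> X; a \<noteq> b\<rbrakk> \<Longrightarrow> \<not> rule x x a b"
    and xi: "\<xi> \<in> carrier H" "hnorm H \<xi> = 1"
    and povm_P: "x \<in> X \<Longrightarrow> povm H X (P x)" and povm_Q: "x \<in> X \<Longrightarrow> povm H X (Q x)"
    and commute_ops: "\<lbrakk>x \<in> X; y \<in> X; a \<in> X; b \<in> X\<rbrakk> \<Longrightarrow>
      P x a \<otimes>\<^bsub>op_algebra H\<^esub> Q y b = Q y b \<otimes>\<^bsub>op_algebra H\<^esub> P x a"
    and perfect: "\<lbrakk>x \<in> X; y \<in> X; a \<in> X; b \<in> X; \<not> rule x y a b\<rbrakk> \<Longrightarrow>
      cinner H ((P x a \<otimes>\<^bsub>op_algebra H\<^esub> Q y b) \<xi>) \<xi> = 0"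
begin

lemma xi_inner: "cinner H \<xi> \<xi> = 1"
  using cinner_self_real[OF xi(1)] xi(2) by simp

lemma povm_facts:
  assumes E: "povm H X E" and a: "a \<in> X"
  shows "linear_op (E a)" and "\<And>v. v \<in> carrier H \<Longrightarrow> cinner H (E a v) v \<in> \<real>\<^sub>\<ge>\<^sub>0"
    and "\<And>v w. v \<in> carrier H \<Longrightarrow> w \<in> carrier H \<Longrightarrow> cinner H (E a v) w = cinner H v (E a w)"
proof -
  have pos: "positive_op H (E a)" using E a by (simp add: povm_def)
  show l: "linear_op (E a)" using pos bounded_linear_op by (simp add: positive_op_def)
  show p: "\<And>v. v \<in> carrier H \<Longrightarrow> cinner H (E a v) v \<in> \<real>\<^sub>\<ge>\<^sub>0" using pos by (simp add: positive_op_def)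
  show "\<And>v w. v \<in> carrier H \<Longrightarrow> w \<in> carrier H \<Longrightarrow> cinner H (E a v) w = cinner H v (E a w)"
    by (rule positive_symmetric[OF l p])
qed

lemma povm_sum:
  assumes E: "povm H X E" and v: "v \<in> carrier H" and w: "w \<in> carrier H"
  shows "(\<Sum>a\<in>X. cinner H (E a v) w) = cinner H v w"
proof -
  have b: "E a \<in> bounded_ops H" if "a \<in> X" for a using E that by (simp add: povm_def positive_op_def)
  have "(\<Oplus>a\<in>X. E a v) = (\<Oplus>\<^bsub>op_algebra H\<^esub>a\<in>X. E a) v" by (rule finsum_op_apply[OF finite_X b v, symmetric])
  also have "\<dots> = v" using E v by (simp add: povm_def op_algebra_simps)
  finally have "(\<Oplus>a\<in>X. E a v) = v" .
  moreover have "cinner H (\<Oplus>a\<in>X. E a v) w = (\<Sum>a\<in>X. cinner H (E a v) w)"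
    by (rule cinner_finsum_left[OF finite_X _ w]) (rule bounded_opsD(1)[OF b v])
  ultimately show ?thesis by simp
qed

lemma povm_le:
  assumes E: "povm H X E" and a: "a \<in> X" and v: "v \<in> carrier H"
  shows "Re (cinner H (E a v) v) \<le> Re (cinner H v v)"
proof -
  have "Re (cinner H (E a v) v) \<le> (\<Sum>b\<in>X. Re (cinner H (E b v) v))"
    using povm_facts(2)[OF E _ v] by (intro member_le_sum a finite_X) (auto simp: complex_nonneg_Reals_iff)
  also have "\<dots> = Re (cinner H v v)" using povm_sum[OF E v v] by (metis Re_sum)
  finally show ?thesis .
qed

text \<open>The operator \<open>E - E\<^sup>2\<close> is the sum of the positive operators \<open>E (1 - E) E\<close> and \<open>(1 - E) E (1 - E)\<close>.\<close>

lemma povm_square_le: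
  assumes E: "povm H X E" and a: "a \<in> X" and v: "v \<in> carrier H"
  shows "Re (cinner H (E a v) (E a v)) \<le> Re (cinner H (E a v) v)"
proof -
  note l = povm_facts(1)[OF E a] and sym = povm_facts(3)[OF E a]
  have e: "E a v \<in> carrier H" "E a (E a v) \<in> carrier H" using linear_opD(1)[OF l] v by auto
  have d: "v \<ominus> E a v \<in> carrier H" using v e by simp
  have 1: "Re (cinner H (E a (E a v)) (E a v)) \<le> Re (cinner H (E a v) (E a v))"
    by (rule povm_le[OF E a e(1)])
  have "0 \<le> Re (cinner H (E a (v \<ominus> E a v)) (v \<ominus> E a v))"
    using povm_facts(2)[OF E a d] by (simp add: complex_nonneg_Reals_iff)
  also have "\<dots> = Re (cinner H (E a v) v) - 2 * Re (cinner H (E a v) (E a v)) + Re (cinner H (E a (E a v)) (E a v))"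
    using v e by (simp add: linear_op_diff[OF l] cinner_diff_left cinner_diff_right sym[OF e(1) v])
  finally show ?thesis using 1 by simp
qed

lemma povm_square_eq:
  assumes E: "povm H X E" and a: "a \<in> X" and v: "v \<in> carrier H"
    and eq: "Re (cinner H (E a v) (E a v)) = Re (cinner H (E a v) v)"
  shows "E a (E a v) = E a v"
proof -
  note l = povm_facts(1)[OF E a] and sym = povm_facts(3)[OF E a]
  note cl = linear_opD(1)[OF l]
  define D where "D = (\<lambda>v. E a v \<ominus> E a (E a v))"
  have D: "linear_op D" unfolding linear_op_def
  proof (intro conjI ballI allI)
    fix u w assume u: "u \<in> carrier H" and w: "w \<in> carrier H"
    show "D (u \<oplus> w) = D u \<oplus> D w"
      by (rule vector_eqI) (simp_all add: D_def cl u w linear_opD(2)[OF l] cinner_diff_right cinner_add_right)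
  next
    fix u c assume u: "u \<in> carrier H"
    show "D u \<in> carrier H" by (simp add: D_def cl u)
    show "D (c \<odot> u) = c \<odot> D u"
      by (rule vector_eqI) (simp_all add: D_def cl u linear_opD(3)[OF l] cinner_diff_right cinner_smult_right right_diff_distrib)
  qed
  have Dval: "cinner H (D u) u = cinner H (E a u) u - cinner H (E a u) (E a u)" if u: "u \<in> carrier H" for u
    by (simp add: D_def cinner_diff_left cl u sym[OF cl[OF u] u])
  have real: "Im (cinner H (E a u) u) = 0" "Im (cinner H (E a u) (E a u)) = 0" if u: "u \<in> carrier H" for u
    using povm_facts(2)[OF E a u] cinner_self_real[OF cl[OF u]] by (auto simp: complex_nonneg_Reals_iff)
  have "D v = \<zero>"
  proof (rule positive_null_vector[OF D _ v])
    show "cinner H (D u) u \<in> \<real>\<^sub>\<ge>\<^sub>0" if u: "u \<in> carrier H" for u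
      using povm_square_le[OF E a u] real[OF u] by (simp add: complex_nonneg_Reals_iff Dval[OF u])
    show "cinner H (D v) v = 0" using eq real[OF v] by (simp add: Dval[OF v] complex_eq_iff)
  qed
  show ?thesis
  proof (rule vector_eqI)
    fix u assume u: "u \<in> carrier H"
    have "cinner H u (D v) = 0" using \<open>D v = \<zero>\<close> u by simp
    then show "cinner H u (E a (E a v)) = cinner H u (E a v)" by (simp add: D_def cinner_diff_right cl u v)
  qed (simp_all add: cl v)
qed

lemma PQ_apply:
  assumes "x \<in> X" "y \<in> X" "a \<in> X" "b \<in> X" "v \<in> carrier H"
  shows "P x a (Q y b v) = Q y b (P x a v)"
    and "(P x a \<otimes>\<^bsub>op_algebra H\<^esub> Q y b) v = P x a (Q y b v)"
proof -
  show "(P x a \<otimes>\<^bsub>op_algebra H\<^esub> Q y b) v = P x a (Q y b v)"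
    using assms(5) by (simp add: op_algebra_simps compose_def)
  moreover have "(Q y b \<otimes>\<^bsub>op_algebra H\<^esub> P x a) v = Q y b (P x a v)"
    using assms(5) by (simp add: op_algebra_simps compose_def)
  ultimately show "P x a (Q y b v) = Q y b (P x a v)" using commute_ops[OF assms(1-4)] by simp
qed

lemma P_in: "x \<in> X \<Longrightarrow> a \<in> X \<Longrightarrow> v \<in> carrier H \<Longrightarrow> P x a v \<in> carrier H"
  and Q_in: "x \<in> X \<Longrightarrow> a \<in> X \<Longrightarrow> v \<in> carrier H \<Longrightarrow> Q x a v \<in> carrier H"
  using linear_opD(1) povm_facts(1) povm_P povm_Q by metis+

text \<open>The game being synchronous, \<open>\<Sum>a. \<langle>P\<^sub>x\<^sub>a \<xi>, Q\<^sub>x\<^sub>a \<xi>\<rangle> = 1\<close>. Hence the non-negative numbers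
  \<open>\<langle>P\<^sub>x\<^sub>a \<xi>, \<xi>\<rangle> - \<parallel>P\<^sub>x\<^sub>a \<xi>\<parallel>\<^sup>2\<close>, the same with \<open>Q\<close>, and \<open>\<parallel>P\<^sub>x\<^sub>a \<xi> - Q\<^sub>x\<^sub>a \<xi>\<parallel>\<^sup>2\<close> have sum 0 over all \<open>a\<close>.\<close>

lemma state_facts:
  assumes x: "x \<in> X" and a: "a \<in> X"
  shows "P x a \<xi> = Q x a \<xi>" and "P x a (P x a \<xi>) = P x a \<xi>" and "Q x a (Q x a \<xi>) = Q x a \<xi>"
proof -
  note PP = povm_P[OF x] and QQ = povm_Q[OF x]
  define e1 e2 f1 f2 d where "e1 = (\<lambda>a. Re (cinner H (P x a \<xi>) \<xi>))" and "e2 = (\<lambda>a. Re (cinner H (P x a \<xi>) (P x a \<xi>)))"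
    and "f1 = (\<lambda>a. Re (cinner H (Q x a \<xi>) \<xi>))" and "f2 = (\<lambda>a. Re (cinner H (Q x a \<xi>) (Q x a \<xi>)))"
    and "d = (\<lambda>a. Re (cinner H (P x a \<xi> \<ominus> Q x a \<xi>) (P x a \<xi> \<ominus> Q x a \<xi>)))"
  note in' = P_in[OF x _ xi(1)] Q_in[OF x _ xi(1)]
  have sums: "(\<Sum>a\<in>X. e1 a) = 1" "(\<Sum>a\<in>X. f1 a) = 1"
    using povm_sum[OF PP xi(1) xi(1)] povm_sum[OF QQ xi(1) xi(1)]
    by (simp_all add: e1_def f1_def xi_inner flip: Re_sum)
  have cross: "cinner H (P x a \<xi>) (Q x b \<xi>) = cinner H ((P x a \<otimes>\<^bsub>op_algebra H\<^esub> Q x b) \<xi>) \<xi>"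
    if "a \<in> X" "b \<in> X" for a b
    using PQ_apply[OF x x that xi(1)] povm_facts(3)[OF QQ that(2) in'(1)[OF that(1)] xi(1)] by simp
  have "(\<Sum>a\<in>X. cinner H (P x a \<xi>) (Q x a \<xi>)) = 1"
  proof -
    have "(\<Sum>a\<in>X. \<Sum>b\<in>X. cinner H (P x a \<xi>) (Q x b \<xi>)) = (\<Sum>a\<in>X. \<Sum>b\<in>X. if a = b then cinner H (P x a \<xi>) (Q x a \<xi>) else 0)"
      by (intro sum.cong refl) (auto simp: cross perfect[OF x x] synchronous[OF x])
    also have "\<dots> = (\<Sum>a\<in>X. cinner H (P x a \<xi>) (Q x a \<xi>))" using finite_X by simp
    finally have "(\<Sum>a\<in>X. cinner H (P x a \<xi>) (Q x a \<xi>)) = (\<Sum>b\<in>X. \<Sum>a\<in>X. cinner H (P x a \<xi>) (Q x b \<xi>))"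
      by (subst sum.swap) simp
    also have "\<dots> = (\<Sum>b\<in>X. cinner H \<xi> (Q x b \<xi>))"
      by (intro sum.cong refl povm_sum[OF PP xi(1)] in'(2))
    also have "\<dots> = (\<Sum>b\<in>X. cinner H (Q x b \<xi>) \<xi>)"
      by (intro sum.cong refl povm_facts(3)[OF QQ _ xi(1) xi(1), symmetric])
    also have "\<dots> = 1" using povm_sum[OF QQ xi(1) xi(1)] by (simp add: xi_inner)
    finally show ?thesis .
  qed
  then have m: "(\<Sum>a\<in>X. Re (cinner H (P x a \<xi>) (Q x a \<xi>))) = 1" by (simp flip: Re_sum)
  have dval: "d a = e2 a + f2 a - 2 * Re (cinner H (P x a \<xi>) (Q x a \<xi>))" if a: "a \<in> X" for a
    using cinner_commute[OF in'(1)[OF a] in'(2)[OF a]] in'[OF a]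
    by (simp add: d_def e2_def f2_def cinner_diff_left cinner_diff_right)
  have "(\<Sum>a\<in>X. (e1 a - e2 a) + (f1 a - f2 a) + d a) = (\<Sum>a\<in>X. e1 a + f1 a - 2 * Re (cinner H (P x a \<xi>) (Q x a \<xi>)))"
    by (intro sum.cong refl) (simp add: dval)
  also have "\<dots> = 0" by (simp add: sum_subtractf sum.distrib sums m flip: sum_distrib_left)
  finally have zero: "(\<Sum>a\<in>X. (e1 a - e2 a) + (f1 a - f2 a) + d a) = 0" .
  have nonneg: "0 \<le> e1 a - e2 a" "0 \<le> f1 a - f2 a" "0 \<le> d a" if a: "a \<in> X" for a
    using povm_square_le[OF PP a xi(1)] povm_square_le[OF QQ a xi(1)]
      cinner_self_nonneg[of "P x a \<xi> \<ominus> Q x a \<xi>"] in'[OF a]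
    by (simp_all add: e1_def e2_def f1_def f2_def d_def)
  have "0 \<le> (e1 b - e2 b) + (f1 b - f2 b) + d b" if "b \<in> X" for b
    by (intro add_nonneg_nonneg nonneg that)
  from sum_nonneg_0[OF finite_X this zero a] have "(e1 a - e2 a) + (f1 a - f2 a) + d a = 0" .
  then have z: "e1 a - e2 a = 0" "f1 a - f2 a = 0" "d a = 0" using nonneg[OF a] by linarith+
  show "P x a (P x a \<xi>) = P x a \<xi>"
    using z(1) by (intro povm_square_eq[OF PP a xi(1)]) (simp add: e1_def e2_def)
  show "Q x a (Q x a \<xi>) = Q x a \<xi>"
    using z(2) by (intro povm_square_eq[OF QQ a xi(1)]) (simp add: f1_def f2_def)
  have dd: "P x a \<xi> \<ominus> Q x a \<xi> \<in> carrier H" using in'[OF a] by simp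
  have "cinner H (P x a \<xi> \<ominus> Q x a \<xi>) (P x a \<xi> \<ominus> Q x a \<xi>) = 0"
    using z(3) cinner_self_real[OF dd] by (simp add: d_def complex_eq_iff)
  then have dz: "P x a \<xi> \<ominus> Q x a \<xi> = \<zero>" by (rule cinner_eq_zero[OF dd])
  show "P x a \<xi> = Q x a \<xi>"
  proof (rule vector_eqI)
    fix u assume u: "u \<in> carrier H"
    have "cinner H u (P x a \<xi> \<ominus> Q x a \<xi>) = 0" using dz u by simp
    then show "cinner H u (P x a \<xi>) = cinner H u (Q x a \<xi>)" using in'[OF a] u by (simp add: cinner_diff_right)
  qed (rule in'[OF a])+
qed

text \<open>Replace \<open>P\<^sub>y\<^sub>b \<xi>\<close> by \<open>Q\<^sub>y\<^sub>b \<xi>\<close>. As both operators act idempotently on \<open>\<xi>\<close> and commute, \<open>\<parallel>P\<^sub>x\<^sub>a Q\<^sub>y\<^sub>b \<xi>\<parallel>\<^sup>2 = \<langle>P\<^sub>x\<^sub>a Q\<^sub>y\<^sub>b \<xi>, \<xi>\<rangle>\<close>, a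
  correlation that vanishes.\<close>

lemma forbidden:
  assumes "x \<in> X" "y \<in> X" "a \<in> X" "b \<in> X" "\<not> rule x y a b"
  shows "P x a (P y b \<xi>) = \<zero>"
proof (rule cinner_eq_zero)
  note q = state_facts[OF assms(2,4)] and p = state_facts[OF assms(1,3)]
  note symP = povm_facts(3)[OF povm_P[OF assms(1)] assms(3)] and symQ = povm_facts(3)[OF povm_Q[OF assms(2)] assms(4)]
  note comm = PQ_apply(1)[OF assms(1-4)]
  have qx: "Q y b \<xi> \<in> carrier H" by (rule Q_in[OF assms(2,4) xi(1)])
  have px: "P x a \<xi> \<in> carrier H" by (rule P_in[OF assms(1,3) xi(1)])
  have pq: "P x a (Q y b \<xi>) \<in> carrier H" by (rule P_in[OF assms(1,3) qx])
  show "P x a (P y b \<xi>) \<in> carrier H" using pq by (simp add: q(1))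
  have pp: "P x a (P x a (Q y b \<xi>)) = P x a (Q y b \<xi>)"
    unfolding comm[OF xi(1)] comm[OF px] by (simp add: p(2))
  have "cinner H (P x a (Q y b \<xi>)) (P x a (Q y b \<xi>)) = cinner H (P x a (P x a (Q y b \<xi>))) (Q y b \<xi>)"
    by (rule symP[OF pq qx, symmetric])
  also have "\<dots> = cinner H (P x a (Q y b \<xi>)) (Q y b \<xi>)" by (simp only: pp)
  also have "\<dots> = cinner H (Q y b (P x a (Q y b \<xi>))) \<xi>" by (rule symQ[OF pq xi(1), symmetric])
  also have "Q y b (P x a (Q y b \<xi>)) = P x a (Q y b (Q y b \<xi>))" by (rule comm[OF qx, symmetric])
  also have "\<dots> = P x a (Q y b \<xi>)" by (simp only: q(3))
  also have "cinner H \<dots> \<xi> = 0" using perfect[OF assms] PQ_apply(2)[OF assms(1-4) xi(1)] by simp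
  finally show "cinner H (P x a (P y b \<xi>)) (P x a (P y b \<xi>)) = 0" by (simp only: q(1))
qed

definition wordP :: "('x \<times> 'x) list \<Rightarrow> 'h \<Rightarrow> 'h" where "wordP w v = foldr (\<lambda>(x, a). P x a) w v"
definition wordQ :: "('x \<times> 'x) list \<Rightarrow> 'h \<Rightarrow> 'h" where "wordQ w v = foldr (\<lambda>(x, a). Q x a) w v"

lemma word_simps [simp]: "wordP [] v = v" "wordQ [] v = v"
  "wordP ((x, a) # w) v = P x a (wordP w v)" "wordQ ((x, a) # w) v = Q x a (wordQ w v)"
  "wordP (u @ w) v = wordP u (wordP w v)" "wordQ (u @ w) v = wordQ u (wordQ w v)"
  by (simp_all add: wordP_def wordQ_def)

lemma wordP_in: "set w \<subseteq> X \<times> X \<Longrightarrow> v \<in> carrier H \<Longrightarrow> wordP w v \<in> carrier H"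
  and wordQ_in: "set w \<subseteq> X \<times> X \<Longrightarrow> v \<in> carrier H \<Longrightarrow> wordQ w v \<in> carrier H"
  by (induction w) (auto simp: P_in Q_in)

lemma wordP_zero: "set w \<subseteq> X \<times> X \<Longrightarrow> wordP w \<zero> = \<zero>"
  by (induction w) (auto simp: linear_op_zero povm_facts(1)[OF povm_P])

lemma wordQ_zero: "set w \<subseteq> X \<times> X \<Longrightarrow> wordQ w \<zero> = \<zero>"
  by (induction w) (auto simp: linear_op_zero povm_facts(1)[OF povm_Q])

lemma P_wordQ:
  "set w \<subseteq> X \<times> X \<Longrightarrow> x \<in> X \<Longrightarrow> a \<in> X \<Longrightarrow> v \<in> carrier H \<Longrightarrow> P x a (wordQ w v) = wordQ w (P x a v)"
  by (induction w) (auto simp: PQ_apply(1) wordQ_in)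

text \<open>This moves operators \<open>P\<close> past each other: what holds for them at \<open>\<xi>\<close> holds at each \<open>wordQ w \<xi>\<close> and therefore at each \<open>wordP w \<xi>\<close>.\<close>

lemma wordP_xi: "set w \<subseteq> X \<times> X \<Longrightarrow> wordP w \<xi> = wordQ (rev w) \<xi>"
proof (induction w)
  case (Cons l w)
  obtain x a where l: "l = (x, a)" by force
  then show ?case using Cons by (simp add: P_wordQ xi(1) state_facts(1))
qed simp

lemma wordP_adjoint:
  "set w \<subseteq> X \<times> X \<Longrightarrow> u \<in> carrier H \<Longrightarrow> v \<in> carrier H \<Longrightarrow> cinner H (wordP w u) v = cinner H u (wordP (rev w) v)"
proof (induction w arbitrary: v)
  case (Cons l w)
  obtain x a where l: "l = (x, a)" by force
  then show ?case using Cons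
    by (simp add: povm_facts(3)[OF povm_P] wordP_in P_in)
qed simp

definition correlation :: "('x \<times> 'x) list \<Rightarrow> complex" where
  "correlation w = (if set w \<subseteq> X \<times> X then cinner H (wordP w \<xi>) \<xi> else 0)"

lemma correlation_Nil: "correlation [] = 1"
  by (simp add: correlation_def xi_inner)

lemma correlation_rev: "correlation (rev w) = cnj (correlation w)"
proof (cases "set w \<subseteq> X \<times> X")
  case True
  then show ?thesis
    using wordP_adjoint[of "rev w" \<xi> \<xi>] cinner_commute[OF xi(1) wordP_in[OF True xi(1)]] xi(1)
    by (simp add: correlation_def)
qed (simp add: correlation_def)

lemma correlation_outside: "\<not> set (u @ v) \<subseteq> X \<times> X \<Longrightarrow> correlation (u @ m @ v) = 0"
  by (auto simp: correlation_def)

lemma correlation_game: "game_functional X rule UNIV correlation"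
  unfolding game_functional_def
proof (intro conjI ballI impI)
  fix u v :: "('x \<times> 'x) list" and x assume x: "x \<in> X"
  have good: "set (u @ v) \<subseteq> X \<times> X \<Longrightarrow> set u \<subseteq> X \<times> X \<and> set v \<subseteq> X \<times> X" by simp
  show "(\<Sum>a\<in>X. correlation (u @ (x, a) # v)) = correlation (u @ v)"
  proof (cases "set (u @ v) \<subseteq> X \<times> X")
    case True
    then have u: "set u \<subseteq> X \<times> X" and v: "set v \<subseteq> X \<times> X" by auto
    have vx: "wordP v \<xi> \<in> carrier H" and ux: "wordP (rev u) \<xi> \<in> carrier H"
      using wordP_in[OF v xi(1)] wordP_in[of "rev u"] u xi(1) by auto
    have "(\<Sum>a\<in>X. correlation (u @ (x, a) # v)) = (\<Sum>a\<in>X. cinner H (P x a (wordP v \<xi>)) (wordP (rev u) \<xi>))"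
      using u v x by (intro sum.cong refl) (simp add: correlation_def wordP_adjoint P_in vx xi(1))
    also have "\<dots> = cinner H (wordP v \<xi>) (wordP (rev u) \<xi>)" by (rule povm_sum[OF povm_P[OF x] vx ux])
    also have "\<dots> = correlation (u @ v)" using u v by (simp add: correlation_def wordP_adjoint vx xi(1))
    finally show ?thesis .
  next
    case False
    then show ?thesis using correlation_outside[of u v "[(x, _)]"] correlation_outside[of u v "[]"] by simp
  qed
  fix a assume a: "a \<in> X"
  show "correlation (u @ (x, a) # (x, a) # v) = correlation (u @ (x, a) # v)"
  proof (cases "set (u @ v) \<subseteq> X \<times> X")
    case True
    then have v: "set v \<subseteq> X \<times> X" "set (rev v) \<subseteq> X \<times> X" by auto
    have "P x a (P x a (wordP v \<xi>)) = P x a (wordP v \<xi>)"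
      using x a v by (simp add: wordP_xi P_wordQ xi(1) P_in state_facts(2))
    then show ?thesis by (simp add: correlation_def)
  next
    case False
    then show ?thesis using correlation_outside[of u v "[(x, a), (x, a)]"] correlation_outside[of u v "[(x, a)]"] by simp
  qed
next
  fix u v :: "('x \<times> 'x) list" and x y a b
  assume xy: "x \<in> X" "y \<in> X" "a \<in> X" "b \<in> X" "\<not> rule x y a b"
  show "correlation (u @ (x, a) # (y, b) # v) = 0"
  proof (cases "set (u @ v) \<subseteq> X \<times> X")
    case True
    then have u: "set u \<subseteq> X \<times> X" and v: "set v \<subseteq> X \<times> X" "set (rev v) \<subseteq> X \<times> X" by auto
    have "P x a (P y b (wordP v \<xi>)) = \<zero>"
      using xy v by (simp add: wordP_xi P_wordQ xi(1) P_in forbidden wordQ_zero)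
    then show ?thesis using u by (simp add: correlation_def wordP_zero xi(1))
  next
    case False
    then show ?thesis using correlation_outside[of u v "[(x, a), (y, b)]"] by simp
  qed
qed

end

lemma qc_strategy_nonzero:
  assumes strat: "perfect_qc_strategy TYPE('h) X rule" and fin: "finite X"
    and sync: "\<And>x a b. x \<in> X \<Longrightarrow> a \<in> X \<Longrightarrow> b \<in> X \<Longrightarrow> a \<noteq> b \<Longrightarrow> \<not> rule x x a b"
  shows "carrier (game_algebra X rule) \<noteq> {\<zero>\<^bsub>game_algebra X rule\<^esub>}"
proof -
  obtain H :: "'h hilbert" and \<xi> P Q where
    *: "hilbert_space H" "\<xi> \<in> carrier H" "hnorm H \<xi> = 1" "\<forall>x \<in> X. povm H X (P x)" "\<forall>y \<in> X. povm H X (Q y)"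
      "\<forall>x \<in> X. \<forall>y \<in> X. \<forall>a \<in> X. \<forall>b \<in> X.
           P x a \<otimes>\<^bsub>op_algebra H\<^esub> Q y b = Q y b \<otimes>\<^bsub>op_algebra H\<^esub> P x a"
      "\<forall>x \<in> X. \<forall>y \<in> X. \<forall>a \<in> X. \<forall>b \<in> X.
           \<not> rule x y a b \<longrightarrow> cinner H ((P x a \<otimes>\<^bsub>op_algebra H\<^esub> Q y b) \<xi>) \<xi> = 0"
    using strat unfolding perfect_qc_strategy_def by blast
  interpret qc_strategy H X rule \<xi> P Q
    using * fin sync by (intro qc_strategy.intro qc_strategy_axioms.intro) blast+
  show ?thesis
    by (rule game_functional_nonzero[OF fin correlation_game correlation_rev]) (simp add: correlation_Nil)
qed

text \<open>In the zero algebra \<open>1 = 1 + 1\<close>, and a unital representation carries this over to the identity operator.\<close>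

lemma representation_nonzero:
  assumes H: "hilbert_space H" "carrier H \<noteq> {\<zero>\<^bsub>H\<^esub>}" and hom: "h \<in> star_hom (game_algebra X rule) (op_algebra H)"
  shows "carrier (game_algebra X rule) \<noteq> {\<zero>\<^bsub>game_algebra X rule\<^esub>}"
proof
  let ?Q = "game_algebra X rule"
  assume triv: "carrier ?Q = {\<zero>\<^bsub>?Q\<^esub>}"
  interpret hilbert_space H by (rule H)
  interpret I: ideal "game_ideal X rule" "free_star_algebra (X \<times> X)" by (rule ideal_game_ideal)
  interpret Q: ring "free_star_algebra (X \<times> X) Quot game_ideal X rule" by (rule I.quotient_is_ring)
  have q: "carrier ?Q = carrier (free_star_algebra (X \<times> X) Quot game_ideal X rule)"
    "\<one>\<^bsub>?Q\<^esub> = \<one>\<^bsub>free_star_algebra (X \<times> X) Quot game_ideal X rule\<^esub>"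
    "\<And>a b. a \<oplus>\<^bsub>?Q\<^esub> b = a \<oplus>\<^bsub>free_star_algebra (X \<times> X) Quot game_ideal X rule\<^esub> b"
    by (simp_all add: game_algebra_def quot_star_algebra_def game_ideal_def)
  have one: "\<one>\<^bsub>?Q\<^esub> \<in> carrier ?Q" using Q.one_closed by (simp only: q)
  have "\<one>\<^bsub>?Q\<^esub> \<oplus>\<^bsub>?Q\<^esub> \<one>\<^bsub>?Q\<^esub> \<in> carrier ?Q" using Q.a_closed[OF Q.one_closed Q.one_closed] by (simp only: q)
  then have eq: "\<one>\<^bsub>?Q\<^esub> \<oplus>\<^bsub>?Q\<^esub> \<one>\<^bsub>?Q\<^esub> = \<one>\<^bsub>?Q\<^esub>" using one triv by simp
  have rh: "h \<in> ring_hom ?Q (op_algebra H)" using hom by (simp add: star_hom_def)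
  have "h \<one>\<^bsub>?Q\<^esub> = h \<one>\<^bsub>?Q\<^esub> \<oplus>\<^bsub>op_algebra H\<^esub> h \<one>\<^bsub>?Q\<^esub>"
    using ring_hom_add[OF rh one one] eq by simp
  then have dbl: "(\<lambda>v\<in>carrier H. v) = (\<lambda>v\<in>carrier H. v \<oplus>\<^bsub>H\<^esub> v)"
    unfolding ring_hom_one[OF rh] op_algebra_simps by (simp cong: restrict_cong)
  have "v = \<zero>\<^bsub>H\<^esub>" if v: "v \<in> carrier H" for v
  proof -
    have "v = v \<oplus>\<^bsub>H\<^esub> v" using fun_cong[OF dbl, of v] v by simp
    from arg_cong[OF this, of "\<lambda>u. cinner H u v"] have "cinner H v v = 0"
      using cinner_add_left[OF v v v] by simp
    then show ?thesis by (rule cinner_eq_zero[OF v])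
  qed
  then show False using H(2) zero_closed by blast
qed

section \<open>The hypergraph isomorphism game\<close>

text \<open>The rule of the game compares two relations between vertices, between hyperedges, or between a vertex and a
  hyperedge; the constructor records the kinds of the two items in order.\<close>

datatype item_colour = VV vertex_relation | VE bool | EV bool | EE hedge_relation

text \<open>Only meaningful on the items of the first hypergraph, and \<open>item_rel2\<close> on those of the second.\<close>

fun item_rel1 :: "('v1, 'e1) hypergraph \<Rightarrow> ('v1, 'e1, 'v2, 'e2) item \<Rightarrow> ('v1, 'e1, 'v2, 'e2) item \<Rightarrow> item_colour" where
  "item_rel1 \<Lambda> (Vtx1 v) (Vtx1 w) = VV (vertex_rel \<Lambda> v w)"
| "item_rel1 \<Lambda> (Vtx1 v) (Edg1 e) = VE (v \<in> incid \<Lambda> e)"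
| "item_rel1 \<Lambda> (Edg1 e) (Vtx1 v) = EV (v \<in> incid \<Lambda> e)"
| "item_rel1 \<Lambda> (Edg1 e) (Edg1 f) = EE (hedge_rel \<Lambda> e f)"
| "item_rel1 \<Lambda> _ _ = VE False"

fun item_rel2 :: "('v2, 'e2) hypergraph \<Rightarrow> ('v1, 'e1, 'v2, 'e2) item \<Rightarrow> ('v1, 'e1, 'v2, 'e2) item \<Rightarrow> item_colour" where
  "item_rel2 \<Lambda> (Vtx2 v) (Vtx2 w) = VV (vertex_rel \<Lambda> v w)"
| "item_rel2 \<Lambda> (Vtx2 v) (Edg2 e) = VE (v \<in> incid \<Lambda> e)"
| "item_rel2 \<Lambda> (Edg2 e) (Vtx2 v) = EV (v \<in> incid \<Lambda> e)"
| "item_rel2 \<Lambda> (Edg2 e) (Edg2 f) = EE (hedge_rel \<Lambda> e f)"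
| "item_rel2 \<Lambda> _ _ = VE False"

lemma vertex_rel_refl: "vertex_rel \<Lambda> v w = Equal_vertices \<longleftrightarrow> v = w"
  "Equal_vertices = vertex_rel \<Lambda> v w \<longleftrightarrow> v = w" "vertex_rel \<Lambda> v v = Equal_vertices"
  by (auto simp: vertex_rel_def)

lemma hedge_rel_refl: "hedge_rel \<Lambda> e f = Equal_hedges \<longleftrightarrow> e = f"
  "Equal_hedges = hedge_rel \<Lambda> e f \<longleftrightarrow> e = f" "hedge_rel \<Lambda> e e = Equal_hedges"
  by (auto simp: hedge_rel_def)

lemma vertex_rel_sym: "vertex_rel \<Lambda> v w = vertex_rel \<Lambda> w v"
  by (auto simp: vertex_rel_def)

lemma hedge_rel_sym: "hedge_rel \<Lambda> e f = hedge_rel \<Lambda> f e"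
  by (auto simp: hedge_rel_def)

lemma vertex_rel_eqD:
  assumes "vertex_rel \<Lambda> v w = vertex_rel \<Lambda>' v' w'"
  shows "v = w \<longleftrightarrow> v' = w'" and "vertex_rel \<Lambda> w v = vertex_rel \<Lambda>' w' v'"
proof -
  show "v = w \<longleftrightarrow> v' = w'"
    unfolding vertex_rel_refl(1)[of \<Lambda> v w, symmetric] vertex_rel_refl(1)[of \<Lambda>' v' w', symmetric]
    by (simp only: assms)
  show "vertex_rel \<Lambda> w v = vertex_rel \<Lambda>' w' v'"
    unfolding vertex_rel_sym[of \<Lambda> w v] vertex_rel_sym[of \<Lambda>' w' v'] by (rule assms)
qed

lemma hedge_rel_eqD:
  assumes "hedge_rel \<Lambda> v w = hedge_rel \<Lambda>' v' w'"
  shows "v = w \<longleftrightarrow> v' = w'" and "hedge_rel \<Lambda> w v = hedge_rel \<Lambda>' w' v'"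
proof -
  show "v = w \<longleftrightarrow> v' = w'"
    unfolding hedge_rel_refl(1)[of \<Lambda> v w, symmetric] hedge_rel_refl(1)[of \<Lambda>' v' w', symmetric]
    by (simp only: assms)
  show "hedge_rel \<Lambda> w v = hedge_rel \<Lambda>' w' v'"
    unfolding hedge_rel_sym[of \<Lambda> w v] hedge_rel_sym[of \<Lambda>' w' v'] by (rule assms)
qed

locale hypergraph_pair = L1: hypergraph \<Lambda>1 + L2: hypergraph \<Lambda>2
  for \<Lambda>1 :: "('v1, 'e1) hypergraph" and \<Lambda>2 :: "('v2, 'e2) hypergraph"
begin

definition I1 :: "('v1, 'e1, 'v2, 'e2) item set" where "I1 = Vtx1 ` verts \<Lambda>1 \<union> Edg1 ` hedges \<Lambda>1"
definition I2 :: "('v1, 'e1, 'v2, 'e2) item set" where "I2 = Vtx2 ` verts \<Lambda>2 \<union> Edg2 ` hedges \<Lambda>2"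

abbreviation X :: "('v1, 'e1, 'v2, 'e2) item set" where "X \<equiv> iso_items \<Lambda>1 \<Lambda>2"
abbreviation rule :: "('v1, 'e1, 'v2, 'e2) item \<Rightarrow> _" where "rule \<equiv> hyp_iso_rule \<Lambda>1 \<Lambda>2"

lemma X_eq: "X = I1 \<union> I2" by (auto simp: iso_items_def I1_def I2_def)

lemma finite_items: "finite I1" "finite I2" "finite X"
  using L1.finite_verts L1.finite_hedges L2.finite_verts L2.finite_hedges
  by (simp_all add: X_eq I1_def I2_def)

lemma I1_E: assumes "i \<in> I1" obtains v where "i = Vtx1 v" | e where "i = Edg1 e"
  using assms by (auto simp: I1_def)

lemma I2_E: assumes "j \<in> I2" obtains v where "j = Vtx2 v" | e where "j = Edg2 e"
  using assms by (auto simp: I2_def)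

lemma disjoint: "i \<in> I1 \<Longrightarrow> i \<notin> I2" by (auto simp: I1_def I2_def)

sublocale C: coloured_pair I1 I2 "item_rel1 \<Lambda>1" "item_rel2 \<Lambda>2"
proof
  fix i k j l assume "i \<in> I1" "k \<in> I1" "j \<in> I2" "l \<in> I2" and eq: "item_rel1 \<Lambda>1 i k = item_rel2 \<Lambda>2 j l"
  then show "(i = k) = (j = l)" "item_rel1 \<Lambda>1 k i = item_rel2 \<Lambda>2 l j"
    by (auto elim!: I1_E I2_E dest: vertex_rel_eqD hedge_rel_eqD)
qed (rule finite_items)+

text \<open>An answer \<open>j\<close> to a question \<open>i\<close> and an answer \<open>i\<close> to a question \<open>j\<close> are both treated as the letter \<open>(i, j)\<close>. Equality of the
  colours of \<open>(i, i)\<close> and \<open>(j, j)\<close> says that \<open>i\<close> and \<open>j\<close> are of the same kind.\<close>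

lemma rule_intro:
  assumes "i \<in> I1" "k \<in> I1" "j \<in> I2" "l \<in> I2"
    and "item_rel1 \<Lambda>1 i k = item_rel2 \<Lambda>2 j l"
    and "item_rel1 \<Lambda>1 i i = item_rel2 \<Lambda>2 j j" "item_rel1 \<Lambda>1 k k = item_rel2 \<Lambda>2 l l"
    and "(x, a) = (i, j) \<or> (x, a) = (j, i)" "(y, b) = (k, l) \<or> (y, b) = (l, k)"
  shows "rule x y a b"
  using assms
  by (elim I1_E I2_E) (auto simp: hyp_iso_rule_def doubleton_eq_iff)

text \<open>Both orders of the questions are needed, since the rule compares incidences only if the vertex comes first.\<close>

lemma rule_elim:
  assumes "i \<in> I1" "k \<in> I1" "j \<in> I2" "l \<in> I2" "rule i k j l" "rule k i l j"
  shows "item_rel1 \<Lambda>1 i k = item_rel2 \<Lambda>2 j l"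
  using assms
  by (elim I1_E I2_E) (auto simp: hyp_iso_rule_def doubleton_eq_iff)

lemma rule_swap_answer:
  assumes "i \<in> I1" "j \<in> I2" "b \<in> X" "rule i j j b"
  shows "b = i"
  using assms(1,2,4)
  by (elim I1_E I2_E)
     (auto simp: hyp_iso_rule_def doubleton_eq_iff vertex_rel_refl hedge_rel_refl)

lemma rule_swap_answer':
  assumes "i \<in> I1" "j \<in> I2" "b \<in> X" "rule i j b i"
  shows "b = j"
  using assms(1,2,4)
  by (elim I1_E I2_E)
     (auto simp: hyp_iso_rule_def doubleton_eq_iff vertex_rel_refl hedge_rel_refl)

lemma rule_answer_side:
  assumes "a \<in> X" "rule x x a a"
  shows "x \<in> I1 \<Longrightarrow> a \<in> I2" "x \<in> I2 \<Longrightarrow> a \<in> I1"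
  using assms by (auto simp: X_eq I1_def I2_def hyp_iso_rule_def)

lemma rule_synchronous: "x \<in> X \<Longrightarrow> a \<in> X \<Longrightarrow> b \<in> X \<Longrightarrow> a \<noteq> b \<Longrightarrow> \<not> rule x x a b"
  unfolding X_eq
  by (auto simp: I1_def I2_def hyp_iso_rule_def doubleton_eq_iff vertex_rel_refl hedge_rel_refl)

text \<open>Every column of \<open>u\<close> sums to 1 because generators with question and answer interchanged are equal: by the rule, the product of the
  generators for \<open>(i, j)\<close> and \<open>(j, b)\<close> vanishes for \<open>b \<noteq> i\<close>, and that for \<open>(i, b)\<close> and \<open>(j, i)\<close> vanishes for \<open>b \<noteq> j\<close>.\<close>

lemma iso_functional_exists:
  assumes "carrier (game_algebra X rule) \<noteq> {\<zero>\<^bsub>game_algebra X rule\<^esub>}"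
  shows "\<exists>g\<in>C.iso_functionals. g [] \<noteq> 0"
proof -
  let ?W = "lists (X \<times> X)"
  obtain f where game: "game_functional X rule ?W f" and game': "game_functional X (\<lambda>x y a b. rule y x b a) ?W f"
    and f1: "f [] = 1"
    using game_functional_exists[OF finite_items(3) assms] by blast
  have idem: "f (u @ (x, a) # (x, a) # v) = f (u @ (x, a) # v)" if "u \<in> ?W" "v \<in> ?W" "x \<in> X" "a \<in> X" for u v x a
    using game that unfolding game_functional_def by blast
  have total: "(\<Sum>a\<in>X. f (u @ (x, a) # v)) = f (u @ v)" if "u \<in> ?W" "v \<in> ?W" "x \<in> X" for u v x
    using game that unfolding game_functional_def by blast
  have forbid1: "f (u @ (x, a) # (y, b) # v) = 0"
    if "u \<in> ?W" "v \<in> ?W" "x \<in> X" "y \<in> X" "a \<in> X" "b \<in> X" "\<not> rule x y a b" for u v x y a b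
    using game that unfolding game_functional_def by blast
  have forbid2: "f (u @ (x, a) # (y, b) # v) = 0"
    if "u \<in> ?W" "v \<in> ?W" "x \<in> X" "y \<in> X" "a \<in> X" "b \<in> X" "\<not> rule y x b a" for u v x y a b
    using game' that unfolding game_functional_def by blast
  have forbid: "f (u @ (x, a) # (y, b) # v) = 0"
    if "u \<in> ?W" "v \<in> ?W" "x \<in> X" "y \<in> X" "a \<in> X" "b \<in> X" "\<not> rule x y a b \<or> \<not> rule y x b a" for u v x y a b
    using forbid1[OF that(1-6)] forbid2[OF that(1-6)] that(7) by blast
  have I1X: "i \<in> I1 \<Longrightarrow> i \<in> X" and I2X: "j \<in> I2 \<Longrightarrow> j \<in> X" for i j by (simp_all add: X_eq)
  have side: "f (u @ (x, a) # v) = 0" if u: "u \<in> ?W" and v: "v \<in> ?W" and x: "x \<in> X" and a: "a \<in> X" and "\<not> rule x x a a" for u v x a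
    using idem[OF u v x a] forbid[OF u v x x a a] that(5) by simp
  have row: "(\<Sum>a\<in>I2. f (u @ (i, a) # v)) = f (u @ v)" if u: "u \<in> ?W" and v: "v \<in> ?W" and i: "i \<in> I1" for u v i
  proof -
    have "(\<Sum>a\<in>I2. f (u @ (i, a) # v)) = (\<Sum>a\<in>X. f (u @ (i, a) # v))"
    proof (rule sum.mono_neutral_left)
      show "\<forall>a\<in>X - I2. f (u @ (i, a) # v) = 0"
        using side[OF u v I1X[OF i]] rule_answer_side(1)[OF _ _ i] by blast
    qed (auto simp: X_eq finite_items)
    then show ?thesis using total[OF u v I1X[OF i]] by simp
  qed
  have row': "(\<Sum>a\<in>I1. f (u @ (j, a) # v)) = f (u @ v)" if u: "u \<in> ?W" and v: "v \<in> ?W" and j: "j \<in> I2" for u v j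
  proof -
    have "(\<Sum>a\<in>I1. f (u @ (j, a) # v)) = (\<Sum>a\<in>X. f (u @ (j, a) # v))"
    proof (rule sum.mono_neutral_left)
      show "\<forall>a\<in>X - I1. f (u @ (j, a) # v) = 0"
        using side[OF u v I2X[OF j]] rule_answer_side(2)[OF _ _ j] by blast
    qed (auto simp: X_eq finite_items)
    then show ?thesis using total[OF u v I2X[OF j]] by simp
  qed
  have swap: "f (u @ (i, j) # v) = f (u @ (j, i) # v)" if u: "u \<in> ?W" and v: "v \<in> ?W" and i: "i \<in> I1" and j: "j \<in> I2" for u v i j
  proof -
    have iX: "i \<in> X" and jX: "j \<in> X" using I1X[OF i] I2X[OF j] .
    have ui: "u @ [(i, j)] \<in> ?W" and vj: "(j, i) # v \<in> ?W" using u v iX jX by auto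
    have "f (u @ (i, j) # v) = (\<Sum>b\<in>X. f (u @ (i, j) # (j, b) # v))"
      using total[OF ui v jX] by simp
    also have "\<dots> = (\<Sum>b\<in>{i}. f (u @ (i, j) # (j, b) # v))"
    proof (rule sum.mono_neutral_right)
      show "\<forall>b\<in>X - {i}. f (u @ (i, j) # (j, b) # v) = 0"
        using forbid[OF u v iX jX jX] rule_swap_answer[OF i j] by blast
    qed (use iX finite_items in auto)
    also have "\<dots> = (\<Sum>b\<in>{j}. f (u @ (i, b) # (j, i) # v))" by simp
    also have "\<dots> = (\<Sum>b\<in>X. f (u @ (i, b) # (j, i) # v))"
    proof (rule sum.mono_neutral_left)
      show "\<forall>b\<in>X - {j}. f (u @ (i, b) # (j, i) # v) = 0"
        using forbid[OF u v iX jX _ iX] rule_swap_answer'[OF i j] by blast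
    qed (use jX finite_items in auto)
    also have "\<dots> = f (u @ (j, i) # v)" by (rule total[OF u vj iX])
    finally show ?thesis .
  qed
  have sub: "u \<in> ?W" if "set u \<subseteq> I1 \<times> I2" for u using that by (auto simp: X_eq in_lists_conv_set)
  define g where "g = (\<lambda>w. if set w \<subseteq> I1 \<times> I2 then f w else 0)"
  have g_out: "g (a @ m @ b) = 0" if "\<not> set (a @ b) \<subseteq> I1 \<times> I2" for a b m using that by (auto simp: g_def)
  have "g \<in> C.iso_functionals"
    unfolding C.iso_functionals_def
  proof (intro CollectI conjI allI ballI impI)
    fix a b :: "(('v1, 'e1, 'v2, 'e2) item \<times> ('v1, 'e1, 'v2, 'e2) item) list"
    consider (good) "set (a @ b) \<subseteq> I1 \<times> I2" | (bad) "\<not> set (a @ b) \<subseteq> I1 \<times> I2" by blast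
    note cases = this
    show "(\<Sum>j\<in>I2. g (a @ (i, j) # b)) = g (a @ b)" if i: "i \<in> I1" for i
    proof (cases rule: cases)
      case good
      have "(\<Sum>j\<in>I2. g (a @ (i, j) # b)) = (\<Sum>j\<in>I2. f (a @ (i, j) # b))"
        using good i by (intro sum.cong refl) (simp add: g_def)
      then show ?thesis using row[OF sub sub i, of a b] good by (simp add: g_def)
    next
      case bad
      then show ?thesis using g_out[OF bad, of "[_]"] g_out[OF bad, of "[]"] by simp
    qed
    show "(\<Sum>i\<in>I1. g (a @ (i, j) # b)) = g (a @ b)" if j: "j \<in> I2" for j
    proof (cases rule: cases)
      case good
      then have ab: "a \<in> ?W" "b \<in> ?W" using sub by auto
      have "(\<Sum>i\<in>I1. g (a @ (i, j) # b)) = (\<Sum>i\<in>I1. f (a @ (j, i) # b))"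
        using good j by (intro sum.cong refl) (simp add: g_def swap[OF ab _ j])
      then show ?thesis using row'[OF ab j] good by (simp add: g_def)
    next
      case bad
      then show ?thesis using g_out[OF bad, of "[_]"] g_out[OF bad, of "[]"] by simp
    qed
    fix i k j l assume ij: "i \<in> I1" "k \<in> I1" "j \<in> I2" "l \<in> I2" and ne: "item_rel1 \<Lambda>1 i k \<noteq> item_rel2 \<Lambda>2 j l"
    have X: "i \<in> X" "k \<in> X" "j \<in> X" "l \<in> X" using ij by (auto simp: X_eq)
    show "g (a @ (i, j) # (k, l) # b) = 0"
    proof (cases rule: cases)
      case good
      then have ab: "a \<in> ?W" "b \<in> ?W" using sub by auto
      have "\<not> rule i k j l \<or> \<not> rule k i l j" using rule_elim[OF ij] ne by blast
      then show ?thesis using forbid[OF ab X] by (simp add: g_def)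
    next
      case bad
      then show ?thesis using g_out[OF bad, of "[(i, j), (k, l)]"] by simp
    qed
  qed
  moreover have "g [] \<noteq> 0" using f1 by (simp add: g_def)
  ultimately show ?thesis by blast
qed

text \<open>The letter for which a generator of the game algebra stands; pairs that cannot be question and answer are sent outside \<open>I1 \<times> I2\<close>.\<close>

definition orient where
  "orient p = (if p \<in> I1 \<times> I2 then p else (snd p, fst p))"

lemma orient_simps: "i \<in> I1 \<Longrightarrow> j \<in> I2 \<Longrightarrow> orient (i, j) = (i, j)" "i \<in> I1 \<Longrightarrow> j \<in> I2 \<Longrightarrow> orient (j, i) = (i, j)"
  using disjoint by (auto simp: orient_def)

lemma orient_inE:
  assumes "orient (x, a) \<in> I1 \<times> I2"
  obtains i j where "i \<in> I1" "j \<in> I2" "orient (x, a) = (i, j)" "(x, a) = (i, j) \<or> (x, a) = (j, i)"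
  using assms by (auto simp: orient_def split: if_splits)

lemma psd_pullback:
  assumes psd: "\<And>C c. finite C \<Longrightarrow> (\<Sum>w\<in>C. \<Sum>v\<in>C. cnj (c w) * K w v * c v) \<in> \<real>\<^sub>\<ge>\<^sub>0" and C: "finite C"
  shows "(\<Sum>w\<in>C. \<Sum>v\<in>C. cnj (c w) * K (g w) (g v) * c v) \<in> \<real>\<^sub>\<ge>\<^sub>0"
proof -
  define d where "d = (\<lambda>w'. \<Sum>w | w \<in> C \<and> g w = w'. c w)"
  have "(\<Sum>w\<in>C. \<Sum>v\<in>C. cnj (c w) * K (g w) (g v) * c v) =
      (\<Sum>w'\<in>g ` C. \<Sum>w | w \<in> C \<and> g w = w'. \<Sum>v'\<in>g ` C. \<Sum>v | v \<in> C \<and> g v = v'. cnj (c w) * K (g w) (g v) * c v)"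
    by (simp add: sum.image_gen[OF C, of _ g])
  also have "\<dots> = (\<Sum>w'\<in>g ` C. \<Sum>w | w \<in> C \<and> g w = w'. \<Sum>v'\<in>g ` C. cnj (c w) * K w' v' * d v')"
    by (intro sum.cong refl) (simp add: d_def sum_distrib_left)
  also have "\<dots> = (\<Sum>w'\<in>g ` C. \<Sum>v'\<in>g ` C. cnj (d w') * K w' v' * d v')"
    unfolding d_def cnj_sum sum_distrib_right
    by (intro sum.cong refl) (rule sum.swap)
  also have "\<dots> \<in> \<real>\<^sub>\<ge>\<^sub>0" by (rule psd) (simp add: C)
  finally show ?thesis .
qed

text \<open>The Haar trace of \<open>u\<close>, read as a functional on products of generators of the game algebra.\<close>

lemma tracial_state_exists:
  assumes nz: "carrier (game_algebra X rule) \<noteq> {\<zero>\<^bsub>game_algebra X rule\<^esub>}"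
  shows "\<exists>\<tau>. tracial_game_state X rule \<tau>"
proof -
  interpret N: nontrivial_coloured_pair I1 I2 "item_rel1 \<Lambda>1" "item_rel2 \<Lambda>2"
    by standard (rule iso_functional_exists[OF nz])
  note F = N.haar_in_iso_functionals
  let ?h = N.haar
  let ?m = "map orient"
  define \<tau> where "\<tau> = (\<lambda>w. ?h (?m w))"
  have out: "?h (a @ p # b) = 0" if "p \<notin> I1 \<times> I2" for a b p
    using that by (intro N.haar_outside) auto
  have "tracial_game_state X rule \<tau>"
  proof
    show "finite X" by (rule finite_items)
    show "(\<Sum>w\<in>C. \<Sum>v\<in>C. cnj (c w) * \<tau> (rev w @ v) * c v) \<in> \<real>\<^sub>\<ge>\<^sub>0" if "finite C" for C c
      using psd_pullback[where K = "\<lambda>w v. ?h (rev w @ v)" and g = ?m, OF N.haar_positive that]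
      by (simp add: \<tau>_def rev_map)
    show "\<tau> [] = 1" by (simp add: \<tau>_def N.haar_Nil)
    show "\<tau> (a @ b) = \<tau> (b @ a)" for a b by (simp add: \<tau>_def N.haar_commute)
    show "\<tau> w = 0" if bad: "\<not> set w \<subseteq> X \<times> X" for w
    proof -
      obtain p where p: "p \<in> set w" "p \<notin> X \<times> X" using bad by blast
      obtain a b where w: "w = a @ p # b" using split_list[OF p(1)] by blast
      have "orient p \<notin> I1 \<times> I2" using p(2) by (cases p) (auto simp: orient_def X_eq)
      from out[OF this] show ?thesis by (simp add: \<tau>_def w)
    qed
    show "game_functional X rule UNIV \<tau>"
      unfolding game_functional_def
    proof (intro conjI ballI impI)
      fix u v :: "(('v1, 'e1, 'v2, 'e2) item \<times> ('v1, 'e1, 'v2, 'e2) item) list" and x assume x: "x \<in> X"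
      show "\<tau> (u @ (x, a) # (x, a) # v) = \<tau> (u @ (x, a) # v)" for a
      proof (cases "orient (x, a) \<in> I1 \<times> I2")
        case True
        then obtain i j where "i \<in> I1" "j \<in> I2" "orient (x, a) = (i, j)" by (rule orient_inE)
        then show ?thesis using C.same_row[OF F, of i j j "?m u" "?m v"] by (simp add: \<tau>_def)
      next
        case False
        then show ?thesis by (simp add: \<tau>_def out)
      qed
      show "(\<Sum>a\<in>X. \<tau> (u @ (x, a) # v)) = \<tau> (u @ v)"
      proof (cases "x \<in> I1")
        case True
        have "(\<Sum>a\<in>X. \<tau> (u @ (x, a) # v)) = (\<Sum>a\<in>I2. \<tau> (u @ (x, a) # v))"
        proof (rule sum.mono_neutral_right)
          show "\<forall>a\<in>X - I2. \<tau> (u @ (x, a) # v) = 0"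
            using True disjoint by (auto simp: \<tau>_def orient_def intro!: out)
        qed (auto simp: X_eq finite_items)
        also have "\<dots> = \<tau> (u @ v)"
          using C.row_sum[OF F True, of "?m u" "?m v"] True by (simp add: \<tau>_def orient_simps)
        finally show ?thesis .
      next
        case False
        then have x2: "x \<in> I2" using x by (simp add: X_eq)
        have "(\<Sum>a\<in>X. \<tau> (u @ (x, a) # v)) = (\<Sum>a\<in>I1. \<tau> (u @ (x, a) # v))"
        proof (rule sum.mono_neutral_right)
          show "\<forall>a\<in>X - I1. \<tau> (u @ (x, a) # v) = 0"
            using False by (auto simp: \<tau>_def orient_def intro!: out)
        qed (auto simp: X_eq finite_items)
        also have "\<dots> = \<tau> (u @ v)"
          using C.col_sum[OF F x2, of "?m u" "?m v"] x2 by (simp add: \<tau>_def orient_simps)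
        finally show ?thesis .
      qed
    next
      fix u v :: "(('v1, 'e1, 'v2, 'e2) item \<times> ('v1, 'e1, 'v2, 'e2) item) list" and x y a b
      assume nr: "\<not> rule x y a b"
      show "\<tau> (u @ (x, a) # (y, b) # v) = 0"
      proof (cases "orient (x, a) \<in> I1 \<times> I2 \<and> orient (y, b) \<in> I1 \<times> I2")
        case True
        obtain i j where ij: "i \<in> I1" "j \<in> I2" "orient (x, a) = (i, j)" "(x, a) = (i, j) \<or> (x, a) = (j, i)"
          by (rule orient_inE[OF conjunct1[OF True]])
        obtain k l where kl: "k \<in> I1" "l \<in> I2" "orient (y, b) = (k, l)" "(y, b) = (k, l) \<or> (y, b) = (l, k)"
          by (rule orient_inE[OF conjunct2[OF True]])
        have eq: "\<tau> (u @ (x, a) # (y, b) # v) = ?h (?m u @ (i, j) # (k, l) # ?m v)"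
          by (simp add: \<tau>_def ij(3) kl(3))
        have "item_rel1 \<Lambda>1 i k \<noteq> item_rel2 \<Lambda>2 j l \<or> item_rel1 \<Lambda>1 i i \<noteq> item_rel2 \<Lambda>2 j j \<or>
            item_rel1 \<Lambda>1 k k \<noteq> item_rel2 \<Lambda>2 l l"
          using rule_intro[OF ij(1) kl(1) ij(2) kl(2) _ _ _ ij(4) kl(4)] nr by blast
        then consider "item_rel1 \<Lambda>1 i k \<noteq> item_rel2 \<Lambda>2 j l" | "item_rel1 \<Lambda>1 i i \<noteq> item_rel2 \<Lambda>2 j j"
          | "item_rel1 \<Lambda>1 k k \<noteq> item_rel2 \<Lambda>2 l l" by blast
        then show ?thesis
        proof cases
          case 1
          from C.mismatch[OF F ij(1) kl(1) ij(2) kl(2) this] show ?thesis by (simp add: eq)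
        next
          case 2
          have "?h (?m u @ (i, j) # (i, j) # (k, l) # ?m v) = 0"
            by (rule C.mismatch[OF F ij(1) ij(1) ij(2) ij(2) 2])
          then show ?thesis using C.same_row[OF F ij(1) ij(2) ij(2), of "?m u" "(k, l) # ?m v"] by (simp add: eq)
        next
          case 3
          have "?h ((?m u @ [(i, j)]) @ (k, l) # (k, l) # ?m v) = 0"
            by (rule C.mismatch[OF F kl(1) kl(1) kl(2) kl(2) 3])
          then show ?thesis
            using C.same_row[OF F kl(1) kl(2) kl(2), of "?m u @ [(i, j)]" "?m v"] by (simp add: eq)
        qed
      next
        case False
        then show ?thesis using out[of "orient (x, a)" "?m u" "orient (y, b) # ?m v"]
            out[of "orient (y, b)" "?m u @ [orient (x, a)]" "?m v"] by (auto simp: \<tau>_def)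
      qed
    qed
  qed
  then show ?thesis by blast
qed

end

theorem theorem4p6:
  fixes \<Lambda>1 :: "('v1, 'e1) hypergraph" and \<Lambda>2 :: "('v2, 'e2) hypergraph"
  assumes "hypergraph \<Lambda>1" and "hypergraph \<Lambda>2"
    and universe: "\<exists>f :: complex \<Rightarrow> 'h. inj f"
  shows "(qc_isomorphic TYPE('h) \<Lambda>1 \<Lambda>2 \<longleftrightarrow> cstar_isomorphic TYPE('h) \<Lambda>1 \<Lambda>2) \<and>
         (cstar_isomorphic TYPE('h) \<Lambda>1 \<Lambda>2 \<longleftrightarrow> astar_isomorphic \<Lambda>1 \<Lambda>2)"
proof -
  let ?X = "iso_items \<Lambda>1 \<Lambda>2 :: ('v1, 'e1, 'v2, 'e2) item set" and ?rule = "hyp_iso_rule \<Lambda>1 \<Lambda>2"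
  have pair: "hypergraph_pair \<Lambda>1 \<Lambda>2" using assms(1,2) by (rule hypergraph_pair.intro)
  note defs = qc_isomorphic_def cstar_isomorphic_def astar_isomorphic_def hyp_iso_algebra_def
  have algebra: "qc_isomorphic TYPE('h) \<Lambda>1 \<Lambda>2 \<and> cstar_isomorphic TYPE('h) \<Lambda>1 \<Lambda>2"
    if a: "astar_isomorphic \<Lambda>1 \<Lambda>2"
  proof -
    obtain \<tau> where \<tau>: "tracial_game_state ?X ?rule \<tau>"
      using hypergraph_pair.tracial_state_exists[OF pair a[unfolded defs]] by (rule exE)
    show ?thesis
      unfolding defs by (rule conjI[OF tracial_game_state.realisations[OF \<tau> universe]])
  qed
  have qc: "astar_isomorphic \<Lambda>1 \<Lambda>2" if "qc_isomorphic TYPE('h) \<Lambda>1 \<Lambda>2"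
    unfolding defs
    by (rule qc_strategy_nonzero[OF that[unfolded defs] hypergraph_pair.finite_items(3)[OF pair]
          hypergraph_pair.rule_synchronous[OF pair]])
  have cstar: "astar_isomorphic \<Lambda>1 \<Lambda>2" if c: "cstar_isomorphic TYPE('h) \<Lambda>1 \<Lambda>2"
  proof -
    obtain H :: "'h hilbert" where H: "hilbert_space H" "carrier H \<noteq> {\<zero>\<^bsub>H\<^esub>}"
      and "star_hom (game_algebra ?X ?rule) (op_algebra H) \<noteq> {}"
      using c unfolding defs by (elim exE conjE)
    then obtain h where "h \<in> star_hom (game_algebra ?X ?rule) (op_algebra H)" by blast
    then show ?thesis unfolding defs by (rule representation_nonzero[OF H])
  qed
  show ?thesis using algebra qc cstar by (intro conjI iffI) simp_all
qed

end
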